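(* Let $k$ be a positive integer. Then, given a graph $G$, a finite family $\mathcal{H}=\{H_j\}_{j\in J}$ of connected nonnull subgraphs of $G$, and a weight function $w:J\to\mathbb{Q}_+$, the Max Weight Independent Packing problem can be solved in time $$\mathcal{O}\Big(|J|\cdot\big((|J|+|V(T)|)\cdot|V(G)|+|E(G)|+|J|^{k}\cdot|V(T)|\big)\Big)$$ if $G$ is given together with a tree decomposition $\mathcal{T}=(T,\{X_t\}_{t\in V(T)})$ with independence number at most $k$.
   Context: All graphs are finite, simple, and undirected; a graph is nonnull if it has at least one vertex; $\mathbb{Q}_+$ is the set of nonnegative rationals. A tree decomposition of a graph $G$ is a pair $\mathcal{T}=(T,\{X_t\}_{t\in V(T)})$ where $T$ is a tree and each node $t$ is assigned a bag $X_t\subseteq V(G)$ such that every vertex of $G$ is in at least one bag, every edge of $G$ has both endpoints in some common bag, and for every $u\in V(G)$ the subgraph of $T$ induced by $\{t: u\in X_t\}$ is connected. The independence number of $\mathcal{T}$ is $\alpha(\mathcal{T})=\max_{t\in V(T)}\alpha(G[X_t])$, where $\alpha(H)$ is the maximum size of an independent set in $H$. Given $G$ and a finite family $\mathcal{H}=\{H_j\}_{j\in J}$ of connected nonnull subgraphs of $G$, an independent $\mathcal{H}$-packing in $G$ is a subfamily $\{H_i\}_{i\in I}$, $I\subseteq J$, such that every two of its members are vertex-disjoint and there is no edge of $G$ between them. Given also $w:J\to\mathbb{Q}_+$, the weight of $\{H_i\}_{i\in I}$ is $\sum_{i\in I}w(i)$. The Max Weight Independent Packing problem asks to find an independent $\mathcal{H}$-packing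 in $G$ of maximum weight. The integer $k$ is fixed (not part of the input). *)

theory Defs
  imports Complex_Main
begin

section \<open>Graphs and tree decompositions\<close>

datatype 'a graph = Graph (verts: "'a set") (edges: "'a set set")

definition simple_graph :: "'a graph \<Rightarrow> bool" where
  "simple_graph G \<longleftrightarrow> finite (verts G) \<and>
     (\<forall>e\<in>edges G. \<exists>u v. e = {u, v} \<and> u \<noteq> v \<and> u \<in> verts G \<and> v \<in> verts G)"

definition subgraph :: "'a graph \<Rightarrow> 'a graph \<Rightarrow> bool" where
  "subgraph H G \<longleftrightarrow> simple_graph H \<and> verts H \<subseteq> verts G \<and> edges H \<subseteq> edges G"

definition nonnull :: "'a graph \<Rightarrow> bool" where
  "nonnull G \<longleftrightarrow> verts G \<noteq> {}"

definition induced :: "'a graph \<Rightarrow> 'a set \<Rightarrow> 'a graph" where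
  "induced G S = Graph (verts G \<inter> S) {e \<in> edges G. e \<subseteq> S}"

definition connected_graph :: "'a graph \<Rightarrow> bool" where
  "connected_graph G \<longleftrightarrow>
     (\<forall>u\<in>verts G. \<forall>v\<in>verts G. (u, v) \<in> {(x, y). {x, y} \<in> edges G}\<^sup>*)"

definition is_cycle :: "'a graph \<Rightarrow> 'a list \<Rightarrow> bool" where
  "is_cycle G p \<longleftrightarrow> length p \<ge> 3 \<and> distinct p \<and> set p \<subseteq> verts G \<and>
     (\<forall>i<length p. {p ! i, p ! (Suc i mod length p)} \<in> edges G)"

definition is_tree :: "'a graph \<Rightarrow> bool" where
  "is_tree T \<longleftrightarrow> simple_graph T \<and> nonnull T \<and> connected_graph T \<and> (\<nexists>p. is_cycle T p)"

definition tree_decomposition :: "'a graph \<Rightarrow> 'b graph \<Rightarrow> ('b \<Rightarrow> 'a set) \<Rightarrow> bool" where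
  "tree_decomposition G T X \<longleftrightarrow> is_tree T \<and>
     (\<forall>t\<in>verts T. X t \<subseteq> verts G) \<and>
     (\<forall>u\<in>verts G. \<exists>t\<in>verts T. u \<in> X t) \<and>
     (\<forall>e\<in>edges G. \<exists>t\<in>verts T. e \<subseteq> X t) \<and>
     (\<forall>u\<in>verts G. connected_graph (induced T {t \<in> verts T. u \<in> X t}))"

definition independent_set :: "'a graph \<Rightarrow> 'a set \<Rightarrow> bool" where
  "independent_set G S \<longleftrightarrow> S \<subseteq> verts G \<and> (\<forall>u\<in>S. \<forall>v\<in>S. {u, v} \<notin> edges G)"

definition independence_number :: "'a graph \<Rightarrow> nat" where
  "independence_number G = Max (card ` {S. independent_set G S})"

definition td_independence_number :: "'a graph \<Rightarrow> 'b graph \<Rightarrow> ('b \<Rightarrow> 'a set) \<Rightarrow> nat" where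
  "td_independence_number G T X = Max ((\<lambda>t. independence_number (induced G (X t))) ` verts T)"


section \<open>Independent packings\<close>

text \<open>A subfamily is given by its index set, so two members with different indices count as two
  members even if they are equal as graphs (and then they are not disjoint).\<close>

definition independent_packing :: "'a graph \<Rightarrow> 'j set \<Rightarrow> ('j \<Rightarrow> 'a graph) \<Rightarrow> 'j set \<Rightarrow> bool" where
  "independent_packing G J H I \<longleftrightarrow> I \<subseteq> J \<and>
     (\<forall>i\<in>I. \<forall>j\<in>I. i \<noteq> j \<longrightarrow>
        verts (H i) \<inter> verts (H j) = {} \<and>
        (\<forall>u\<in>verts (H i). \<forall>v\<in>verts (H j). {u, v} \<notin> edges G))"

definition max_weight_independent_packing ::
    "'a graph \<Rightarrow> 'j set \<Rightarrow> ('j \<Rightarrow> 'a graph) \<Rightarrow> ('j \<Rightarrow> rat) \<Rightarrow> 'j set \<Rightarrow> bool" where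
  "max_weight_independent_packing G J H w I \<longleftrightarrow> independent_packing G J H I \<and>
     (\<forall>I'. independent_packing G J H I' \<longrightarrow> sum w I' \<le> sum w I)"


section \<open>Random access machines\<close>

text \<open>
  The machine model is the unit-cost RAM with addition and subtraction, but no multiplication, as
  primitive arithmetic (Cook and Reckhow), presented with structured control flow.  The memory
  consists of numbered arrays, each with infinitely many cells.  A program can only name finitely
  many arrays, so they could be interleaved in a single one at the price of a constant factor.

  Natural numbers and weights are kept apart.  Weights are rational numbers, which can only be
  moved, added, subtracted and compared, each at unit cost.  In particular a weight can neither be
  used as an address nor be converted to a natural number.
\<close>

record state =
  nmem :: "nat \<Rightarrow> nat \<Rightarrow> nat"
  wmem :: "nat \<Rightarrow> nat \<Rightarrow> rat"

datatype nexp =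
    NConst nat
  | NCell nat nexp
  | NPlus nexp nexp
  | NMinus nexp nexp

datatype wexp =
    WZero
  | WCell nat nexp
  | WPlus wexp wexp
  | WMinus wexp wexp

datatype bexp =
    NLess nexp nexp
  | WLess wexp wexp
  | Not bexp
  | And bexp bexp

datatype com =
    Skip
  | NAssign nat nexp nexp
  | WAssign nat nexp wexp
  | Seq com com
  | If bexp com com
  | While bexp com

primrec nval :: "nexp \<Rightarrow> state \<Rightarrow> nat" where
  "nval (NConst c) s = c"
| "nval (NCell a e) s = nmem s a (nval e s)"
| "nval (NPlus e f) s = nval e s + nval f s"
| "nval (NMinus e f) s = nval e s - nval f s"

primrec wval :: "wexp \<Rightarrow> state \<Rightarrow> rat" where
  "wval WZero s = 0"
| "wval (WCell a e) s = wmem s a (nval e s)"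
| "wval (WPlus e f) s = wval e s + wval f s"
| "wval (WMinus e f) s = wval e s - wval f s"

primrec bval :: "bexp \<Rightarrow> state \<Rightarrow> bool" where
  "bval (NLess e f) s = (nval e s < nval f s)"
| "bval (WLess e f) s = (wval e s < wval f s)"
| "bval (Not b) s = (\<not> bval b s)"
| "bval (And b c) s = (bval b s \<and> bval c s)"

primrec ncost :: "nexp \<Rightarrow> nat" where
  "ncost (NConst c) = 1"
| "ncost (NCell a e) = 1 + ncost e"
| "ncost (NPlus e f) = 1 + ncost e + ncost f"
| "ncost (NMinus e f) = 1 + ncost e + ncost f"

primrec wcost :: "wexp \<Rightarrow> nat" where
  "wcost WZero = 1"
| "wcost (WCell a e) = 1 + ncost e"
| "wcost (WPlus e f) = 1 + wcost e + wcost f"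
| "wcost (WMinus e f) = 1 + wcost e + wcost f"

primrec bcost :: "bexp \<Rightarrow> nat" where
  "bcost (NLess e f) = 1 + ncost e + ncost f"
| "bcost (WLess e f) = 1 + wcost e + wcost f"
| "bcost (Not b) = 1 + bcost b"
| "bcost (And b c) = 1 + bcost b + bcost c"

definition nupdate :: "nat \<Rightarrow> nat \<Rightarrow> nat \<Rightarrow> state \<Rightarrow> state" where
  "nupdate a i x s = s\<lparr>nmem := (nmem s)(a := (nmem s a)(i := x))\<rparr>"

definition wupdate :: "nat \<Rightarrow> nat \<Rightarrow> rat \<Rightarrow> state \<Rightarrow> state" where
  "wupdate a i x s = s\<lparr>wmem := (wmem s)(a := (wmem s a)(i := x))\<rparr>"

text \<open>\<open>run P s c s'\<close>: started in \<open>s\<close>, program \<open>P\<close> halts in \<open>s'\<close> after exactly \<open>c\<close> elementary steps.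
  Diverging programs have no derivation.\<close>

inductive run :: "com \<Rightarrow> state \<Rightarrow> nat \<Rightarrow> state \<Rightarrow> bool" where
  Skip: "run Skip s 1 s"
| NAssign: "run (NAssign a e f) s (1 + ncost e + ncost f) (nupdate a (nval e s) (nval f s) s)"
| WAssign: "run (WAssign a e f) s (1 + ncost e + wcost f) (wupdate a (nval e s) (wval f s) s)"
| Seq: "run P s c s' \<Longrightarrow> run Q s' d s'' \<Longrightarrow> run (Seq P Q) s (c + d) s''"
| IfTrue: "bval b s \<Longrightarrow> run P s c s' \<Longrightarrow> run (If b P Q) s (1 + bcost b + c) s'"
| IfFalse: "\<not> bval b s \<Longrightarrow> run Q s c s' \<Longrightarrow> run (If b P Q) s (1 + bcost b + c) s'"
| WhileFalse: "\<not> bval b s \<Longrightarrow> run (While b P) s (1 + bcost b) s"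
| WhileTrue: "bval b s \<Longrightarrow> run P s c s' \<Longrightarrow> run (While b P) s' d s'' \<Longrightarrow>
    run (While b P) s (1 + bcost b + c + d) s''"

inductive_cases run_SkipE: "run Skip s c s'"
inductive_cases run_NAssignE: "run (NAssign a e f) s c s'"
inductive_cases run_WAssignE: "run (WAssign a e f) s c s'"
inductive_cases run_SeqE: "run (Seq P Q) s c s'"
inductive_cases run_IfE: "run (If b P Q) s c s'"
inductive_cases run_WhileE: "run (While b P) s c s'"

lemma run_deterministic: "run P s c s' \<Longrightarrow> run P s d s'' \<Longrightarrow> c = d \<and> s' = s''"
proof (induction arbitrary: d s'' rule: run.induct)
  case (Skip s)
  from Skip.prems show ?case by (rule run_SkipE) simp
next
  case (NAssign a e f s)
  from NAssign.prems show ?case by (rule run_NAssignE) simp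
next
  case (WAssign a e f s)
  from WAssign.prems show ?case by (rule run_WAssignE) simp
next
  case (Seq P s c s' Q d' t)
  from Seq.prems obtain c1 c2 r where "run P s c1 r" "run Q r c2 s''" "d = c1 + c2"
    by (rule run_SeqE)
  with Seq.IH show ?case by metis
next
  case (IfTrue b s P c s' Q)
  from IfTrue.prems obtain c1 where "run P s c1 s''" "d = 1 + bcost b + c1"
    by (rule run_IfE) (use IfTrue.hyps in simp_all)
  with IfTrue.IH show ?case by metis
next
  case (IfFalse b s Q c s' P)
  from IfFalse.prems obtain c1 where "run Q s c1 s''" "d = 1 + bcost b + c1"
    by (rule run_IfE) (use IfFalse.hyps in simp_all)
  with IfFalse.IH show ?case by metis
next
  case (WhileFalse b s P)
  from WhileFalse.prems show ?case by (rule run_WhileE) (use WhileFalse.hyps in simp_all)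
next
  case (WhileTrue b s P c s' d' t)
  from WhileTrue.prems obtain c1 c2 r where
    "run P s c1 r" "run (While b P) r c2 s''" "d = 1 + bcost b + c1 + c2"
    by (rule run_WhileE) (use WhileTrue.hyps in simp_all)
  with WhileTrue.IH show ?case by metis
qed


section \<open>Input and output\<close>

text \<open>The input words are in natural number array 0 and the weights in weight array 0; all other
  cells are 0.\<close>

definition init_state :: "nat list \<Rightarrow> rat list \<Rightarrow> state" where
  "init_state xs ws =
     \<lparr>nmem = (\<lambda>a i. if a = 0 \<and> i < length xs then xs ! i else 0),
      wmem = (\<lambda>a i. if a = 0 \<and> i < length ws then ws ! i else 0)\<rparr>"

text \<open>The output is the subset of the index set whose characteristic function is in natural number
  array 1.\<close>

definition output_set :: "nat set \<Rightarrow> state \<Rightarrow> nat set" where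
  "output_set J s = {j \<in> J. nmem s 1 j \<noteq> 0}"

definition lists_set :: "nat list \<Rightarrow> nat set \<Rightarrow> bool" where
  "lists_set vs V \<longleftrightarrow> distinct vs \<and> set vs = V"

definition lists_edges :: "(nat \<times> nat) list \<Rightarrow> nat set set \<Rightarrow> bool" where
  "lists_edges es E \<longleftrightarrow>
     distinct (map (\<lambda>(u, v). {u, v}) es) \<and> set (map (\<lambda>(u, v). {u, v}) es) = E"

definition enc_set :: "nat list \<Rightarrow> nat list" where
  "enc_set vs = length vs # vs"

definition enc_edges :: "(nat \<times> nat) list \<Rightarrow> nat list" where
  "enc_edges es = length es # concat (map (\<lambda>(u, v). [u, v]) es)"

text \<open>\<open>V(G)\<close>, \<open>J\<close> and \<open>V(T)\<close> are initial segments of the natural numbers, of sizes \<open>n\<close>, \<open>m\<close>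
  and \<open>q\<close>.  Edge sets are given as plain edge lists, bags as vertex lists, and the members of the
  family by their vertex and edge lists.  All lists are free of repetitions and preceded by their
  lengths, but their order, and the order of the endpoints of an edge, are arbitrary; hence an
  instance has many encodings.\<close>

definition encodes ::
    "nat list \<Rightarrow> rat list \<Rightarrow> nat graph \<Rightarrow> nat set \<Rightarrow> (nat \<Rightarrow> nat graph) \<Rightarrow> (nat \<Rightarrow> rat) \<Rightarrow>
     nat graph \<Rightarrow> (nat \<Rightarrow> nat set) \<Rightarrow> bool" where
  "encodes xs ws G J H w T X \<longleftrightarrow>
     (\<exists>n m q gs ts bags fam.
        verts G = {..<n} \<and> J = {..<m} \<and> verts T = {..<q} \<and>
        lists_edges gs (edges G) \<and> lists_edges ts (edges T) \<and>
        length bags = q \<and> (\<forall>t<q. lists_set (bags ! t) (X t)) \<and>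
        length fam = m \<and>
        (\<forall>j<m. lists_set (fst (fam ! j)) (verts (H j)) \<and>
               lists_edges (snd (fam ! j)) (edges (H j))) \<and>
        xs = [n, m, q] @ enc_edges gs @ enc_edges ts @ concat (map enc_set bags) @
             concat (map (\<lambda>(vs, es). enc_set vs @ enc_edges es) fam) \<and>
        ws = map w [0..<m])"

end

theory Submission
  imports Defs
begin

text \<open>
  Two members of the family conflict if they share a vertex or are joined by an edge, so the problem
  is to find a maximum weight independent set of the conflict graph on the index set \<open>J\<close>.  Replacing
  each bag \<open>X t\<close> by the set \<open>Y t\<close> of all members that meet it gives a tree decomposition of the
  conflict graph on the same tree, and an independent set contained in \<open>Y t\<close> has at most \<open>k\<close>
  elements, because its members have pairwise non-adjacent representatives in \<open>X t\<close>.  Hence for every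
  node the independent subsets of \<open>Y t\<close> are among the \<open>O(m ^ k)\<close> lists of length at most \<open>k\<close> over
  \<open>J\<close>, where \<open>m = |J|\<close>.

  The tree is contracted leaf by leaf.  For every remaining node \<open>t\<close> and every independent list
  over \<open>Y t\<close> the program maintains an optimal solution, stored as an explicit subset of \<open>J\<close>, within
  the part of the tree that has been contracted into \<open>t\<close>, among those that meet \<open>Y t\<close> exactly in that
  list.  To merge a leaf \<open>x\<close> into its neighbour \<open>p\<close>, the lists of \<open>x\<close> are grouped by their restriction
  to \<open>Y p\<close> (the sublist of their elements in \<open>Y p\<close>), the best one of each group is selected, and it is
  combined with the lists of \<open>p\<close> that have the same restriction to \<open>Y x\<close>.  Leaves are found without
  adjacency lists: it suffices to maintain, for each node, its degree and the sum of its remaining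
  neighbours, since for a leaf this sum is its only neighbour.
\<close>

section \<open>A program calculus with running times\<close>

text \<open>One merge may only cost \<open>O(m * K)\<close>, where \<open>K\<close> counts the lists
  of length at most \<open>k\<close>. Comparing all pairs of lists would cost \<open>K ^ 2\<close>;
  grouping by restriction leaves one pass over each side, and the factor \<open>m\<close> pays for
  copying a solution. Over at most \<open>q\<close> merges, \<open>q\<close> being the number of
  tree nodes, this is the last term of the bound. Hence freeness, weight and restriction of a list
  must be table lookups. As the machine neither multiplies nor divides, the tables indexed by lists
  are filled by recurrences that use earlier entries, and the products that serve as addresses are
  tabulated too. Restrictions are compared as lists, not as sets, so that equality is equality of
  codes; different orders of one set then belong to different groups. For correctness, the part of
  the tree behind a remaining node is a fibre of a map \<open>\<rho>\<close> onto the remaining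
  nodes. The only edge that leaves the fibre of a leaf goes to its neighbour, so the members met by
  both bags of this edge separate the two sides. The stored weight omits the list itself, and the
  stored set need not contain it; therefore zero memory is already the correct initial
  table.\<close>

definition ht :: "com \<Rightarrow> state \<Rightarrow> nat \<Rightarrow> (state \<Rightarrow> bool) \<Rightarrow> bool" where
  "ht P s B Q \<longleftrightarrow> (\<exists>c s'. run P s c s' \<and> c \<le> B \<and> Q s')"

lemma ht_mono:
  assumes "ht P s B Q" "B \<le> B'" "\<And>s'. Q s' \<Longrightarrow> Q' s'"
  shows "ht P s B' Q'"
  using assms unfolding ht_def by (meson order_trans)

lemma ht_Seq:
  assumes P: "ht P s b Q'" and R: "\<And>t. Q' t \<Longrightarrow> ht R t d Q" and "b + d \<le> B"
  shows "ht (Seq P R) s B Q"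
proof -
  obtain c t where 1: "run P s c t" "c \<le> b" "Q' t"
    using P unfolding ht_def by blast
  obtain c' s' where 2: "run R t c' s'" "c' \<le> d" "Q s'"
    using R[OF 1(3)] unfolding ht_def by blast
  have "run (Seq P R) s (c + c') s'" "c + c' \<le> B"
    using 1 2 assms(3) by (auto intro: run.Seq)
  with 2 show ?thesis unfolding ht_def by blast
qed

lemma ht_If:
  assumes "bval b s \<Longrightarrow> ht P s d Q" "\<not> bval b s \<Longrightarrow> ht R s d Q" "1 + bcost b + d \<le> B"
  shows "ht (If b P R) s B Q"
proof (cases "bval b s")
  case True
  then obtain c s' where "run P s c s'" "c \<le> d" "Q s'" using assms(1) unfolding ht_def by blast
  then show ?thesis unfolding ht_def using run.IfTrue[OF True] assms(3)
    by (intro exI[of _ "1 + bcost b + c"] exI[of _ s']) auto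
next
  case False
  then obtain c s' where "run R s c s'" "c \<le> d" "Q s'" using assms(2) unfolding ht_def by blast
  then show ?thesis unfolding ht_def using run.IfFalse[OF False] assms(3)
    by (intro exI[of _ "1 + bcost b + c"] exI[of _ s']) auto
qed

text \<open>The index of the invariant serves as variant: every iteration strictly lowers it, so
  there are at most \<open>N\<close> of them. The last summand \<open>1 + bcost b\<close> pays for
  the final test, which fails.\<close>

lemma ht_While:
  assumes "I N s"
    and body: "\<And>i s. I i s \<Longrightarrow> bval b s \<Longrightarrow> ht P s c (\<lambda>s'. \<exists>j<i. I j s')"
    and "N * (c + 1 + bcost b) + 1 + bcost b \<le> B"
  shows "ht (While b P) s B (\<lambda>s'. (\<exists>i. I i s') \<and> \<not> bval b s')"
proof -
  have "\<exists>d s'. run (While b P) s d s' \<and> d \<le> N * (c + 1 + bcost b) + 1 + bcost b \<and> (\<exists>i. I i s') \<and> \<not> bval b s'"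
    using assms(1)
  proof (induction N arbitrary: s rule: less_induct)
    case (less N)
    show ?case
    proof (cases "bval b s")
      case True
      obtain c1 s1 j where 1: "run P s c1 s1" "c1 \<le> c" "I j s1" "j < N"
        using body[OF less.prems True] unfolding ht_def by blast
      obtain d s2 where 2: "run (While b P) s1 d s2"
        "d \<le> j * (c + 1 + bcost b) + 1 + bcost b" "\<exists>i. I i s2" "\<not> bval b s2"
        using less.IH[OF 1(4) 1(3)] by blast
      have "Suc j * (c + 1 + bcost b) \<le> N * (c + 1 + bcost b)"
        using 1(4) by (intro mult_right_mono) auto
      then have "1 + bcost b + c1 + d \<le> N * (c + 1 + bcost b) + 1 + bcost b"
        using 1(2) 2(2) by simp
      with run.WhileTrue[OF True 1(1) 2(1)] 2 show ?thesis by blast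
    next
      case False
      with run.WhileFalse[OF False, of P] less.prems show ?thesis
        by (intro exI[of _ "1 + bcost b"] exI[of _ s]) auto
    qed
  qed
  then show ?thesis unfolding ht_def using assms(3) by (meson order_trans)
qed

section \<open>Straight-line programs\<close>

primrec loop_free :: "com \<Rightarrow> bool" where
  "loop_free Skip = True"
| "loop_free (NAssign a e f) = True"
| "loop_free (WAssign a e f) = True"
| "loop_free (Seq P R) = (loop_free P \<and> loop_free R)"
| "loop_free (If b P R) = (loop_free P \<and> loop_free R)"
| "loop_free (While b P) = False"

text \<open>Meant for loop-free programs only; the value at a loop is a dummy, as is that of
  \<open>lf_cost\<close>.\<close>

primrec sem :: "com \<Rightarrow> state \<Rightarrow> state" where
  "sem Skip s = s"
| "sem (NAssign a e f) s = nupdate a (nval e s) (nval f s) s"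
| "sem (WAssign a e f) s = wupdate a (nval e s) (wval f s) s"
| "sem (Seq P R) s = sem R (sem P s)"
| "sem (If b P R) s = (if bval b s then sem P s else sem R s)"
| "sem (While b P) s = s"

primrec lf_cost :: "com \<Rightarrow> nat" where
  "lf_cost Skip = 1"
| "lf_cost (NAssign a e f) = 1 + ncost e + ncost f"
| "lf_cost (WAssign a e f) = 1 + ncost e + wcost f"
| "lf_cost (Seq P R) = lf_cost P + lf_cost R"
| "lf_cost (If b P R) = 1 + bcost b + max (lf_cost P) (lf_cost R)"
| "lf_cost (While b P) = 0"

lemma run_loop_free: "loop_free P \<Longrightarrow> \<exists>c. run P s c (sem P s) \<and> c \<le> lf_cost P"
proof (induction P arbitrary: s)
  case (Seq P R)
  obtain c where c: "run P s c (sem P s)" "c \<le> lf_cost P" using Seq by auto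
  obtain d where d: "run R (sem P s) d (sem R (sem P s))" "d \<le> lf_cost R" using Seq by auto
  show ?case using run.Seq[OF c(1) d(1)] c(2) d(2) by auto
next
  case (If b P R)
  show ?case
  proof (cases "bval b s")
    case True
    obtain c where "run P s c (sem P s)" "c \<le> lf_cost P" using If by auto
    with run.IfTrue[OF True] True show ?thesis by (intro exI[of _ "1 + bcost b + c"]) auto
  next
    case False
    obtain c where "run R s c (sem R s)" "c \<le> lf_cost R" using If by auto
    with run.IfFalse[OF False] False show ?thesis by (intro exI[of _ "1 + bcost b + c"]) auto
  qed
next
  case Skip
  show ?case using run.Skip by fastforce
next
  case (NAssign a e f)
  show ?case using run.NAssign by fastforce
next
  case (WAssign a e f)
  show ?case using run.WAssign by fastforce
qed simp

text \<open>Reduces straight-line code to symbolic evaluation: what remains is to simplify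
  \<open>sem\<close> and to compare the cost with a number.\<close>

lemma ht_loop_free:
  assumes "loop_free P" "lf_cost P \<le> B" "Q (sem P s)"
  shows "ht P s B Q"
  using run_loop_free[OF assms(1), of s] assms(2,3) unfolding ht_def by (meson order_trans)

lemma nmem_nupdate [simp]:
  "nmem (nupdate a i x s) b = (if b = a then (nmem s a)(i := x) else nmem s b)"
  by (simp add: nupdate_def)

lemma wmem_nupdate [simp]: "wmem (nupdate a i x s) = wmem s"
  by (simp add: nupdate_def)

lemma nmem_wupdate [simp]: "nmem (wupdate a i x s) = nmem s"
  by (simp add: wupdate_def)

lemma wmem_wupdate [simp]:
  "wmem (wupdate a i x s) b = (if b = a then (wmem s a)(i := x) else wmem s b)"
  by (simp add: wupdate_def)

text \<open>A scalar variable is cell 0 of an array of its own.\<close>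

abbreviation V :: "nat \<Rightarrow> nexp" where "V a \<equiv> NCell a (NConst 0)"
abbreviation Set :: "nat \<Rightarrow> nexp \<Rightarrow> com" where "Set a e \<equiv> NAssign a (NConst 0) e"
abbreviation NEq :: "nexp \<Rightarrow> nexp \<Rightarrow> bexp" where
  "NEq e f \<equiv> And (Not (NLess e f)) (Not (NLess f e))"
abbreviation NonZero :: "nexp \<Rightarrow> bexp" where "NonZero e \<equiv> NLess (NConst 0) e"
abbreviation Or :: "bexp \<Rightarrow> bexp \<Rightarrow> bexp" where "Or b c \<equiv> Not (And (Not b) (Not c))"

definition For :: "nat \<Rightarrow> nexp \<Rightarrow> com \<Rightarrow> com" where
  "For v e P = Seq (Set v (NConst 0))
     (While (NLess (V v) e) (Seq P (Set v (NPlus (V v) (NConst 1)))))"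

text \<open>The limit \<open>e\<close> is evaluated anew at every test, so the invariant has to keep
  its value at \<open>N\<close>. The body may use the counter but must leave it unchanged at its
  end. The summand \<open>ncost e + 10\<close> of each round is the exact price of the test and the
  increment.\<close>

lemma ht_For:
  assumes init: "I 0 (nupdate v 0 0 s)"
    and bound: "\<And>i s. i \<le> N \<Longrightarrow> I i s \<Longrightarrow> nval e s = N"
    and step: "\<And>i s. i < N \<Longrightarrow> I i s \<Longrightarrow> nmem s v 0 = i \<Longrightarrow>
      ht P s b (\<lambda>s'. nmem s' v 0 = i \<and> I (Suc i) (nupdate v 0 (Suc i) s'))"
    and cost: "N * (b + ncost e + 10) + ncost e + 10 \<le> B"
  shows "ht (For v e P) s B (I N)"
proof -
  let ?J = "\<lambda>j s. nmem s v 0 + j = N \<and> I (nmem s v 0) s"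
  have loop: "ht (While (NLess (V v) e) (Seq P (Set v (NPlus (V v) (NConst 1))))) t
      (N * (b + ncost e + 10) + ncost e + 5) (\<lambda>s'. (\<exists>j. ?J j s') \<and> \<not> bval (NLess (V v) e) s')"
    if "t = nupdate v 0 0 s" for t
  proof (rule ht_While[where I = ?J and N = N and c = "b + 6"])
    show "?J N t" using init that by simp
  next
    fix j s assume J: "?J j s" and lt: "bval (NLess (V v) e) s"
    define i where "i = nmem s v 0"
    have i: "i < N" "I i s" using bound[of "nmem s v 0" s] J lt by (auto simp: i_def)
    show "ht (Seq P (Set v (NPlus (V v) (NConst 1)))) s (b + 6) (\<lambda>s'. \<exists>j'<j. ?J j' s')"
    proof (rule ht_Seq[OF step[OF i]])
      show "nmem s v 0 = i" by (simp add: i_def)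
    next
      fix s' assume "nmem s' v 0 = i \<and> I (Suc i) (nupdate v 0 (Suc i) s')"
      then show "ht (Set v (NPlus (V v) (NConst 1))) s' 6 (\<lambda>s'. \<exists>j'<j. ?J j' s')"
        using i J by (intro ht_loop_free exI[of _ "j - 1"]) (auto simp: i_def)
    qed simp
  qed (simp add: algebra_simps)
  show ?thesis unfolding For_def
  proof (rule ht_Seq)
    show "ht (Set v (NConst 0)) s 3 (\<lambda>t. t = nupdate v 0 0 s)" by (rule ht_loop_free) auto
    show "ht (While (NLess (V v) e) (Seq P (Set v (NPlus (V v) (NConst 1))))) t
      (N * (b + ncost e + 10) + ncost e + 5) (I N)" if "t = nupdate v 0 0 s" for t
    proof (rule ht_mono[OF loop[OF that]], goal_cases)
      case (2 s')
      then obtain j where "nmem s' v 0 + j = N" "I (nmem s' v 0) s'" "\<not> nmem s' v 0 < nval e s'" by auto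
      moreover from this have "nmem s' v 0 = N" using bound[of "nmem s' v 0" s'] by simp
      ultimately show ?case by simp
    qed simp
  qed (use cost in simp)
qed

lemma ht_Seq_sum:
  assumes "ht P s b Q'" "\<And>t. Q' t \<Longrightarrow> ht R t d Q"
  shows "ht (Seq P R) s (b + d) Q"
  by (rule ht_Seq[OF assms(1) assms(2) order_refl])

section \<open>Which arrays a program may change\<close>

definition frame :: "nat set \<Rightarrow> nat set \<Rightarrow> state \<Rightarrow> state \<Rightarrow> bool" where
  "frame M W s s' \<longleftrightarrow> (\<forall>a. a \<notin> M \<longrightarrow> nmem s' a = nmem s a) \<and> (\<forall>a. a \<notin> W \<longrightarrow> wmem s' a = wmem s a)"

lemma frame_refl [simp]: "frame M W s s"
  by (simp add: frame_def)

lemma frame_nmem: "frame M W s s' \<Longrightarrow> a \<notin> M \<Longrightarrow> nmem s' a = nmem s a"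
  by (simp add: frame_def)

lemma frame_wmem: "frame M W s s' \<Longrightarrow> a \<notin> W \<Longrightarrow> wmem s' a = wmem s a"
  by (simp add: frame_def)

lemma frame_trans:
  "frame M W s s' \<Longrightarrow> frame M' W' s' s'' \<Longrightarrow> M \<subseteq> N \<Longrightarrow> M' \<subseteq> N \<Longrightarrow> W \<subseteq> Z \<Longrightarrow> W' \<subseteq> Z \<Longrightarrow>
    frame N Z s s''"
  unfolding frame_def by (metis subsetD)

lemma frame_mono: "frame M W s s' \<Longrightarrow> M \<subseteq> N \<Longrightarrow> W \<subseteq> Z \<Longrightarrow> frame N Z s s'"
  unfolding frame_def by blast

lemma frame_nupdate [simp]: "a \<in> M \<Longrightarrow> frame M W s (nupdate a i x s') \<longleftrightarrow> frame M W s s'"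
  unfolding frame_def by auto

lemma frame_wupdate [simp]: "a \<in> W \<Longrightarrow> frame M W s (wupdate a i x s') \<longleftrightarrow> frame M W s s'"
  unfolding frame_def by auto

section \<open>Trees and their contractions\<close>

text \<open>Both neighbours of the first vertex of a longest path lie on that path, or it could be
  prolonged. The one that is not its second vertex closes a cycle.\<close>

lemma min_degree_two_imp_cycle:
  assumes fin: "finite S" and ne: "S \<noteq> {}" and sub: "S \<subseteq> verts G"
    and noloop: "\<And>v. {v} \<notin> edges G"
    and deg: "\<And>v. v \<in> S \<Longrightarrow> \<exists>a\<in>S. \<exists>b\<in>S. a \<noteq> b \<and> {v, a} \<in> edges G \<and> {v, b} \<in> edges G"
  shows "\<exists>p. is_cycle G p"
proof -
  define path where "path = (\<lambda>p. p \<noteq> [] \<and> distinct p \<and> set p \<subseteq> S \<and>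
    (\<forall>i. Suc i < length p \<longrightarrow> {p ! i, p ! Suc i} \<in> edges G))"
  obtain v0 where "v0 \<in> S" using ne by blast
  then have "path [v0]" by (simp add: path_def)
  moreover have "length p \<le> card S" if "path p" for p
    using that card_mono[OF fin, of "set p"] by (simp add: path_def distinct_card)
  ultimately obtain p where p: "path p" and max: "\<And>p'. path p' \<Longrightarrow> length p' \<le> length p"
    using ex_has_greatest_nat[of path "[v0]" length "Suc (card S)"] by fastforce
  then obtain v ps where vps: "p = v # ps" by (auto simp: path_def neq_Nil_conv)
  have in_p: "w \<in> set p" if "w \<in> S" "{v, w} \<in> edges G" for w
  proof (rule ccontr)
    assume "w \<notin> set p"
    then have "path (w # p)"
      using p that unfolding path_def vps by (auto simp: nth_Cons insert_commute split: nat.splits)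
    with max show False by fastforce
  qed
  have "v \<in> S" using p vps by (simp add: path_def)
  then obtain a b where ab: "a \<in> S" "b \<in> S" "a \<noteq> b" "{v, a} \<in> edges G" "{v, b} \<in> edges G"
    using deg by blast
  \<comment> \<open>\<open>p ! 1\<close> is the successor of \<open>v\<close> on the path; at most
    one of the two neighbours equals it.\<close>
  obtain w where w: "w \<in> S" "{v, w} \<in> edges G" "w \<noteq> p ! 1"
    using ab by (cases "a = p ! 1") auto
  obtain i where i: "i < length p" "p ! i = w" using in_p[OF w(1,2)] by (auto simp: in_set_conv_nth)
  have "i \<noteq> 0" using i w noloop[of v] vps by (cases "i = 0") auto
  moreover have "i \<noteq> 1" using i w by auto
  ultimately have i2: "i \<ge> 2" by linarith
  define c where "c = take (Suc i) p"
  have len: "length c = Suc i" using i by (simp add: c_def)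
  have nth: "c ! j = p ! j" if "j \<le> i" for j using that by (simp add: c_def)
  have "{c ! j, c ! (Suc j mod length c)} \<in> edges G" if "j < length c" for j
  proof (cases "j = i")
    case True
    then show ?thesis using len nth i w vps by (simp add: insert_commute)
  next
    case False
    then have "j < i" using that len by simp
    then show ?thesis using len nth i p by (simp add: path_def)
  qed
  moreover have "distinct c" "set c \<subseteq> verts G"
    using p sub set_take_subset[of "Suc i" p] by (auto simp: path_def c_def)
  ultimately have "is_cycle G c" using len i2 unfolding is_cycle_def by auto
  then show ?thesis ..
qed

lemma is_cycle_mono:
  "is_cycle G p \<Longrightarrow> verts G \<subseteq> verts G' \<Longrightarrow> edges G \<subseteq> edges G' \<Longrightarrow> is_cycle G' p"
  unfolding is_cycle_def by blast

text \<open>Some vertex has at most one neighbour, and deleting it loses at most one edge. The bound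
  makes the time spent on the edge list of the tree linear in its number of nodes.\<close>

lemma acyclic_card_edges:
  assumes "simple_graph G" "\<nexists>p. is_cycle G p"
  shows "card (edges G) \<le> card (verts G)"
  using assms
proof (induction "card (verts G)" arbitrary: G)
  case 0
  then have "verts G = {}" by (auto simp: simple_graph_def)
  with 0 have "edges G = {}" by (auto simp: simple_graph_def)
  then show ?case by simp
next
  case (Suc n)
  have fin: "finite (verts G)" using Suc.prems by (simp add: simple_graph_def)
  have edge: "\<exists>u v. e = {u, v} \<and> u \<noteq> v \<and> u \<in> verts G \<and> v \<in> verts G" if "e \<in> edges G" for e
    using that Suc.prems by (simp add: simple_graph_def)
  have noloop: "{v} \<notin> edges G" for v
    using edge[of "{v}"] by (auto simp: doubleton_eq_iff)
  have "verts G \<noteq> {}" using Suc.hyps(2) by auto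
  then obtain v where v: "v \<in> verts G" and
    uniq: "\<And>a b. a \<in> verts G \<Longrightarrow> b \<in> verts G \<Longrightarrow> {v, a} \<in> edges G \<Longrightarrow> {v, b} \<in> edges G \<Longrightarrow> a = b"
    using min_degree_two_imp_cycle[OF fin _ subset_refl noloop] Suc.prems(2) by blast
  define G' where "G' = Graph (verts G - {v}) {e \<in> edges G. v \<notin> e}"
  have "simple_graph G'"
    using fin edge unfolding simple_graph_def G'_def by fastforce
  moreover have "\<nexists>p. is_cycle G' p"
    using Suc.prems(2) is_cycle_mono[of G' _ G] by (auto simp: G'_def)
  moreover have "n = card (verts G')" using Suc.hyps(2) v fin by (simp add: G'_def)
  ultimately have IH: "card (edges G') \<le> n" using Suc.hyps(1) by simp
  have "edges G \<subseteq> Pow (verts G)" using edge by blast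
  then have finE: "finite (edges G)" using fin finite_subset by blast
  obtain e where "edges G \<subseteq> insert e (edges G')"
  proof (cases "\<exists>a. {v, a} \<in> edges G")
    case True
    then obtain a where a: "{v, a} \<in> edges G" by blast
    have "edges G \<subseteq> insert {v, a} (edges G')"
    proof
      fix e assume e: "e \<in> edges G"
      then obtain x y where xy: "e = {x, y}" "x \<in> verts G" "y \<in> verts G" using edge by blast
      have "a \<in> verts G" using edge[OF a] by (auto simp: doubleton_eq_iff)
      then have "e = {v, a}" if "v \<in> e"
        using uniq[of a x] uniq[of a y] a e xy that by (auto simp: insert_commute)
      with e show "e \<in> insert {v, a} (edges G')" by (auto simp: G'_def)
    qed
    then show ?thesis by (rule that)
  next
    case False
    \<comment> \<open>No edge is lost in this case, and \<open>{}\<close> is a dummy for the lost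
      edge.\<close>
    then have "edges G \<subseteq> insert {} (edges G')"
      using edge unfolding G'_def by (fastforce simp: insert_commute)
    then show ?thesis by (rule that)
  qed
  moreover have "finite (edges G')" using finE by (simp add: G'_def)
  ultimately have "card (edges G) \<le> Suc (card (edges G'))"
    using card_mono[of "insert e (edges G')" "edges G"] by (auto simp: card_insert_if split: if_splits)
  with IH Suc.hyps(2) show ?case by simp
qed

lemma rtrancl_cross:
  assumes "(a, b) \<in> r\<^sup>*" "a \<in> S" "b \<notin> S"
  shows "\<exists>x y. (x, y) \<in> r \<and> x \<in> S \<and> y \<notin> S"
  using assms by (induction rule: rtrancl_induct) auto

text \<open>\<open>contraction E U R \<rho>\<close>: contracting the fibres of \<open>\<rho>\<close>, each of which is represented by the
  element of \<open>R\<close> in it, turns the graph on \<open>U\<close> with edge set \<open>E\<close> into the one induced by \<open>R\<close>.\<close>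

definition contraction :: "'b set set \<Rightarrow> 'b set \<Rightarrow> 'b set \<Rightarrow> ('b \<Rightarrow> 'b) \<Rightarrow> bool" where
  "contraction E U R \<rho> \<longleftrightarrow> R \<subseteq> U \<and> (\<forall>s\<in>U. \<rho> s \<in> R) \<and> (\<forall>s\<in>R. \<rho> s = s) \<and>
     (\<forall>a b. {a, b} \<in> E \<longrightarrow> a \<in> U \<and> b \<in> U \<and> a \<noteq> b \<and> (\<rho> a = \<rho> b \<or> \<rho> a = a \<and> \<rho> b = b))"

definition nbrs :: "'b set set \<Rightarrow> 'b set \<Rightarrow> 'b \<Rightarrow> 'b set" where
  "nbrs E R t = {v \<in> R. {t, v} \<in> E}"

definition merge_rep :: "'b \<Rightarrow> 'b \<Rightarrow> ('b \<Rightarrow> 'b) \<Rightarrow> 'b \<Rightarrow> 'b" where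
  "merge_rep x p \<rho> s = (if \<rho> s = x then p else \<rho> s)"

lemma contraction_id:
  assumes "simple_graph T"
  shows "contraction (edges T) (verts T) (verts T) id"
  using assms unfolding contraction_def simple_graph_def
  by (fastforce simp: doubleton_eq_iff)

text \<open>As \<open>p\<close> is the only remaining neighbour of \<open>x\<close>, the only edge
  leaving the fibre of \<open>x\<close> is the one between \<open>x\<close> and \<open>p\<close>,
  and the merge makes it internal.\<close>

lemma contraction_merge:
  assumes c: "contraction E U R \<rho>" and x: "x \<in> R" and p: "nbrs E R x = {p}"
  shows "contraction E U (R - {x}) (merge_rep x p \<rho>)"
proof -
  have p': "p \<in> R" "{x, p} \<in> E" using p by (auto simp: nbrs_def)
  then have "p \<noteq> x" using c unfolding contraction_def by blast
  have only: "b = p" if "{x, b} \<in> E" "b \<in> R" for b using p that by (auto simp: nbrs_def)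
  have "merge_rep x p \<rho> a = merge_rep x p \<rho> b \<or> merge_rep x p \<rho> a = a \<and> merge_rep x p \<rho> b = b"
    if e: "{a, b} \<in> E" for a b
  proof -
    have ab: "\<rho> a \<in> R" "\<rho> b \<in> R" "\<rho> a = \<rho> b \<or> \<rho> a = a \<and> \<rho> b = b"
      using c e unfolding contraction_def by blast+
    have "\<rho> p = p" using c p' by (auto simp: contraction_def)
    moreover have "{b, a} \<in> E" using e by (simp add: insert_commute)
    ultimately show ?thesis using ab only[of a] only[of b] e \<open>p \<noteq> x\<close>
      unfolding merge_rep_def by (cases "a = x"; cases "b = x") auto
  qed
  then show ?thesis using c p' \<open>p \<noteq> x\<close> unfolding contraction_def
    by (auto simp: merge_rep_def)
qed

text \<open>Connectedness of the subgraph induced by \<open>Y\<close>, phrased by cuts instead of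
  paths: every split of \<open>Y\<close> into two nonempty parts is crossed by an edge. The fibres
  of a contraction provide such splits directly.\<close>

definition cut_connected :: "'b set set \<Rightarrow> 'b set \<Rightarrow> bool" where
  "cut_connected E Y \<longleftrightarrow> (\<forall>S. Y \<inter> S \<noteq> {} \<longrightarrow> Y - S \<noteq> {} \<longrightarrow>
     (\<exists>a\<in>Y \<inter> S. \<exists>b\<in>Y - S. {a, b} \<in> E))"

lemma connected_induced_imp_cut_connected:
  assumes "connected_graph (induced T Y)" "Y \<subseteq> verts T"
  shows "cut_connected (edges T) Y"
  unfolding cut_connected_def
proof (intro allI impI)
  fix S assume "Y \<inter> S \<noteq> {}" "Y - S \<noteq> {}"
  then obtain a b where "a \<in> Y" "a \<in> S" "b \<in> Y" "b \<notin> S" by blast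
  moreover from this have "(a, b) \<in> {(x, y). {x, y} \<in> edges (induced T Y)}\<^sup>*"
    using assms unfolding connected_graph_def by (auto simp: induced_def)
  ultimately show "\<exists>a\<in>Y \<inter> S. \<exists>b\<in>Y - S. {a, b} \<in> edges T"
    using rtrancl_cross[of a b _ S] by (fastforce simp: induced_def)
qed

text \<open>The running intersection property for the contracted tree. A connected set of nodes with
  elements inside and outside the fibre of \<open>x\<close> contains an edge leaving this fibre, and
  only the edge between \<open>x\<close> and \<open>p\<close> does so.\<close>

lemma contraction_cut:
  assumes c: "contraction E U R \<rho>" and x: "x \<in> R" and p: "nbrs E R x = {p}"
    and Y: "cut_connected E Y" "a \<in> Y" "b \<in> Y" "\<rho> a = x" "\<rho> b \<noteq> x"
  shows "x \<in> Y \<and> p \<in> Y"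
proof -
  obtain a' b' where e: "a' \<in> Y" "b' \<in> Y" "\<rho> a' = x" "\<rho> b' \<noteq> x" "{a', b'} \<in> E"
    using Y(1)[unfolded cut_connected_def, rule_format, of "{s. \<rho> s = x}"] Y(2-) by blast
  then have "\<rho> a' = a' \<and> \<rho> b' = b' \<and> \<rho> b' \<in> R" using c[unfolded contraction_def] by metis
  then have "a' = x" "b' \<in> nbrs E R x" using e by (auto simp: nbrs_def)
  with e p show ?thesis by auto
qed

text \<open>If there were two representatives, connectedness of the tree would give each of them a
  neighbour among the representatives. None has exactly one, so all have two or more, and the tree
  would contain a cycle.\<close>

lemma contraction_of_tree_final:
  assumes T: "is_tree T" and c: "contraction (edges T) (verts T) R \<rho>" and "r0 \<in> R"
    and deg: "\<And>t. t \<in> R \<Longrightarrow> card (nbrs (edges T) R t) \<noteq> 1"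
  shows "R = {r0}"
proof (rule ccontr)
  assume "R \<noteq> {r0}"
  have fin: "finite R" using T c finite_subset
    unfolding is_tree_def simple_graph_def contraction_def by blast
  have noloop: "{v} \<notin> edges T" for v :: 'a
    using c[unfolded contraction_def] by (metis insert_absorb2)
  have "\<exists>a\<in>R. \<exists>b\<in>R. a \<noteq> b \<and> {t, a} \<in> edges T \<and> {t, b} \<in> edges T" if t: "t \<in> R" for t
  proof -
    obtain b where b: "b \<in> R" "b \<noteq> t" using \<open>R \<noteq> {r0}\<close> \<open>r0 \<in> R\<close> t by blast
    have "(t, b) \<in> {(x, y). {x, y} \<in> edges T}\<^sup>*"
      using T t b c unfolding is_tree_def connected_graph_def contraction_def by blast
    moreover have "\<rho> t = t" "\<rho> b = b" using t b c unfolding contraction_def by auto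
    ultimately obtain x y where xy: "{x, y} \<in> edges T" "\<rho> x = t" "\<rho> y \<noteq> t"
      using rtrancl_cross[of t b "{(x, y). {x, y} \<in> edges T}" "{s. \<rho> s = t}"] b by auto
    then have "x = t" "y \<in> R" using c[unfolded contraction_def] by metis+
    then have "y \<in> nbrs (edges T) R t" using xy by (simp add: nbrs_def)
    moreover have "finite (nbrs (edges T) R t)" using fin by (simp add: nbrs_def)
    ultimately have "card (nbrs (edges T) R t) \<noteq> 0" by auto
    with deg[OF t] have "card (nbrs (edges T) R t) \<ge> 2" by linarith
    then obtain a b where "a \<in> nbrs (edges T) R t" "b \<in> nbrs (edges T) R t" "a \<noteq> b"
      by (meson card_2_iff' obtain_subset_with_card_n subset_iff)
    then show ?thesis by (auto simp: nbrs_def)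
  qed
  then have "\<exists>p. is_cycle T p"
    using c \<open>r0 \<in> R\<close> by (intro min_degree_two_imp_cycle[OF fin _ _ noloop]) (auto simp: contraction_def)
  then show False using T by (simp add: is_tree_def)
qed

section \<open>The conflict graph\<close>

definition conflict :: "'a graph \<Rightarrow> ('j \<Rightarrow> 'a graph) \<Rightarrow> 'j \<Rightarrow> 'j \<Rightarrow> bool" where
  "conflict G H i j \<longleftrightarrow> verts (H i) \<inter> verts (H j) \<noteq> {} \<or>
     (\<exists>u\<in>verts (H i). \<exists>v\<in>verts (H j). {u, v} \<in> edges G)"

definition conflict_free :: "('j \<Rightarrow> 'j \<Rightarrow> bool) \<Rightarrow> 'j set \<Rightarrow> bool" where
  "conflict_free cf I \<longleftrightarrow> (\<forall>i\<in>I. \<forall>j\<in>I. i \<noteq> j \<longrightarrow> \<not> cf i j)"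

definition hits :: "'j set \<Rightarrow> ('j \<Rightarrow> 'a graph) \<Rightarrow> ('b \<Rightarrow> 'a set) \<Rightarrow> 'b \<Rightarrow> 'j set" where
  "hits J H X t = {j \<in> J. verts (H j) \<inter> X t \<noteq> {}}"

lemma independent_packing_iff:
  "independent_packing G J H I \<longleftrightarrow> I \<subseteq> J \<and> conflict_free (conflict G H) I"
  unfolding independent_packing_def conflict_free_def conflict_def by blast

lemma conflict_free_subset: "conflict_free cf I \<Longrightarrow> I' \<subseteq> I \<Longrightarrow> conflict_free cf I'"
  unfolding conflict_free_def by blast

text \<open>A common vertex lies in some bag, and some bag contains both ends of a joining
  edge.\<close>

lemma conflict_share_bag:
  assumes "tree_decomposition G T X" "conflict G H i j" "i \<in> J" "j \<in> J"
    and "verts (H i) \<subseteq> verts G" "verts (H j) \<subseteq> verts G"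
  shows "\<exists>t\<in>verts T. i \<in> hits J H X t \<and> j \<in> hits J H X t"
  using assms(2) unfolding conflict_def
proof
  assume "verts (H i) \<inter> verts (H j) \<noteq> {}"
  then obtain u where "u \<in> verts (H i)" "u \<in> verts (H j)" by blast
  moreover from this obtain t where "t \<in> verts T" "u \<in> X t"
    using assms unfolding tree_decomposition_def by blast
  ultimately show ?thesis using assms(3,4) unfolding hits_def by blast
next
  assume "\<exists>u\<in>verts (H i). \<exists>v\<in>verts (H j). {u, v} \<in> edges G"
  then obtain u v where uv: "u \<in> verts (H i)" "v \<in> verts (H j)" "{u, v} \<in> edges G" by blast
  then obtain t where "t \<in> verts T" "{u, v} \<subseteq> X t"
    using assms(1) unfolding tree_decomposition_def by meson
  with uv show ?thesis using assms(3,4) unfolding hits_def by blast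
qed

text \<open>The nodes of a single vertex cannot be split without a crossing tree edge, so an
  uncrossed cut would divide the vertices of \<open>H j\<close> into two nonempty classes. Some edge
  of \<open>H j\<close> joins the classes, but its ends share a bag, which lies on one side
  only.\<close>

lemma hits_cut_connected:
  assumes td: "tree_decomposition G T X" and j: "j \<in> J" and sub: "subgraph (H j) G"
    and con: "connected_graph (H j)"
  shows "cut_connected (edges T) {t \<in> verts T. j \<in> hits J H X t}"
  unfolding cut_connected_def
proof (intro allI impI, rule ccontr)
  let ?Y = "{t \<in> verts T. j \<in> hits J H X t}"
  fix S assume ne: "?Y \<inter> S \<noteq> {}" "?Y - S \<noteq> {}"
    and nc: "\<not> (\<exists>a\<in>?Y \<inter> S. \<exists>b\<in>?Y - S. {a, b} \<in> edges T)"
  have vG: "verts (H j) \<subseteq> verts G" and eG: "edges (H j) \<subseteq> edges G"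
    using sub by (auto simp: subgraph_def)
  have same: "a \<in> S" if u: "u \<in> verts (H j)" "a \<in> verts T" "b \<in> verts T" "u \<in> X a" "u \<in> X b" "b \<in> S"
    for u a b
  proof (rule ccontr)
    assume "a \<notin> S"
    have "connected_graph (induced T {t \<in> verts T. u \<in> X t})"
      using td u vG unfolding tree_decomposition_def by blast
    then have "cut_connected (edges T) {t \<in> verts T. u \<in> X t}"
      by (rule connected_induced_imp_cut_connected) auto
    then obtain a' b' where "a' \<in> {t \<in> verts T. u \<in> X t} \<inter> S" "b' \<in> {t \<in> verts T. u \<in> X t} - S"
      "{a', b'} \<in> edges T"
      using u \<open>a \<notin> S\<close> unfolding cut_connected_def by blast
    with nc u j show False unfolding hits_def by blast
  qed
  define In where "In = {u \<in> verts (H j). \<exists>t\<in>verts T. u \<in> X t \<and> t \<in> S}"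
  obtain a u where a: "a \<in> verts T" "u \<in> verts (H j)" "u \<in> X a" "a \<in> S"
    using ne(1) by (auto simp: hits_def)
  obtain b v where b: "b \<in> verts T" "v \<in> verts (H j)" "v \<in> X b" "b \<notin> S"
    using ne(2) by (auto simp: hits_def)
  have "u \<in> In" "v \<notin> In" using a b same unfolding In_def by blast+
  then obtain x y where xy: "{x, y} \<in> edges (H j)" "x \<in> In" "y \<notin> In"
    using con a b rtrancl_cross[of u v _ In] unfolding connected_graph_def by blast
  then obtain t where t: "t \<in> verts T" "{x, y} \<subseteq> X t"
    using td eG unfolding tree_decomposition_def by (meson subsetD)
  have "y \<in> verts (H j)"
    using sub xy unfolding subgraph_def simple_graph_def by (fastforce simp: doubleton_eq_iff)
  moreover have "t \<in> S" using xy(2) t same unfolding In_def by blast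
  ultimately have "y \<in> In" using t unfolding In_def by blast
  with xy show False by simp
qed

text \<open>Pairwise non-conflicting members that all meet one bag have distinct representatives in it,
  which are pairwise non-adjacent.\<close>

lemma card_conflict_free_hits:
  assumes td: "tree_decomposition G T X" and G: "simple_graph G"
    and ind: "td_independence_number G T X \<le> k"
    and t: "t \<in> verts T" and I: "I \<subseteq> hits J H X t" "conflict_free (conflict G H) I"
  shows "finite I \<and> card I \<le> k"
proof -
  have "\<forall>i\<in>I. \<exists>u. u \<in> verts (H i) \<and> u \<in> X t" using I(1) unfolding hits_def by blast
  then obtain f where f: "\<And>i. i \<in> I \<Longrightarrow> f i \<in> verts (H i) \<and> f i \<in> X t" by metis
  have inj: "inj_on f I"
  proof (rule inj_onI, rule ccontr)
    fix i j assume "i \<in> I" "j \<in> I" "f i = f j" "i \<noteq> j"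
    then show False using I(2) f[of i] f[of j] unfolding conflict_free_def conflict_def by auto
  qed
  have XG: "X t \<subseteq> verts G" using td t by (simp add: tree_decomposition_def)
  have noloop: "{u} \<notin> edges G" for u
    using G unfolding simple_graph_def by (fastforce simp: doubleton_eq_iff)
  have "independent_set (induced G (X t)) (f ` I)"
    unfolding independent_set_def
  proof (intro conjI ballI)
    show "f ` I \<subseteq> verts (induced G (X t))" using f XG by (auto simp: induced_def)
    fix u v assume "u \<in> f ` I" "v \<in> f ` I"
    then obtain i j where "i \<in> I" "j \<in> I" "u = f i" "v = f j" by blast
    then show "{u, v} \<notin> edges (induced G (X t))"
      using I(2) f noloop[of u] unfolding conflict_free_def conflict_def induced_def
      by (cases "i = j") auto
  qed
  moreover have finG: "finite (verts G)" using G by (simp add: simple_graph_def)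
  have finS: "finite {S. independent_set (induced G (X t)) S}"
    by (rule finite_subset[of _ "Pow (verts G)"])
      (use finG in \<open>auto simp: independent_set_def induced_def\<close>)
  ultimately have "card (f ` I) \<le> independence_number (induced G (X t))"
    unfolding independence_number_def by (intro Max_ge) auto
  also have "finite (verts T)"
    using td by (simp add: tree_decomposition_def is_tree_def simple_graph_def)
  then have "independence_number (induced G (X t)) \<le> td_independence_number G T X"
    unfolding td_independence_number_def using t by (intro Max_ge) auto
  finally have "card I \<le> k" using ind inj by (simp add: card_image)
  moreover have "finite (f ` I)" using f XG finG by (meson finite_subset image_subsetI subsetD)
  then have "finite I" using inj by (simp add: finite_image_iff)
  ultimately show ?thesis by simp
qed


section \<open>The recursion of the dynamic program\<close>

definition optimal ::
    "('j \<Rightarrow> 'j \<Rightarrow> bool) \<Rightarrow> ('j \<Rightarrow> rat) \<Rightarrow> 'j set \<Rightarrow> 'j set \<Rightarrow> 'j set \<Rightarrow> 'j set \<Rightarrow> bool" where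
  "optimal cf w U Y S I \<longleftrightarrow> I \<subseteq> U \<and> conflict_free cf I \<and> I \<inter> Y = S \<and>
     (\<forall>I'. I' \<subseteq> U \<longrightarrow> conflict_free cf I' \<longrightarrow> I' \<inter> Y = S \<longrightarrow> sum w I' \<le> sum w I)"

text \<open>By \<open>sep\<close>, the set \<open>Yx \<inter> Yp\<close> is an interface between the
  sides. The two solutions agree on it, so a conflict between them would already be a conflict
  inside one of them. Conversely, any competitor splits into its two sides, whose overlap
  \<open>S \<inter> Yx\<close> is counted twice and subtracted once. For \<open>Ix\<close> only its
  trace on the interface is prescribed, which is why one best solution per group suffices.\<close>

lemma optimal_merge:
  assumes fin: "finite Ux" "finite Up" and sym: "\<And>i j. cf i j \<Longrightarrow> cf j i" and refl: "\<And>i. i \<in> Ux \<Longrightarrow> cf i i"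
    and sep: "\<And>i j. i \<in> Ux \<Longrightarrow> j \<in> Up \<Longrightarrow> cf i j \<Longrightarrow> i \<in> Yx \<inter> Yp \<or> j \<in> Yx \<inter> Yp"
    and sub: "Yx \<subseteq> Ux" "Yp \<subseteq> Up"
    and p: "optimal cf w Up Yp S Ip"
    and x: "Ix \<subseteq> Ux" "conflict_free cf Ix" "Ix \<inter> Yx \<inter> Yp = S \<inter> Yx"
    and best: "\<And>I'. I' \<subseteq> Ux \<Longrightarrow> conflict_free cf I' \<Longrightarrow> I' \<inter> Yx \<inter> Yp = S \<inter> Yx \<Longrightarrow> sum w I' \<le> sum w Ix"
  shows "optimal cf w (Up \<union> Ux) Yp S (Ip \<union> Ix)"
    and "sum w (Ip \<union> Ix) = sum w Ip + (sum w Ix - sum w (S \<inter> Yx))"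
proof -
  have p1: "Ip \<subseteq> Up" "conflict_free cf Ip" "Ip \<inter> Yp = S"
    using p unfolding optimal_def by blast+
  have p2: "\<And>I'. I' \<subseteq> Up \<Longrightarrow> conflict_free cf I' \<Longrightarrow> I' \<inter> Yp = S \<Longrightarrow> sum w I' \<le> sum w Ip"
    using p unfolding optimal_def by blast
  \<comment> \<open>An element of both sides conflicts with itself, so \<open>sep\<close> places it
    in the interface.\<close>
  have inter: "Ux \<inter> Up = Yx \<inter> Yp" using sep refl sub by blast
  have fx: "finite A" if "A \<subseteq> Ux" for A using that fin finite_subset by blast
  have fp: "finite A" if "A \<subseteq> Up" for A using that fin finite_subset by blast
  have int: "Ip \<inter> Ix = S \<inter> Yx" using p1 x inter sub by blast
  have S: "S \<subseteq> Up" using p1 by blast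
  show w: "sum w (Ip \<union> Ix) = sum w Ip + (sum w Ix - sum w (S \<inter> Yx))"
    using sum_Un[of Ip Ix w] fx[OF x(1)] fp[OF p1(1)] int by simp
  have mixed: "\<not> cf i j" if ij: "i \<in> Ix" "j \<in> Ip" "i \<noteq> j" for i j
  proof
    assume c: "cf i j"
    then have "i \<in> Yx \<inter> Yp \<or> j \<in> Yx \<inter> Yp" using sep ij x p1 by blast
    then have "i \<in> Ip \<or> j \<in> Ix" using ij x p1 by blast
    then show False using c ij x(2) p1(2) unfolding conflict_free_def by blast
  qed
  have cf: "conflict_free cf (Ip \<union> Ix)"
    using mixed sym p1(2) x(2) unfolding conflict_free_def by blast
  have ub: "sum w I' \<le> sum w (Ip \<union> Ix)"
    if I': "I' \<subseteq> Up \<union> Ux" "conflict_free cf I'" "I' \<inter> Yp = S" for I'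
  proof -
    have ple: "sum w (I' \<inter> Up) \<le> sum w Ip"
      using I' sub p2[of "I' \<inter> Up"] conflict_free_subset[OF I'(2), of "I' \<inter> Up"] by blast
    have xle: "sum w (I' \<inter> Ux) \<le> sum w Ix"
      using I' sub by (intro best conflict_free_subset[OF I'(2)]) blast+
    have "I' = (I' \<inter> Up) \<union> (I' \<inter> Ux)" using I' by blast
    moreover have "(I' \<inter> Up) \<inter> (I' \<inter> Ux) = S \<inter> Yx" using I' inter by blast
    ultimately have "sum w I' = sum w (I' \<inter> Up) + sum w (I' \<inter> Ux) - sum w (S \<inter> Yx)"
      using sum_Un[of "I' \<inter> Up" "I' \<inter> Ux" w] fx[of "I' \<inter> Ux"] fp[of "I' \<inter> Up"] by simp
    then show ?thesis using w ple xle by linarith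
  qed
  have "Ix \<inter> Yp \<subseteq> S" using x(1,3) inter sub by blast
  then have "(Ip \<union> Ix) \<inter> Yp = S" using p1(3) by blast
  moreover have "Ip \<union> Ix \<subseteq> Up \<union> Ux" using p1(1) x(1) by blast
  ultimately show "optimal cf w (Up \<union> Ux) Yp S (Ip \<union> Ix)"
    unfolding optimal_def using cf by (intro conjI allI impI ub)
qed

section \<open>Numbering short lists\<close>

text \<open>Lists over \<open>{..<m}\<close> are numbered like the nodes of an \<open>m\<close>-ary heap: the children of node \<open>c\<close>,
  which extend the list of \<open>c\<close> by one element, are \<open>c * m + 1, \<dots>, c * m + m\<close>.\<close>

fun lst :: "nat \<Rightarrow> nat \<Rightarrow> nat list" where
  "lst m 0 = []"
| "lst m (Suc i) = lst m (i div m) @ [i mod m]"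

definition enc :: "nat \<Rightarrow> nat list \<Rightarrow> nat" where
  "enc m l = foldl (\<lambda>c j. Suc (c * m + j)) 0 l"

text \<open>The number \<open>1 + m + ... + m ^ k\<close> of lists of length at most
  \<open>k\<close>, in Horner form; the program computes it in the same way.\<close>

primrec num_codes :: "nat \<Rightarrow> nat \<Rightarrow> nat" where
  "num_codes m 0 = 1"
| "num_codes m (Suc k) = Suc (m * num_codes m k)"

lemma enc_Nil [simp]: "enc m [] = 0"
  by (simp add: enc_def)

lemma enc_snoc [simp]: "enc m (l @ [j]) = Suc (enc m l * m + j)"
  by (simp add: enc_def)

lemma set_lst: "m > 0 \<Longrightarrow> set (lst m c) \<subseteq> {..<m}"
  by (induction m c rule: lst.induct) auto

lemma lst_child: "j < m \<Longrightarrow> lst m (Suc (c * m + j)) = lst m c @ [j]"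
  by simp

declare lst.simps(2) [simp del]

lemma lst_enc: "set l \<subseteq> {..<m} \<Longrightarrow> lst m (enc m l) = l"
  by (induction l rule: rev_induct) (auto simp: lst_child)

lemma enc_lst: "enc m (lst m c) = c"
  by (induction m c rule: lst.induct) (auto simp: lst.simps)

lemma lst_inj: "lst m c = lst m d \<Longrightarrow> c = d"
  by (metis enc_lst)

text \<open>The numbering runs level by level, so the lists up to a given length form an initial
  segment of the codes. The induction passes from a code to its parent.\<close>

lemma less_num_codes_iff: "m > 0 \<Longrightarrow> c < num_codes m k \<longleftrightarrow> length (lst m c) \<le> k"
proof (induction k arbitrary: c)
  case 0
  then show ?case by (cases c) (auto simp: lst.simps)
next
  case (Suc k)
  show ?case
  proof (cases c)
    case (Suc i)
    have "i < m * num_codes m k \<longleftrightarrow> i div m < num_codes m k"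
      using Suc.prems by (simp add: div_less_iff_less_mult mult.commute)
    then show ?thesis using Suc Suc.IH[OF Suc.prems, of "i div m"] by (simp add: lst.simps)
  qed simp
qed

lemma num_codes_pos [simp]: "num_codes m k > 0"
  by (cases k) auto

lemma num_codes_gt: "k > 0 \<Longrightarrow> m < num_codes m k"
  by (cases k) (auto simp: less_Suc_eq_le Suc_le_eq)

text \<open>Each of the \<open>k + 1\<close> levels has at most \<open>m ^ k\<close> lists.\<close>

lemma num_codes_le: "m > 0 \<Longrightarrow> num_codes m k \<le> Suc k * m ^ k"
proof (induction k)
  case (Suc k)
  then have "m * num_codes m k \<le> m * (Suc k * m ^ k)" by (intro mult_left_mono) auto
  moreover have "1 \<le> m ^ Suc k" using Suc.prems by (metis Suc_leI One_nat_def zero_less_power)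
  ultimately have "Suc (m * num_codes m k) \<le> m * (Suc k * m ^ k) + m ^ Suc k" by linarith
  also have "\<dots> = Suc (Suc k) * m ^ Suc k" by (simp add: algebra_simps)
  finally show ?case by simp
qed simp

definition restrict_code :: "nat \<Rightarrow> nat set \<Rightarrow> nat \<Rightarrow> nat" where
  "restrict_code m Y c = enc m (filter (\<lambda>j. j \<in> Y) (lst m c))"

lemma lst_restrict_code: "m > 0 \<Longrightarrow> lst m (restrict_code m Y c) = filter (\<lambda>j. j \<in> Y) (lst m c)"
  unfolding restrict_code_def using set_lst[of m c] by (intro lst_enc) auto

lemma restrict_code_less: "m > 0 \<Longrightarrow> c < num_codes m k \<Longrightarrow> restrict_code m Y c < num_codes m k"
  by (simp add: less_num_codes_iff lst_restrict_code) (meson length_filter_le order_trans)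

lemma restrict_code_0 [simp]: "restrict_code m Y 0 = 0"
  by (simp add: restrict_code_def)

text \<open>The recurrence along parents that \<open>restriction_table\<close> follows, with
  constant time per entry.\<close>

lemma restrict_code_Suc:
  "restrict_code m Y (Suc i) = (if i mod m \<in> Y
     then Suc (restrict_code m Y (i div m) * m + i mod m) else restrict_code m Y (i div m))"
  by (simp add: restrict_code_def lst.simps)

text \<open>Turns containment of a list in \<open>Y\<close> into one lookup in the table of
  restrictions and one comparison.\<close>

lemma restrict_code_eq_iff: "m > 0 \<Longrightarrow> restrict_code m Y c = c \<longleftrightarrow> set (lst m c) \<subseteq> Y"
  by (metis (no_types, lifting) lst_restrict_code lst_inj filter_id_conv subset_iff)

text \<open>As conflict relations are reflexive, an element that occurs twice conflicts with itself.\<close>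

definition extends_code :: "(nat \<Rightarrow> nat \<Rightarrow> bool) \<Rightarrow> nat \<Rightarrow> nat \<Rightarrow> bool" where
  "extends_code cf m c = (case c of 0 \<Rightarrow> True | Suc i \<Rightarrow> (\<forall>e\<in>set (lst m (i div m)). \<not> cf e (i mod m)))"

definition free_code :: "(nat \<Rightarrow> nat \<Rightarrow> bool) \<Rightarrow> nat \<Rightarrow> nat \<Rightarrow> bool" where
  "free_code cf m c \<longleftrightarrow> distinct (lst m c) \<and> conflict_free cf (set (lst m c))"

definition valid_code :: "(nat \<Rightarrow> nat \<Rightarrow> bool) \<Rightarrow> nat \<Rightarrow> nat set \<Rightarrow> nat \<Rightarrow> bool" where
  "valid_code cf m Y c \<longleftrightarrow> free_code cf m c \<and> set (lst m c) \<subseteq> Y"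

lemma free_code_0 [simp]: "free_code cf m 0"
  by (simp add: free_code_def conflict_free_def)

text \<open>The code on the right belongs to the list with its last but one element
  \<open>c mod m\<close> deleted. One earlier entry and one lookup in the conflict table thus
  replace a scan of the whole list.\<close>

lemma extends_code_Suc_Suc:
  assumes "m > 0" "i div m = Suc c"
  shows "extends_code cf m (Suc i) \<longleftrightarrow>
    extends_code cf m (Suc (c div m * m + i mod m)) \<and> \<not> cf (c mod m) (i mod m)"
  using assms by (auto simp: extends_code_def lst.simps)

lemma extends_code_Suc_0: "i div m = 0 \<Longrightarrow> extends_code cf m (Suc i)"
  by (simp add: extends_code_def)

lemma free_code_Suc:
  assumes "m > 0" and refl: "\<And>i. i < m \<Longrightarrow> cf i i" and sym: "\<And>i j. cf i j \<Longrightarrow> cf j i"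
  shows "free_code cf m (Suc i) \<longleftrightarrow> free_code cf m (i div m) \<and> extends_code cf m (Suc i)"
proof -
  have "cf (i mod m) (i mod m)" using assms by simp
  then show ?thesis
    using sym unfolding free_code_def extends_code_def conflict_free_def
    by (auto simp: lst.simps)
qed

text \<open>The elements of \<open>S \<inter> Y\<close> are put in front, in the order of the list
  of \<open>d\<close>, and the others behind them. The restriction is then \<open>d\<close> itself
  and not the code of a permutation, so the set is represented in exactly the group that is
  wanted.\<close>

lemma exists_code:
  assumes m: "m > 0" and S: "S \<subseteq> {..<m}" "conflict_free cf S" "card S \<le> k"
    and d: "set (lst m d) = S \<inter> Y" "distinct (lst m d)"
  shows "\<exists>c<num_codes m k. valid_code cf m S c \<and> set (lst m c) = S \<and> restrict_code m Y c = d"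
proof -
  have fin: "finite S" using S(1) finite_subset by blast
  obtain l where l: "set l = S - Y" "distinct l"
    using finite_distinct_list[of "S - Y"] fin by auto
  define c where "c = enc m (lst m d @ l)"
  have lst: "lst m c = lst m d @ l"
    unfolding c_def by (rule lst_enc) (use S(1) d l in auto)
  have set: "set (lst m c) = S" using lst d l by auto
  have "distinct (lst m c)" using lst d l by auto
  then have len: "length (lst m c) = card S" using set distinct_card by metis
  have "filter (\<lambda>j. j \<in> Y) (lst m c) = lst m d" using lst d l by auto
  then have "restrict_code m Y c = d" by (simp add: restrict_code_def enc_lst)
  moreover have "c < num_codes m k" using len S(3) m by (simp add: less_num_codes_iff)
  moreover have "valid_code cf m S c"
    using set S(2) \<open>distinct (lst m c)\<close> by (simp add: valid_code_def free_code_def)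
  ultimately show ?thesis using set by blast
qed

section \<open>Program fragments\<close>

text \<open>Used for multiples of a number and for walking through consecutive records of the input,
  where each record tells the start of the next one.\<close>

definition iterate_table :: "nat \<Rightarrow> nat \<Rightarrow> nat \<Rightarrow> nexp \<Rightarrow> nexp \<Rightarrow> com" where
  "iterate_table A v acc N e = For v N (Seq (NAssign A (V v) (V acc)) (Set acc e))"

lemma ht_iterate_table:
  assumes dist: "distinct [A, v, acc]" and cost: "ncost N \<le> 2" "ncost e \<le> 40"
    and val: "\<And>s'. frame {A, v, acc} {} s s' \<Longrightarrow> nval N s' = cnt \<and> nval e s' = f (nmem s' acc 0)"
  shows "ht (iterate_table A v acc N e) s ((cnt + 1) * 80) (\<lambda>s'. frame {A, v, acc} {} s s' \<and>
    nmem s' acc 0 = (f ^^ cnt) (nmem s acc 0) \<and> (\<forall>i<cnt. nmem s' A i = (f ^^ i) (nmem s acc 0)))"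
proof -
  let ?I = "\<lambda>i s'. frame {A, v, acc} {} s s' \<and> nmem s' acc 0 = (f ^^ i) (nmem s acc 0) \<and>
    (\<forall>j<i. nmem s' A j = (f ^^ j) (nmem s acc 0))"
  have [simp]: "A \<noteq> v" "A \<noteq> acc" "v \<noteq> acc" "v \<noteq> A" "acc \<noteq> A" "acc \<noteq> v" using dist by auto
  show ?thesis unfolding iterate_table_def
  proof (rule ht_For[where I = ?I and b = 60], goal_cases)
    case (3 i t)
    then have "frame {A, v, acc} {} s (nupdate A i (nmem t acc 0) t)" by simp
    from val[OF this] have e: "nval e (nupdate A i (nmem t acc 0) t) = f (nmem t acc 0)" by simp
    show ?case using cost 3 e by (intro ht_loop_free) (auto simp: less_Suc_eq)
  next
    case 4
    have "cnt * (60 + ncost N + 10) + ncost N + 10 \<le> cnt * 72 + 2 + 10"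
      by (intro add_mono mult_left_mono) (use cost in auto)
    then show ?case by simp
  qed (use val in auto)
qed

text \<open>Replaces the missing multiplication by repeated addition. Besides the table, the product
  with the table length itself is left in the accumulator.\<close>

definition mult_table :: "nat \<Rightarrow> nat \<Rightarrow> nat \<Rightarrow> nexp \<Rightarrow> nexp \<Rightarrow> com" where
  "mult_table A v acc N d = Seq (Set acc (NConst 0)) (iterate_table A v acc N (NPlus (V acc) d))"

lemma ht_mult_table:
  assumes dist: "distinct [A, v, acc]" and cost: "ncost N \<le> 2" "ncost d \<le> 2"
    and val: "\<And>s'. frame {A, v, acc} {} s s' \<Longrightarrow> nval N s' = cnt \<and> nval d s' = dv"
  shows "ht (mult_table A v acc N d) s ((cnt + 1) * 90) (\<lambda>s'. frame {A, v, acc} {} s s' \<and>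
    nmem s' acc 0 = cnt * dv \<and> (\<forall>i<cnt. nmem s' A i = i * dv))"
  unfolding mult_table_def
proof (rule ht_Seq)
  show "ht (Set acc (NConst 0)) s 3 (\<lambda>s1. s1 = nupdate acc 0 0 s)" by (rule ht_loop_free) auto
next
  fix s1 assume s1: "s1 = nupdate acc 0 0 s"
  have pow: "((\<lambda>x. x + dv) ^^ i) 0 = i * dv" for i by (induction i) auto
  have fr: "frame {A, v, acc} {} s s'" if "frame {A, v, acc} {} s1 s'" for s'
    by (rule frame_trans[of "{acc}" "{}" s s1, OF _ that]) (auto simp: s1)
  show "ht (iterate_table A v acc N (NPlus (V acc) d)) s1 ((cnt + 1) * 80) (\<lambda>s'. frame {A, v, acc} {} s s' \<and>
    nmem s' acc 0 = cnt * dv \<and> (\<forall>i<cnt. nmem s' A i = i * dv))"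
    by (rule ht_mono[OF ht_iterate_table[OF dist cost(1), where f = "\<lambda>x. x + dv"]])
      (use cost val[OF fr] fr pow s1 in auto)
qed simp

text \<open>The marks are stamps: if every round uses a new value of \<open>st\<close>, the marks of
  earlier rounds need not be erased.\<close>

definition mark_list :: "nat \<Rightarrow> nat \<Rightarrow> nexp \<Rightarrow> nexp \<Rightarrow> com" where
  "mark_list A v p st =
     For v (NCell 0 p) (NAssign A (NCell 0 (NPlus p (NPlus (V v) (NConst 1)))) st)"

definition holds :: "(nat \<Rightarrow> nat) \<Rightarrow> nat \<Rightarrow> nat list \<Rightarrow> bool" where
  "holds f p vs \<longleftrightarrow> f p = length vs \<and> (\<forall>i<length vs. f (p + (i + 1)) = vs ! i)"

lemma ht_mark_list:
  assumes dist: "distinct [0, A, v]" and cost: "ncost p \<le> 4" "ncost st \<le> 4"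
    and val: "\<And>s'. frame {A, v} {} s s' \<Longrightarrow> nval p s' = pv \<and> nval st s' = stv"
    and vs: "holds (nmem s 0) pv vs"
  shows "ht (mark_list A v p st) s ((length vs + 1) * 40) (\<lambda>s'. frame {A, v} {} s s' \<and>
    nmem s' A = (\<lambda>u. if u \<in> set vs then stv else nmem s A u))"
proof -
  let ?I = "\<lambda>i s'. frame {A, v} {} s s' \<and>
    nmem s' A = (\<lambda>u. if u \<in> set (take i vs) then stv else nmem s A u)"
  have [simp]: "A \<noteq> v" "v \<noteq> A" "A \<noteq> 0" "v \<noteq> 0" using dist by auto
  have inp: "nmem s' 0 = nmem s 0" if "frame {A, v} {} s s'" for s'
    using that by (rule frame_nmem) (use dist in auto)
  have "ht (mark_list A v p st) s ((length vs + 1) * 40) (?I (length vs))"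
    unfolding mark_list_def
  proof (intro ht_For[where I = ?I and b = 15], goal_cases)
    case (3 i t)
    then have "vs ! i = nmem t 0 (pv + (i + 1))" using inp[of t] vs by (simp add: holds_def)
    with 3 show ?case using cost val
      by (intro ht_loop_free) (auto simp: take_Suc_conv_app_nth fun_eq_iff)
  next
    case (2 i t)
    then show ?case using val[of t] inp[of t] vs by (simp add: holds_def)
  next
    case 4
    have "length vs * (15 + ncost (NCell 0 p) + 10) + ncost (NCell 0 p) + 10 \<le> length vs * 30 + 5 + 10"
      by (intro add_mono mult_left_mono) (use cost in auto)
    also have "\<dots> \<le> (length vs + 1) * 40" by simp
    finally show ?case .
  qed auto
  then show ?thesis by simp
qed

definition hit_row :: "nat \<Rightarrow> nat \<Rightarrow> nat \<Rightarrow> nat \<Rightarrow> nat \<Rightarrow> nexp \<Rightarrow> nexp \<Rightarrow> com" where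
  "hit_row FP j v A out base st =
     For j (NCell 0 (NConst 1)) (For v (NCell 0 (NCell FP (V j)))
       (If (NEq (NCell A (NCell 0 (NPlus (NCell FP (V j)) (NPlus (V v) (NConst 1))))) st)
         (NAssign out (NPlus base (V j)) (NConst 1)) Skip))"

lemma ht_hit_row:
  assumes dist: "distinct [0, FP, j, v, A, out]" and cost: "ncost base \<le> 4" "ncost st \<le> 4"
    and val: "\<And>s'. frame {out, j, v} {} s s' \<Longrightarrow> nval base s' = bv \<and> nval st s' = stv"
    and m: "nmem s 0 1 = m"
    and vs: "\<And>i. i < m \<Longrightarrow> holds (nmem s 0) (nmem s FP i) (vs i) \<and> length (vs i) \<le> n"
  shows "ht (hit_row FP j v A out base st) s (m * (n + 1) * 100 + 100) (\<lambda>s'. frame {out, j, v} {} s s' \<and>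
    nmem s' out = (\<lambda>x. if \<exists>i<m. x = bv + i \<and> (\<exists>u\<in>set (vs i). nmem s A u = stv) then 1 else nmem s out x))"
proof -
  let ?hit = "\<lambda>i x. x = bv + i \<and> (\<exists>u\<in>set (vs i). nmem s A u = stv)"
  let ?I = "\<lambda>i s'. frame {out, j, v} {} s s' \<and>
    nmem s' out = (\<lambda>x. if \<exists>i'<i. ?hit i' x then 1 else nmem s out x)"
  have [simp]: "out \<noteq> 0" "j \<noteq> 0" "v \<noteq> 0" "out \<noteq> FP" "j \<noteq> FP" "v \<noteq> FP" "out \<noteq> A" "j \<noteq> A" "v \<noteq> A"
    "out \<noteq> j" "out \<noteq> v" "j \<noteq> v" "FP \<noteq> 0" "A \<noteq> 0" "v \<noteq> j" "FP \<noteq> j" "FP \<noteq> v" "FP \<noteq> out" "j \<noteq> out" "v \<noteq> out"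
    "A \<noteq> j" "A \<noteq> v" "A \<noteq> out"
    using dist by auto
  have fr: "nmem s' 0 = nmem s 0 \<and> nmem s' FP = nmem s FP \<and> nmem s' A = nmem s A"
    if "frame {out, j, v} {} s s'" for s'
    using that by (auto simp: frame_nmem)
  have "ht (hit_row FP j v A out base st) s (m * (n + 1) * 100 + 100) (?I m)"
    unfolding hit_row_def
  proof (intro ht_For[where I = ?I and b = "(n + 1) * 70"], goal_cases)
    case (3 i t)
    let ?I2 = "\<lambda>l s'. frame {out, j, v} {} s s' \<and> nmem s' j 0 = i \<and>
      nmem s' out = (\<lambda>x. if (\<exists>i'<i. ?hit i' x) \<or> x = bv + i \<and> (\<exists>u\<in>set (take l (vs i)). nmem s A u = stv)
        then 1 else nmem s out x)"
    have len: "length (vs i) \<le> n" and hold: "holds (nmem s 0) (nmem s FP i) (vs i)" using vs 3 by auto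
    show ?case
    proof (rule ht_mono)
      show "ht (For v (NCell 0 (NCell FP (V j)))
        (If (NEq (NCell A (NCell 0 (NPlus (NCell FP (V j)) (NPlus (V v) (NConst 1))))) st)
         (NAssign out (NPlus base (V j)) (NConst 1)) Skip)) t ((length (vs i) + 1) * 70) (?I2 (length (vs i)))"
      proof (intro ht_For[where I = ?I2 and b = 50], goal_cases)
        case (3 l r)
        have nth: "nmem s 0 (nmem s FP i + (l + 1)) = vs i ! l" using hold 3 by (simp add: holds_def)
        from 3 have r: "nmem r 0 = nmem s 0" "nmem r FP = nmem s FP" "nmem r A = nmem s A"
          "nmem r j 0 = i" "nmem r v 0 = l" using fr[of r] by auto
        from 3 show ?case using cost val nth r
          by (intro ht_loop_free) (auto simp: take_Suc_conv_app_nth fun_eq_iff)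
      next
        case (2 l r)
        then show ?case using fr[of r] hold by (simp add: holds_def)
      qed (use 3 in auto)
    next
      show "(length (vs i) + 1) * 70 \<le> (n + 1) * 70" using len by simp
    qed (auto simp: less_Suc_eq fun_eq_iff)
  next
    case (2 i t)
    then show ?case using fr[of t] m by simp
  qed (auto simp: algebra_simps)
  then show ?thesis by simp
qed

definition holds_edges :: "(nat \<Rightarrow> nat) \<Rightarrow> nat \<Rightarrow> (nat \<times> nat) list \<Rightarrow> bool" where
  "holds_edges f p es \<longleftrightarrow> f p = length es \<and>
     (\<forall>i<length es. f (p + (i + i + 1)) = fst (es ! i) \<and> f (p + (i + i + 2)) = snd (es ! i))"

definition fst_end :: "nexp \<Rightarrow> nat \<Rightarrow> nexp" where
  "fst_end p v = NCell 0 (NPlus p (NPlus (NPlus (V v) (V v)) (NConst 1)))"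

definition snd_end :: "nexp \<Rightarrow> nat \<Rightarrow> nexp" where
  "snd_end p v = NCell 0 (NPlus p (NPlus (NPlus (V v) (V v)) (NConst 2)))"

text \<open>Marks are read from \<open>A\<close> but written to \<open>B\<close>, so they travel
  along one edge only. If the same vertices are stamped in both arrays beforehand, \<open>B\<close>
  ends up stamping their closed neighbourhood.\<close>

definition spread_marks :: "nat \<Rightarrow> nat \<Rightarrow> nat \<Rightarrow> nexp \<Rightarrow> nexp \<Rightarrow> com" where
  "spread_marks A B v p st = For v (NCell 0 p)
     (Seq (If (NEq (NCell A (fst_end p v)) st) (NAssign B (snd_end p v) st) Skip)
          (If (NEq (NCell A (snd_end p v)) st) (NAssign B (fst_end p v) st) Skip))"

lemma ht_spread_marks:
  assumes dist: "distinct [0, A, B, v]" and cost: "ncost p \<le> 4" "ncost st \<le> 4"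
    and val: "\<And>s'. frame {B, v} {} s s' \<Longrightarrow> nval p s' = pv \<and> nval st s' = stv"
    and es: "holds_edges (nmem s 0) pv es"
  shows "ht (spread_marks A B v p st) s ((length es + 1) * 200) (\<lambda>s'. frame {B, v} {} s s' \<and>
    nmem s' B = (\<lambda>x. if \<exists>e\<in>set es. fst e = x \<and> nmem s A (snd e) = stv \<or> snd e = x \<and> nmem s A (fst e) = stv
      then stv else nmem s B x))"
proof -
  let ?I = "\<lambda>i s'. frame {B, v} {} s s' \<and> nmem s' B = (\<lambda>x. if \<exists>e\<in>set (take i es).
      fst e = x \<and> nmem s A (snd e) = stv \<or> snd e = x \<and> nmem s A (fst e) = stv
      then stv else nmem s B x)"
  have [simp]: "B \<noteq> v" "v \<noteq> B" "A \<noteq> 0" "v \<noteq> 0" "B \<noteq> 0" "A \<noteq> B" "B \<noteq> A" "A \<noteq> v" "v \<noteq> A" using dist by auto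
  have fr: "nmem s' 0 = nmem s 0 \<and> nmem s' A = nmem s A" if "frame {B, v} {} s s'" for s'
    using that by (auto simp: frame_nmem)
  have "ht (spread_marks A B v p st) s ((length es + 1) * 200) (?I (length es))"
    unfolding spread_marks_def
  proof (intro ht_For[where I = ?I and b = 170], goal_cases)
    case (3 i t)
    from 3 have t: "nmem t 0 = nmem s 0" "nmem t A = nmem s A" "nval p t = pv" "nval st t = stv"
      using fr[of t] val[of t] by auto
    have ends: "nmem s 0 (pv + (i + i + 1)) = fst (es ! i)" "nmem s 0 (pv + (i + i + 2)) = snd (es ! i)"
      using es 3 by (auto simp: holds_edges_def)
    have vals: "nval (fst_end p v) r = fst (es ! i)" "nval (snd_end p v) r = snd (es ! i)" "nval st r = stv"
      "nmem r A = nmem s A"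
      if "frame {B, v} {} s r" "nmem r v 0 = i" for r
      using that fr[of r] val[of r] ends by (auto simp: fst_end_def snd_end_def)
    have "ncost (fst_end p v) \<le> 13" "ncost (snd_end p v) \<le> 13"
      using cost by (auto simp: fst_end_def snd_end_def)
    with 3 show ?case using cost vals[of t] vals[of "nupdate B x y t" for x y]
      by (intro ht_loop_free) (auto simp: take_Suc_conv_app_nth fun_eq_iff)
  next
    case (2 i t)
    then show ?case using val[of t] fr[of t] es by (simp add: holds_edges_def)
  next
    case 4
    have "length es * (170 + ncost (NCell 0 p) + 10) + ncost (NCell 0 p) + 10 \<le> length es * 185 + 5 + 10"
      by (intro add_mono mult_left_mono) (use cost in auto)
    also have "\<dots> \<le> (length es + 1) * 200" by simp
    finally show ?case .
  qed auto
  then show ?thesis by simp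
qed

text \<open>The neighbours of \<open>x\<close> in the order of the edge list: an intermediate
  specification, under which counting degrees and summing neighbours can be verified edge by
  edge.\<close>

definition adj_list :: "(nat \<times> nat) list \<Rightarrow> nat \<Rightarrow> nat list" where
  "adj_list es x = concat (map (\<lambda>(a, b). (if a = x then [b] else []) @ (if b = x then [a] else [])) es)"

definition count_degrees :: "nat \<Rightarrow> nat \<Rightarrow> nat \<Rightarrow> nexp \<Rightarrow> com" where
  "count_degrees D N v p = For v (NCell 0 p)
     (Seq (Seq (NAssign D (fst_end p v) (NPlus (NCell D (fst_end p v)) (NConst 1)))
               (NAssign D (snd_end p v) (NPlus (NCell D (snd_end p v)) (NConst 1))))
          (Seq (NAssign N (fst_end p v) (NPlus (NCell N (fst_end p v)) (snd_end p v)))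
               (NAssign N (snd_end p v) (NPlus (NCell N (snd_end p v)) (fst_end p v)))))"

lemma ht_count_degrees:
  assumes dist: "distinct [0, D, N, v]" and cost: "ncost p \<le> 4"
    and val: "\<And>s'. frame {D, N, v} {} s s' \<Longrightarrow> nval p s' = pv"
    and es: "holds_edges (nmem s 0) pv es"
  shows "ht (count_degrees D N v p) s ((length es + 1) * 200) (\<lambda>s'. frame {D, N, v} {} s s' \<and>
    nmem s' D = (\<lambda>x. nmem s D x + length (adj_list es x)) \<and>
    nmem s' N = (\<lambda>x. nmem s N x + sum_list (adj_list es x)))"
proof -
  let ?I = "\<lambda>i s'. frame {D, N, v} {} s s' \<and> nmem s' D = (\<lambda>x. nmem s D x + length (adj_list (take i es) x)) \<and>
    nmem s' N = (\<lambda>x. nmem s N x + sum_list (adj_list (take i es) x))"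
  have [simp]: "D \<noteq> v" "v \<noteq> D" "D \<noteq> 0" "v \<noteq> 0" "N \<noteq> 0" "D \<noteq> N" "N \<noteq> D" "N \<noteq> v" "v \<noteq> N" using dist by auto
  have fr: "nmem s' 0 = nmem s 0" if "frame {D, N, v} {} s s'" for s'
    using that by (auto simp: frame_nmem)
  have "ht (count_degrees D N v p) s ((length es + 1) * 200) (?I (length es))"
    unfolding count_degrees_def
  proof (intro ht_For[where I = ?I and b = 170], goal_cases)
    case (3 i t)
    have ends: "nmem s 0 (pv + (i + i + 1)) = fst (es ! i)" "nmem s 0 (pv + (i + i + 2)) = snd (es ! i)"
      using es 3 by (auto simp: holds_edges_def)
    have vals: "nval (fst_end p v) r = fst (es ! i) \<and> nval (snd_end p v) r = snd (es ! i)"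
      if "frame {D, N, v} {} s r" "nmem r v 0 = i" for r
      using that fr[of r] val[of r] ends by (auto simp: fst_end_def snd_end_def)
    have "ncost (fst_end p v) \<le> 13" "ncost (snd_end p v) \<le> 13"
      using cost by (auto simp: fst_end_def snd_end_def)
    with 3 show ?case using vals
      by (intro ht_loop_free) (auto simp: take_Suc_conv_app_nth fun_eq_iff adj_list_def split: prod.splits)
  next
    case (2 i t)
    then show ?case using val[of t] fr[of t] es by (simp add: holds_edges_def)
  next
    case 4
    have "length es * (170 + ncost (NCell 0 p) + 10) + ncost (NCell 0 p) + 10 \<le> length es * 185 + 5 + 10"
      by (intro add_mono mult_left_mono) (use cost in auto)
    also have "\<dots> \<le> (length es + 1) * 200" by simp
    finally show ?case .
  qed (auto simp: adj_list_def)
  then show ?thesis by simp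
qed

section \<open>The tables\<close>

text \<open>Arrays 2 to 9 are scratch space.  All other arrays are numbered in the order in which they are
  filled, so that after each phase of the program the arrays from some number on are still zero.\<close>

abbreviation (input) vi :: nat where "vi \<equiv> 2"
abbreviation (input) vj :: nat where "vj \<equiv> 3"
abbreviation (input) vl :: nat where "vl \<equiv> 4"
abbreviation (input) vacc :: nat where "vacc \<equiv> 5"
abbreviation (input) aTmp :: nat where "aTmp \<equiv> 6"
abbreviation (input) vp :: nat where "vp \<equiv> 7"
abbreviation (input) vq :: nat where "vq \<equiv> 8"
abbreviation (input) vpos :: nat where "vpos \<equiv> 9"
abbreviation (input) aK :: nat where "aK \<equiv> 10"
abbreviation (input) aTK :: nat where "aTK \<equiv> 11"
abbreviation (input) aQK :: nat where "aQK \<equiv> 12"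
abbreviation (input) aMM :: nat where "aMM \<equiv> 13"
abbreviation (input) aTpos :: nat where "aTpos \<equiv> 14"
abbreviation (input) aBP :: nat where "aBP \<equiv> 15"
abbreviation (input) aFP :: nat where "aFP \<equiv> 16"
abbreviation (input) aMark :: nat where "aMark \<equiv> 17"
abbreviation (input) aBag :: nat where "aBag \<equiv> 18"
abbreviation (input) aMarkV :: nat where "aMarkV \<equiv> 19"
abbreviation (input) aMarkN :: nat where "aMarkN \<equiv> 20"
abbreviation (input) aConf :: nat where "aConf \<equiv> 21"
abbreviation (input) aPar :: nat where "aPar \<equiv> 22"
abbreviation (input) aLast :: nat where "aLast \<equiv> 23"
abbreviation (input) aExt :: nat where "aExt \<equiv> 24"
abbreviation (input) aFree :: nat where "aFree \<equiv> 25"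
abbreviation (input) aRow :: nat where "aRow \<equiv> 26"
abbreviation (input) aRst :: nat where "aRst \<equiv> 27"
abbreviation (input) aDeg :: nat where "aDeg \<equiv> 28"
abbreviation (input) aNb :: nat where "aNb \<equiv> 29"
abbreviation (input) wWt :: nat where "wWt \<equiv> 1"
abbreviation (input) wF :: nat where "wF \<equiv> 2"

abbreviation (input) eM :: nexp where "eM \<equiv> NCell 0 (NConst 1)"
abbreviation (input) eid :: nexp where "eid \<equiv> NPlus (V vi) (NConst 1)"
abbreviation (input) eQ :: nexp where "eQ \<equiv> NCell 0 (NConst 2)"

definition next_bag :: "(nat \<Rightarrow> nat) \<Rightarrow> nat \<Rightarrow> nat" where
  "next_bag f p = p + (f p + 1)"

definition next_member :: "(nat \<Rightarrow> nat) \<Rightarrow> nat \<Rightarrow> nat" where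
  "next_member f p = (let r = p + (f p + 1) in r + (f r + (f r + 1)))"

text \<open>Cells 0 to 2 hold the three sizes and cell 3 the number of edges of the graph, followed
  by two words per edge.\<close>

definition tree_pos :: "(nat \<Rightarrow> nat) \<Rightarrow> nat" where
  "tree_pos f = 4 + (f 3 + f 3)"

definition bag_pos :: "(nat \<Rightarrow> nat) \<Rightarrow> nat \<Rightarrow> nat" where
  "bag_pos f t = (next_bag f ^^ t) (tree_pos f + (f (tree_pos f) + (f (tree_pos f) + 1)))"

text \<open>\<open>f 2\<close> is the number of bags, so the walk over the bags, carried one step
  past the last of them, ends where the first member begins.\<close>

definition member_pos :: "(nat \<Rightarrow> nat) \<Rightarrow> nat \<Rightarrow> nat" where
  "member_pos f j = (next_member f ^^ j) (bag_pos f (f 2))"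

text \<open>What filling the tables depends on, namely the contents of the input array. The
  structure of the tree enters only in the locale \<open>dp\<close>.\<close>

locale layout =
  fixes inp :: "nat \<Rightarrow> nat" and wt :: "nat \<Rightarrow> rat" and k n m q :: nat
    and gs ts :: "(nat \<times> nat) list" and bag vs :: "nat \<Rightarrow> nat list"
  assumes k_pos: "k > 0" and m_pos: "m > 0" and q_pos: "q > 0"
    and inp_m: "inp (Suc 0) = m" and inp_q: "inp 2 = q"
    and gs: "holds_edges inp 3 gs" and ts: "holds_edges inp (tree_pos inp) ts"
    and bag: "\<And>t. t < q \<Longrightarrow> holds inp (bag_pos inp t) (bag t) \<and> length (bag t) \<le> n"
    and vs: "\<And>j. j < m \<Longrightarrow> holds inp (member_pos inp j) (vs j) \<and> length (vs j) \<le> n"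
    and vs_ne: "\<And>j. j < m \<Longrightarrow> vs j \<noteq> []"
begin

definition Y :: "nat \<Rightarrow> nat set" where
  "Y t = {j. j < m \<and> set (vs j) \<inter> set (bag t) \<noteq> {}}"

definition cf :: "nat \<Rightarrow> nat \<Rightarrow> bool" where
  "cf i j \<longleftrightarrow> (\<exists>u\<in>set (vs j). u \<in> set (vs i) \<or>
     (\<exists>e\<in>set gs. fst e = u \<and> snd e \<in> set (vs i) \<or> snd e = u \<and> fst e \<in> set (vs i)))"

abbreviation K :: nat where "K \<equiv> num_codes m k"

text \<open>Uses \<open>k > 0\<close>. It puts the member indices into the range of the table of
  multiples of \<open>m\<close>, whose length is \<open>q * K\<close>, so that this table serves
  members, nodes and codes alike.\<close>

lemma m_less_K: "m < K"
  using k_pos by (rule num_codes_gt)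

lemma K_le_qK: "K \<le> q * K" "q \<le> q * K"
  using q_pos mult_le_mono2[of 1 K q] num_codes_pos[of m k] by (auto simp: Suc_le_eq)

lemma cf_refl: "i < m \<Longrightarrow> cf i i"
  using vs_ne[of i] unfolding cf_def by (metis list.set_sel(1))

lemma cf_sym: "cf i j \<Longrightarrow> cf j i"
  unfolding cf_def by blast

text \<open>One predicate selected by the array number, so that keeping all finished arrays intact
  is a single argument in \<open>tables_step\<close>.\<close>

definition ok :: "nat \<Rightarrow> (nat \<Rightarrow> nat) \<Rightarrow> bool" where
  "ok a f \<longleftrightarrow>
    (a = aK \<longrightarrow> f 0 = K) \<and>
    (a = aTK \<longrightarrow> (\<forall>t<q. f t = t * K)) \<and>
    (a = aQK \<longrightarrow> f 0 = q * K) \<and>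
    (a = aMM \<longrightarrow> (\<forall>i<q * K. f i = i * m)) \<and>
    (a = aTpos \<longrightarrow> f 0 = tree_pos inp) \<and>
    (a = aBP \<longrightarrow> (\<forall>t<q. f t = bag_pos inp t)) \<and>
    (a = aFP \<longrightarrow> (\<forall>j<m. f j = member_pos inp j)) \<and>
    (a = aBag \<longrightarrow> (\<forall>t<q. \<forall>j<m. 0 < f (t * m + j) \<longleftrightarrow> j \<in> Y t)) \<and>
    (a = aConf \<longrightarrow> (\<forall>i<m. \<forall>j<m. 0 < f (i * m + j) \<longleftrightarrow> cf i j)) \<and>
    (a = aPar \<longrightarrow> (\<forall>i. Suc i < K \<longrightarrow> f (Suc i) = i div m)) \<and>
    (a = aLast \<longrightarrow> (\<forall>i. Suc i < K \<longrightarrow> f (Suc i) = i mod m)) \<and>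
    (a = aExt \<longrightarrow> (\<forall>i. Suc i < K \<longrightarrow> (0 < f (Suc i) \<longleftrightarrow> extends_code cf m (Suc i)))) \<and>
    (a = aFree \<longrightarrow> (\<forall>c<K. 0 < f c \<longleftrightarrow> free_code cf m c)) \<and>
    (a = aRow \<longrightarrow> (\<forall>c<K. \<forall>j<m. 0 < f (c * m + j) \<longleftrightarrow> j \<in> set (lst m c))) \<and>
    (a = aRst \<longrightarrow> (\<forall>t<q. \<forall>c<K. f (t * K + c) = restrict_code m (Y t) c)) \<and>
    (a = aDeg \<longrightarrow> (\<forall>x. f x = length (adj_list ts x))) \<and>
    (a = aNb \<longrightarrow> (\<forall>x. f x = sum_list (adj_list ts x)))"

definition okW :: "(nat \<Rightarrow> rat) \<Rightarrow> bool" where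
  "okW g \<longleftrightarrow> (\<forall>c<K. g c = sum_list (map wt (lst m c)))"

text \<open>The single number \<open>r\<close> records the progress. The list weights in
  \<open>wWt\<close> have no number of their own, as they are computed in the same pass as
  \<open>aFree\<close>.\<close>

definition tables :: "nat \<Rightarrow> state \<Rightarrow> bool" where
  "tables r s \<longleftrightarrow> nmem s 0 = inp \<and> wmem s 0 = wt \<and> nmem s 1 = (\<lambda>_. 0) \<and> wmem s wF = (\<lambda>_. 0) \<and>
     (\<forall>a<r. ok a (nmem s a)) \<and> (\<forall>a\<ge>r. a \<ge> 10 \<longrightarrow> nmem s a = (\<lambda>_. 0)) \<and> (r > aFree \<longrightarrow> okW (wmem s wWt))"

lemma ok_scratch: "a < 10 \<Longrightarrow> ok a f"
  unfolding ok_def by auto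

text \<open>The frame rule for phases: a phase writes only scratch arrays and arrays from
  \<open>r\<close> to \<open>r' - 1\<close>, and has to describe only the latter, together with the
  list weights once they are due.\<close>

lemma tables_step:
  assumes "tables r s" "frame M W s s'" "r \<ge> 10" "r \<le> r'" "W \<subseteq> {wWt}"
    and "\<And>a. a \<in> M \<Longrightarrow> 1 < a \<and> (a < 10 \<or> r \<le> a \<and> a < r')"
    and new: "\<forall>a\<in>set [r..<r']. ok a (nmem s' a)"
    and W: "r' > aFree \<Longrightarrow> (r > aFree \<and> W = {}) \<or> okW (wmem s' wWt)"
  shows "tables r' s'"
proof -
  have old: "ok a (nmem s' a)" if "a < r" for a
  proof (cases "a < 10")
    case False
    then have "a \<notin> M" using that assms(6)[of a] by auto
    then show ?thesis using assms(1,2) that by (simp add: frame_nmem tables_def)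
  qed (rule ok_scratch)
  have "a \<notin> M" if "a \<ge> r'" "a \<ge> 10" for a using that assms(4) assms(6)[of a] by auto
  moreover have "0 \<notin> M" "1 \<notin> M" using assms(6)[of 0] assms(6)[of 1] by auto
  moreover have "0 \<notin> W" "wF \<notin> W" using assms(5) by auto
  ultimately show ?thesis using assms(1,2,4) old new W
    unfolding tables_def by (auto simp: frame_def not_less)
qed

lemma tables_nmem: "tables r s \<Longrightarrow> nmem s 0 = inp"
  by (simp add: tables_def)

lemma tables_ok: "tables r s \<Longrightarrow> a < r \<Longrightarrow> ok a (nmem s a)"
  by (simp add: tables_def)

lemma tables_blank: "tables r s \<Longrightarrow> r \<le> a \<Longrightarrow> a \<ge> 10 \<Longrightarrow> nmem s a = (\<lambda>_. 0)"
  by (simp add: tables_def)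

lemma pair_less: "a < A \<Longrightarrow> b < B \<Longrightarrow> a * B + b < A * (B::nat)"
  using mult_le_mono1[of "Suc a" A B] by simp

lemma pair_eq_iff: "b < B \<Longrightarrow> b' < B \<Longrightarrow> a * B + b = a' * B + b' \<longleftrightarrow> a = a' \<and> b = (b'::nat)"
proof
  assume *: "b < B" "b' < B" "a * B + b = a' * B + b'"
  have "(a * B + b) div B = a" "(a' * B + b') div B = a'" using *(1,2) by simp_all
  with * show "a = a' \<and> b = b'" by (metis add_left_cancel)
qed auto

end

section \<open>Filling the tables\<close>

primrec code_count :: "nat \<Rightarrow> com" where
  "code_count 0 = Set aK (NConst 1)"
| "code_count (Suc k) = Seq (code_count k)
     (Seq (mult_table aTmp vi vacc eM (V aK)) (Set aK (NPlus (V vacc) (NConst 1))))"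

text \<open>The program text depends on \<open>k\<close>: it consists of \<open>k\<close>
  multiplications by \<open>m\<close>, each carried out by \<open>m\<close> additions whose table is
  discarded and whose accumulator is kept.\<close>

lemma ht_code_count:
  assumes "nmem s 0 1 = m"
  shows "ht (code_count k) s ((k + 1) * (m + 1) * 100) (\<lambda>s'. frame {vi, vacc, aTmp, aK} {} s s' \<and>
    nmem s' aK 0 = num_codes m k)"
proof (induction k)
  case 0
  show ?case by (simp, rule ht_loop_free) auto
next
  case (Suc k)
  show ?case unfolding code_count.simps
  proof (rule ht_Seq[OF Suc], elim conjE)
    fix s1 assume f1: "frame {vi, vacc, aTmp, aK} {} s s1" and K: "nmem s1 aK 0 = num_codes m k"
    have m: "nmem s1 0 1 = m" using assms f1 by (simp add: frame_nmem)
    show "ht (Seq (mult_table aTmp vi vacc eM (V aK)) (Set aK (NPlus (V vacc) (NConst 1)))) s1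
      ((m + 1) * 100)
      (\<lambda>s'. frame {vi, vacc, aTmp, aK} {} s s' \<and> nmem s' aK 0 = num_codes m (Suc k))"
    proof (rule ht_Seq[OF ht_mult_table[where cnt = m and dv = "num_codes m k"], where d = 10], goal_cases)
      case (5 s2)
      then have "frame {vi, vacc, aTmp, aK} {} s s2"
        by (intro frame_trans[OF f1, of "{aTmp, vi, vacc}" "{}"]) auto
      with 5 show ?case by (intro ht_loop_free) auto
    next
      case (4 s')
      then show ?case using m K by (simp add: frame_nmem)
    qed auto
  qed simp
qed

context layout
begin

lemma ht_code_count': "tables 10 s \<Longrightarrow> ht (code_count k) s ((k + 1) * (m + 1) * 100) (tables 11)"
  apply (rule ht_mono[OF ht_code_count[of s m k]])
    apply (simp add: tables_def inp_m)
   apply simp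
  apply (elim conjE)
  apply (erule tables_step, assumption)
  apply (auto simp: ok_def)
  done

text \<open>The accumulator of the first table ends at \<open>q * K\<close>. With \<open>aQK\<close>
  in this role, it provides the length of the second table.\<close>

definition (in -) code_tables :: com where
  "code_tables = Seq (mult_table aTK vi aQK eQ (V aK)) (mult_table aMM vi vacc (V aQK) eM)"

lemma ht_code_tables:
  assumes s: "tables 11 s"
  shows "ht code_tables s ((q * K + q + 2) * 90) (tables 14)"
  unfolding code_tables_def
proof (rule ht_Seq)
  have base: "nmem s 0 = inp" "nmem s aK 0 = K"
    using s tables_nmem[OF s] tables_ok[OF s, of aK] by (auto simp: ok_def)
  show "ht (mult_table aTK vi aQK eQ (V aK)) s ((q + 1) * 90) (tables 13)"
  proof (rule ht_mono[OF ht_mult_table[where cnt = q and dv = K]], goal_cases)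
    case (6 s')
    then show ?case using base inp_q
      by (elim conjE, intro tables_step[OF s, where r' = 13]) (auto simp: ok_def)
  qed (use base inp_q in \<open>auto simp: frame_nmem\<close>)
next
  fix s assume s: "tables 13 s"
  have base: "nmem s 0 = inp" "nmem s aQK 0 = q * K"
    using s tables_nmem[OF s] tables_ok[OF s, of aQK] by (auto simp: ok_def)
  show "ht (mult_table aMM vi vacc (V aQK) eM) s ((q * K + 1) * 90) (tables 14)"
  proof (rule ht_mono[OF ht_mult_table[where cnt = "q * K" and dv = m]], goal_cases)
    case (6 s')
    then show ?case using base inp_m
      by (elim conjE, intro tables_step[OF s, where r' = 14]) (auto simp: ok_def)
  qed (use base inp_m in \<open>auto simp: frame_nmem\<close>)
qed simp


lemma less_qK: "t < q \<Longrightarrow> t < q * K" "j < m \<Longrightarrow> j < q * K"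
proof -
  show "t < q \<Longrightarrow> t < q * K" using K_le_qK by linarith
  show "j < m \<Longrightarrow> j < q * K" using m_less_K K_le_qK by linarith
qed

text \<open>The second walk continues where the first one leaves \<open>vpos\<close>, which is just
  behind the last bag.\<close>

definition (in -) position_tables :: com where
  "position_tables =
    Seq (Seq (Set aTpos (NPlus (NConst 4) (NPlus (NCell 0 (NConst 3)) (NCell 0 (NConst 3)))))
      (Set vpos (NPlus (V aTpos) (NPlus (NCell 0 (V aTpos)) (NPlus (NCell 0 (V aTpos)) (NConst 1))))))
    (Seq (iterate_table aBP vi vpos eQ (NPlus (V vpos) (NPlus (NCell 0 (V vpos)) (NConst 1))))
      (let r = NPlus (V vpos) (NPlus (NCell 0 (V vpos)) (NConst 1))
       in iterate_table aFP vi vpos eM (NPlus r (NPlus (NCell 0 r) (NPlus (NCell 0 r) (NConst 1))))))"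

lemma ht_position_tables:
  assumes s: "tables 14 s"
  shows "ht position_tables s ((q + m + 3) * 80) (tables 17)"
  unfolding position_tables_def Let_def
proof (rule ht_Seq)
  let ?init = "Seq (Set aTpos (NPlus (NConst 4) (NPlus (NCell 0 (NConst 3)) (NCell 0 (NConst 3)))))
      (Set vpos (NPlus (V aTpos) (NPlus (NCell 0 (V aTpos)) (NPlus (NCell 0 (V aTpos)) (NConst 1)))))"
  have base: "nmem s 0 = inp" using s tables_nmem[OF s] by simp
  show "ht (?init) s 50
      (\<lambda>s'. tables 15 s' \<and> nmem s' vpos 0 = bag_pos inp 0)"
  proof (rule ht_loop_free, simp, simp, intro conjI)
    show "tables 15 (sem (?init) s)"
      by (rule tables_step[OF s, where M = "{aTpos, vpos}" and W = "{}"])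
        (use base in \<open>auto simp: ok_def tree_pos_def\<close>)
  qed (use base in \<open>auto simp: bag_pos_def tree_pos_def\<close>)
next
  let ?r = "NPlus (V vpos) (NPlus (NCell 0 (V vpos)) (NConst 1))"
  fix s assume *: "tables 15 s \<and> nmem s vpos 0 = bag_pos inp 0"
  then have s: "tables 15 s" by simp
  have base: "nmem s 0 = inp" using s tables_nmem[OF s] by simp
  show "ht (Seq (iterate_table aBP vi vpos eQ (?r))
      (iterate_table aFP vi vpos eM (NPlus ?r (NPlus (NCell 0 ?r) (NPlus (NCell 0 ?r) (NConst 1)))))) s
      ((q + m + 2) * 80) (tables 17)"
  proof (rule ht_Seq)
    have pos: "(next_bag inp ^^ t) (bag_pos inp 0) = bag_pos inp t" for t by (simp add: bag_pos_def)
    show "ht (iterate_table aBP vi vpos eQ (?r)) s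
      ((q + 1) * 80) (\<lambda>s'. tables 16 s' \<and> nmem s' vpos 0 = bag_pos inp q)"
    proof (rule ht_mono[OF ht_iterate_table[where cnt = q and f = "next_bag inp"]], goal_cases)
      case (6 s')
      then show ?case using base pos *
        by (elim conjE, intro conjI tables_step[OF s, where r' = 16]) (auto simp: ok_def)
    qed (use base inp_q in \<open>auto simp: frame_nmem next_bag_def\<close>)
  next
    fix s assume *: "tables 16 s \<and> nmem s vpos 0 = bag_pos inp q"
    then have s: "tables 16 s" by simp
    have base: "nmem s 0 = inp" using s tables_nmem[OF s] by simp
    have pos: "(next_member inp ^^ j) (bag_pos inp q) = member_pos inp j" for j
      by (simp add: member_pos_def inp_q)
    show "ht (iterate_table aFP vi vpos eM (NPlus ?r (NPlus (NCell 0 ?r) (NPlus (NCell 0 ?r) (NConst 1))))) s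
        ((m + 1) * 80) (tables 17)"
    proof (rule ht_mono[OF ht_iterate_table[where cnt = m and f = "next_member inp"]], goal_cases)
      case (6 s')
      then show ?case using base pos *
        by (elim conjE, intro conjI tables_step[OF s, where r' = 17]) (auto simp: ok_def)
    qed (use base inp_m in \<open>auto simp: frame_nmem next_member_def Let_def\<close>)
  qed simp
qed simp

definition (in -) bag_table :: com where
  "bag_table = For vi eQ
     (Seq (mark_list aMark vj (NCell aBP (V vi)) eid)
       (hit_row aFP vj vl aMark aBag (NCell aMM (V vi)) eid))"

lemma ht_bag_table:
  assumes s: "tables 17 s"
  shows "ht bag_table s (q * m * (n + 1) * 400 + 20) (tables 19)"
proof -
  let ?mark = "mark_list aMark vj (NCell aBP (V vi)) eid"
  let ?row = "hit_row aFP vj vl aMark aBag (NCell aMM (V vi)) eid"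
  \<comment> \<open>All stamps so far are at most \<open>i\<close>, so the stamp
    \<open>i + 1\<close> of the next round is fresh. Stamps start at 1 because blank memory holds
    0.\<close>
  let ?I = "\<lambda>i s'. frame {vi, vj, vl, aMark, aBag} {} s s' \<and> (\<forall>u. nmem s' aMark u \<le> i) \<and>
    nmem s' aBag = (\<lambda>x. if \<exists>t<i. \<exists>j<m. x = t * m + j \<and> j \<in> Y t then 1 else 0)"
  have base: "nmem s 0 = inp" "\<forall>i<q * K. nmem s aMM i = i * m"
    "\<forall>t<q. nmem s aBP t = bag_pos inp t" "\<forall>j<m. nmem s aFP j = member_pos inp j"
    "nmem s aMark = (\<lambda>_. 0)" "nmem s aBag = (\<lambda>_. 0)"
    using s tables_nmem[OF s] tables_ok[OF s, of aMM] tables_ok[OF s, of aBP] tables_ok[OF s, of aFP]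
    tables_blank[OF s, of aMark] tables_blank[OF s, of aBag] by (auto simp: ok_def)
  have loop: "ht bag_table s (q * m * (n + 1) * 400 + 20) (?I q)"
    unfolding bag_table_def
  proof (rule ht_For[where I = ?I and b = "m * (n + 1) * 250"], goal_cases)
    case 1
    then show ?case using base by simp
  next
    case (2 i t)
    then show ?case using base inp_q by (auto simp: frame_nmem)
  next
    case (3 i t)
    from 3 have t: "nmem t 0 = inp" "nmem t aBP i = bag_pos inp i" "nmem t aMM i = i * m"
      "\<forall>j<m. nmem t aFP j = member_pos inp j" "nmem t vi 0 = i" "\<forall>u. nmem t aMark u \<le> i"
      using base less_qK(1)[OF 3(1)] by (auto simp: frame_nmem)
    from 3 have fr: "frame {vi, vj, vl, aMark, aBag} {} s t" by simp
    have len: "length (bag i) \<le> n" and hold: "holds inp (bag_pos inp i) (bag i)" using bag 3 by auto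
    show ?case
    proof (rule ht_Seq)
      show "ht (?mark) t ((length (bag i) + 1) * 40)
        (\<lambda>s'. frame {aMark, vj} {} t s' \<and>
          nmem s' aMark = (\<lambda>u. if u \<in> set (bag i) then i + 1 else nmem t aMark u))"
        by (rule ht_mark_list[where pv = "bag_pos inp i"]) (use t hold in \<open>auto simp: frame_nmem\<close>)
    next
      fix t' assume t': "frame {aMark, vj} {} t t' \<and>
          nmem t' aMark = (\<lambda>u. if u \<in> set (bag i) then i + 1 else nmem t aMark u)"
      then have vals: "nmem t' 0 = inp" "nmem t' aMM i = i * m" "\<forall>j<m. nmem t' aFP j = member_pos inp j"
        "nmem t' vi 0 = i" "nmem t' aBag = nmem t aBag" using t by (auto simp: frame_nmem)
      have fr': "frame {vi, vj, vl, aMark, aBag} {} s t'"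
        by (rule frame_trans[OF fr, of "{aMark, vj}" "{}"]) (use t' in auto)
      have mark: "nmem t' aMark u = i + 1 \<longleftrightarrow> u \<in> set (bag i)" for u
        using t' t(6)[rule_format, of u] by auto
      have le: "nmem t' aMark u \<le> i + 1" for u
        using t' t(6)[rule_format, of u] by auto
      show "ht (?row) t'
        (m * (n + 1) * 100 + 100)
        (\<lambda>s'. nmem s' vi 0 = i \<and> ?I (Suc i) (nupdate vi 0 (Suc i) s'))"
      proof (rule ht_mono[OF ht_hit_row[where bv = "i * m" and stv = "i + 1" and n = n and m = m and vs = vs]], goal_cases)
        case (8 r)
        have "frame {vi, vj, vl, aMark, aBag} {} s r"
          by (rule frame_trans[OF fr', of "{aBag, vj, vl}" "{}"]) (use 8 in auto)
        moreover have "nmem r aBag = (\<lambda>x. if \<exists>t<Suc i. \<exists>j<m. x = t * m + j \<and> j \<in> Y t then 1 else 0)"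
        proof
          fix x
          have "nmem r aBag x = (if \<exists>j<m. x = i * m + j \<and> (\<exists>u\<in>set (vs j). u \<in> set (bag i)) then 1
             else nmem t aBag x)"
            using 8 mark vals by auto
          also have "(\<exists>j<m. x = i * m + j \<and> (\<exists>u\<in>set (vs j). u \<in> set (bag i))) \<longleftrightarrow>
              (\<exists>j<m. x = i * m + j \<and> j \<in> Y i)" unfolding Y_def by blast
          finally show "nmem r aBag x = (if \<exists>t<Suc i. \<exists>j<m. x = t * m + j \<and> j \<in> Y t then 1 else 0)"
            using 3 by (auto simp: less_Suc_eq)
        qed
        moreover have "nmem r aMark u \<le> Suc i" "nmem r vi 0 = i" for u
          using 8 vals le[of u] by (auto simp: frame_nmem)
        ultimately show ?case by simp
      qed (use vals vs in \<open>auto simp: frame_nmem inp_m\<close>)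
    next
      \<comment> \<open>As \<open>m\<close> is positive, \<open>z\<close> dominates both 1 and
        \<open>n + 1\<close>, and so all terms in the cost of a round.\<close>
      define z where "z = m * (n + 1)"
      have "1 * 1 \<le> z" "1 * (n + 1) \<le> z"
        using m_pos unfolding z_def by (intro mult_le_mono; simp)+
      then show "(length (bag i) + 1) * 40 + (m * (n + 1) * 100 + 100) \<le> m * (n + 1) * 250"
        unfolding z_def[symmetric] using len by (simp add: algebra_simps)
    qed
  next
    case 4
    have "1 * 1 \<le> m * (n + 1)" using m_pos by (intro mult_le_mono; simp)+
    then have "q * (m * (n + 1) * 250 + ncost eQ + 10) \<le> q * (m * (n + 1) * 400)"
      by (intro mult_left_mono) auto
    moreover have "ncost eQ + 10 \<le> 20" by simp
    ultimately show ?case using add_mono by (fastforce simp only: mult.assoc add.assoc)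
  qed
  show ?thesis
  proof (rule ht_mono[OF loop], goal_cases)
    case (2 s')
    have "0 < nmem s' aBag (t * m + j) \<longleftrightarrow> j \<in> Y t" if "t < q" "j < m" for t j
      using 2 that pair_eq_iff[OF that(2)] by auto
    with 2 show ?case by (elim conjE, intro tables_step[OF s, where r' = 19]) (auto simp: ok_def)
  qed simp
qed

text \<open>Two members conflict if and only if the vertices of one meet the closed neighbourhood of
  the vertices of the other. One pass over the edges and one over all vertex lists therefore yield a
  whole row.\<close>

definition (in -) conflict_table :: com where
  "conflict_table = For vi eM
     (Seq (Seq (mark_list aMarkV vj (NCell aFP (V vi)) eid)
               (mark_list aMarkN vj (NCell aFP (V vi)) eid))
          (Seq (spread_marks aMarkV aMarkN vj (NConst 3) eid)
               (hit_row aFP vj vl aMarkN aConf (NCell aMM (V vi)) eid)))"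

lemma ht_conflict_table:
  assumes s: "tables 19 s"
  shows "ht conflict_table s (m * (m * (n + 1) + length gs) * 700 + 20) (tables 22)"
proof -
  let ?markV = "mark_list aMarkV vj (NCell aFP (V vi)) eid"
  let ?markN = "mark_list aMarkN vj (NCell aFP (V vi)) eid"
  let ?spread = "spread_marks aMarkV aMarkN vj (NConst 3) eid"
  let ?row = "hit_row aFP vj vl aMarkN aConf (NCell aMM (V vi)) eid"
  let ?M = "{vi, vj, vl, aMarkV, aMarkN, aConf}"
  let ?I = "\<lambda>i s'. frame ?M {} s s' \<and> (\<forall>u. nmem s' aMarkV u \<le> i) \<and> (\<forall>u. nmem s' aMarkN u \<le> i) \<and>
    nmem s' aConf = (\<lambda>x. if \<exists>t<i. \<exists>j<m. x = t * m + j \<and> cf t j then 1 else 0)"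
  have base: "nmem s 0 = inp" "\<forall>i<q * K. nmem s aMM i = i * m"
    "\<forall>j<m. nmem s aFP j = member_pos inp j"
    "nmem s aMarkV = (\<lambda>_. 0)" "nmem s aMarkN = (\<lambda>_. 0)" "nmem s aConf = (\<lambda>_. 0)"
    using s tables_nmem[OF s] tables_ok[OF s, of aMM] tables_ok[OF s, of aFP]
    tables_blank[OF s, of aMarkV] tables_blank[OF s, of aMarkN] tables_blank[OF s, of aConf]
    by (auto simp: ok_def)
  have loop: "ht conflict_table s (m * (m * (n + 1) + length gs) * 700 + 20) (?I m)"
    unfolding conflict_table_def
  proof (rule ht_For[where I = ?I and b = "(m * (n + 1) + length gs) * 600"], goal_cases)
    case 1
    then show ?case using base by simp
  next
    case (2 i t)
    then show ?case using base inp_m by (auto simp: frame_nmem)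
  next
    case (3 i t)
    from 3 have t: "nmem t 0 = inp" "nmem t aMM i = i * m" "\<forall>j<m. nmem t aFP j = member_pos inp j"
      "nmem t vi 0 = i" "\<forall>u. nmem t aMarkV u \<le> i" "\<forall>u. nmem t aMarkN u \<le> i"
      "nmem t aConf = (\<lambda>x. if \<exists>t<i. \<exists>j<m. x = t * m + j \<and> cf t j then 1 else 0)"
      using base less_qK(2)[OF 3(1)] by (auto simp: frame_nmem)
    from 3 have fr: "frame ?M {} s t" by simp
    have len: "length (vs i) \<le> n" and hold: "holds inp (member_pos inp i) (vs i)" using vs 3 by auto
    show ?case
    proof (rule ht_Seq)
      show "ht (Seq (?markV)
               (?markN)) t ((n + 1) * 80)
        (\<lambda>s'. frame {aMarkV, aMarkN, vj} {} t s' \<and>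
          nmem s' aMarkV = (\<lambda>u. if u \<in> set (vs i) then i + 1 else nmem t aMarkV u) \<and>
          nmem s' aMarkN = (\<lambda>u. if u \<in> set (vs i) then i + 1 else nmem t aMarkN u))"
      proof (rule ht_Seq)
        show "ht (?markV) t
          ((length (vs i) + 1) * 40) (\<lambda>s'. frame {aMarkV, vj} {} t s' \<and>
          nmem s' aMarkV = (\<lambda>u. if u \<in> set (vs i) then i + 1 else nmem t aMarkV u))"
          by (rule ht_mark_list[where pv = "member_pos inp i"]) (use t hold 3 in \<open>auto simp: frame_nmem\<close>)
      next
        fix t' assume t': "frame {aMarkV, vj} {} t t' \<and>
          nmem t' aMarkV = (\<lambda>u. if u \<in> set (vs i) then i + 1 else nmem t aMarkV u)"
        show "ht (?markN) t'
          ((length (vs i) + 1) * 40) (\<lambda>s'. frame {aMarkV, aMarkN, vj} {} t s' \<and>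
          nmem s' aMarkV = (\<lambda>u. if u \<in> set (vs i) then i + 1 else nmem t aMarkV u) \<and>
          nmem s' aMarkN = (\<lambda>u. if u \<in> set (vs i) then i + 1 else nmem t aMarkN u))"
        proof (rule ht_mono[OF ht_mark_list[where pv = "member_pos inp i" and stv = "i + 1" and vs = "vs i"]], goal_cases)
          case (7 r)
          have "frame {aMarkV, aMarkN, vj} {} t r"
            by (rule frame_trans[of "{aMarkV, vj}" "{}" t t' "{aMarkN, vj}" "{}"]) (use t' 7 in auto)
          then show ?case using 7 t' by (auto simp: frame_nmem)
        qed (use t t' hold 3 in \<open>auto simp: frame_nmem\<close>)
      qed (use len in simp)
    next
      fix t' assume t': "frame {aMarkV, aMarkN, vj} {} t t' \<and>
          nmem t' aMarkV = (\<lambda>u. if u \<in> set (vs i) then i + 1 else nmem t aMarkV u) \<and>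
          nmem t' aMarkN = (\<lambda>u. if u \<in> set (vs i) then i + 1 else nmem t aMarkN u)"
      then have vals: "nmem t' 0 = inp" "nmem t' aMM i = i * m" "\<forall>j<m. nmem t' aFP j = member_pos inp j"
        "nmem t' vi 0 = i" "nmem t' aConf = nmem t aConf" using t by (auto simp: frame_nmem)
      have fr': "frame ?M {} s t'"
        by (rule frame_trans[OF fr, of "{aMarkV, aMarkN, vj}" "{}"]) (use t' in auto)
      have mark: "nmem t' aMarkV u = i + 1 \<longleftrightarrow> u \<in> set (vs i)"
        "nmem t' aMarkN u = i + 1 \<longleftrightarrow> u \<in> set (vs i)" for u
        using t' t(5,6)[rule_format, of u] by auto
      have le: "nmem t' aMarkV u \<le> i + 1" "nmem t' aMarkN u \<le> i + 1" for u
        using t' t(5,6)[rule_format, of u] by auto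
      show "ht (Seq (?spread)
               (?row)) t'
        ((length gs + 1) * 200 + (m * (n + 1) * 100 + 100))
        (\<lambda>s'. nmem s' vi 0 = i \<and> ?I (Suc i) (nupdate vi 0 (Suc i) s'))"
      proof (rule ht_Seq[OF ht_spread_marks[where pv = 3 and stv = "i + 1" and es = gs],
          where d = "m * (n + 1) * 100 + 100"], goal_cases)
        case (6 r)
        let ?nb = "\<lambda>x. \<exists>e\<in>set gs. fst e = x \<and> snd e \<in> set (vs i) \<or> snd e = x \<and> fst e \<in> set (vs i)"
        from 6 have rN: "nmem r aMarkN = (\<lambda>x. if ?nb x then i + 1 else nmem t' aMarkN x)"
          using mark by simp
        then have markN: "nmem r aMarkN u = i + 1 \<longleftrightarrow> u \<in> set (vs i) \<or> ?nb u" for u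
          using mark(2)[of u] by auto
        have leN: "nmem r aMarkN u \<le> i + 1" for u using rN le(2)[of u] by auto
        from 6 vals have rv: "nmem r 0 = inp" "nmem r aMM i = i * m" "\<forall>j<m. nmem r aFP j = member_pos inp j"
          "nmem r vi 0 = i" "nmem r aConf = nmem t aConf" "nmem r aMarkV = nmem t' aMarkV"
          by (auto simp: frame_nmem)
        have frr: "frame ?M {} s r"
          by (rule frame_trans[OF fr', of "{aMarkN, vj}" "{}"]) (use 6 in auto)
        show ?case
        proof (rule ht_mono[OF ht_hit_row[where bv = "i * m" and stv = "i + 1" and n = n and m = m and vs = vs]], goal_cases)
          case (8 r')
          have "frame ?M {} s r'"
            by (rule frame_trans[OF frr, of "{aConf, vj, vl}" "{}"]) (use 8 in auto)
          moreover have "nmem r' aConf = (\<lambda>x. if \<exists>t<Suc i. \<exists>j<m. x = t * m + j \<and> cf t j then 1 else 0)"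
          proof
            fix x
            have "(\<exists>j<m. x = i * m + j \<and> (\<exists>u\<in>set (vs j). nmem r aMarkN u = i + 1)) \<longleftrightarrow>
              (\<exists>j<m. x = i * m + j \<and> cf i j)" unfolding markN cf_def ..
            with 8 have "nmem r' aConf x = (if \<exists>j<m. x = i * m + j \<and> cf i j then 1 else nmem r aConf x)"
              by presburger
            then show "nmem r' aConf x = (if \<exists>t<Suc i. \<exists>j<m. x = t * m + j \<and> cf t j then 1 else 0)"
              using t(7) rv(5) by (auto simp: less_Suc_eq)
          qed
          moreover have "nmem r' aMarkV u \<le> Suc i" "nmem r' aMarkN u \<le> Suc i" "nmem r' vi 0 = i" for u
            using 8 rv leN[of u] le(1)[of u] by (auto simp: frame_nmem)
          ultimately show ?case by simp
        qed (use rv vs in \<open>auto simp: frame_nmem inp_m\<close>)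
      qed (use vals gs in \<open>auto simp: frame_nmem\<close>)
    next
      define z where "z = m * (n + 1)"
      have "1 * 1 \<le> z" "1 * (n + 1) \<le> z"
        using m_pos unfolding z_def by (intro mult_le_mono; simp)+
      then show "(n + 1) * 80 + ((length gs + 1) * 200 + (m * (n + 1) * 100 + 100))
         \<le> (m * (n + 1) + length gs) * 600"
        unfolding z_def[symmetric] by (simp add: algebra_simps)
    qed
  next
    case 4
    have "1 * 1 \<le> m * (n + 1)" using m_pos by (intro mult_le_mono; simp)+
    then have "m * ((m * (n + 1) + length gs) * 600 + ncost eM + 10) \<le> m * ((m * (n + 1) + length gs) * 700)"
      by (intro mult_left_mono) auto
    moreover have "ncost eM + 10 \<le> 20" by simp
    ultimately show ?case using add_mono by (fastforce simp only: mult.assoc add.assoc)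
  qed
  show ?thesis
  proof (rule ht_mono[OF loop], goal_cases)
    case (2 s')
    have "0 < nmem s' aConf (t * m + j) \<longleftrightarrow> cf t j" if "t < m" "j < m" for t j
      using 2 that pair_eq_iff[OF that(2)] by auto
    with 2 show ?case by (elim conjE, intro tables_step[OF s, where r' = 22]) (auto simp: ok_def)
  qed simp
qed


section \<open>Tables indexed by lists\<close>

abbreviation (in -) (input) eK1 :: nexp where "eK1 \<equiv> NMinus (V aK) (NConst 1)"
abbreviation (in -) (input) epar :: nexp where "epar \<equiv> NCell aPar eid"
abbreviation (in -) (input) elast :: nexp where "elast \<equiv> NCell aLast eid"

text \<open>Quotient and remainder of \<open>vi\<close> by \<open>m\<close> are kept as running
  counters, since the machine cannot divide: \<open>vq\<close> wraps around at \<open>m\<close>, and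
  \<open>vp\<close> then moves on.\<close>

definition (in -) trie_tables :: com where
  "trie_tables = Seq (Seq (Set vp (NConst 0)) (Set vq (NConst 0)))
    (For vi eK1 (Seq (Seq (NAssign aPar eid (V vp)) (NAssign aLast eid (V vq)))
      (Seq (Set vq (NPlus (V vq) (NConst 1)))
        (If (NEq (V vq) eM) (Seq (Set vq (NConst 0)) (Set vp (NPlus (V vp) (NConst 1)))) Skip))))"

lemma ht_trie_tables:
  assumes s: "tables 22 s"
  shows "ht trie_tables s (K * 100) (tables 24)"
proof -
  let ?step = "Seq (Seq (NAssign aPar eid (V vp)) (NAssign aLast eid (V vq)))
    (Seq (Set vq (NPlus (V vq) (NConst 1)))
      (If (NEq (V vq) eM) (Seq (Set vq (NConst 0)) (Set vp (NPlus (V vp) (NConst 1)))) Skip))"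
  let ?I = "\<lambda>i s'. frame {vi, vp, vq, aPar, aLast} {} s s' \<and> nmem s' vp 0 = i div m \<and> nmem s' vq 0 = i mod m \<and>
    (\<forall>j<i. nmem s' aPar (Suc j) = j div m) \<and> (\<forall>j<i. nmem s' aLast (Suc j) = j mod m)"
  have base: "nmem s 0 = inp" "nmem s aK 0 = K"
    using s tables_nmem[OF s] tables_ok[OF s, of aK] by (auto simp: ok_def)
  have "ht trie_tables s (K * 100) (?I (K - 1))"
    unfolding trie_tables_def
  proof (rule ht_Seq)
    show "ht (Seq (Set vp (NConst 0)) (Set vq (NConst 0))) s 6 (?I 0)"
      by (rule ht_loop_free) auto
  next
    fix t assume t: "?I 0 t"
    show "ht (For vi eK1 (?step))
      t (K * 94) (?I (K - 1))"
    proof (rule ht_For[where I = ?I and b = 60], goal_cases)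
      case (3 i r)
      then have "nmem r 0 = inp" by (auto simp: frame_nmem base)
      with 3 show ?case
        by (intro ht_loop_free) (auto simp: inp_m less_Suc_eq div_Suc mod_Suc)
    next
      case 4
      show ?case using num_codes_pos[of m k] by (simp del: num_codes_pos)
    qed (use t base in \<open>auto simp: frame_nmem\<close>)
  next
    show "6 + K * 94 \<le> K * 100" using num_codes_pos[of m k] by linarith
  qed
  then show ?thesis
  proof (rule ht_mono, goal_cases)
    case (2 s')
    then show ?case by (elim conjE, intro tables_step[OF s, where r' = 24]) (auto simp: ok_def)
  qed simp
qed

lemma div_less_code: "Suc i < K \<Longrightarrow> i div m < K"
  using div_le_dividend[of i m] by linarith

text \<open>Follows \<open>extends_code_Suc_Suc\<close>. When the last element is rejected nothing
  is written, and the cell keeps its initial 0.\<close>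

definition (in -) extension_table :: com where
  "extension_table = For vi eK1
    (If (NEq epar (NConst 0)) (NAssign aExt eid (NConst 1))
      (If (And (NonZero (NCell aExt (NPlus (NPlus (NCell aMM (NCell aPar epar)) elast) (NConst 1))))
               (Not (NonZero (NCell aConf (NPlus (NCell aMM (NCell aLast epar)) elast)))))
        (NAssign aExt eid (NConst 1)) Skip))"

lemma ht_extension_table:
  assumes s: "tables 24 s"
  shows "ht extension_table s (K * 130) (tables 25)"
proof -
  let ?I = "\<lambda>i s'. frame {vi, aExt} {} s s' \<and>
    (\<forall>j<i. 0 < nmem s' aExt (Suc j) \<longleftrightarrow> extends_code cf m (Suc j)) \<and> (\<forall>j\<ge>i. nmem s' aExt (Suc j) = 0)"
  have base: "nmem s 0 = inp" "nmem s aK 0 = K" "\<forall>i<q * K. nmem s aMM i = i * m"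
    "\<forall>i<m. \<forall>j<m. 0 < nmem s aConf (i * m + j) \<longleftrightarrow> cf i j"
    "\<forall>i. Suc i < K \<longrightarrow> nmem s aPar (Suc i) = i div m" "\<forall>i. Suc i < K \<longrightarrow> nmem s aLast (Suc i) = i mod m"
    "nmem s aExt = (\<lambda>_. 0)"
    using s tables_nmem[OF s] tables_ok[OF s, of aK] tables_ok[OF s, of aMM] tables_ok[OF s, of aConf]
      tables_ok[OF s, of aPar] tables_ok[OF s, of aLast] tables_blank[OF s, of aExt] by (auto simp: ok_def)
  have "ht extension_table s (K * 130) (?I (K - 1))"
    unfolding extension_table_def
  proof (rule ht_For[where I = ?I and b = 100], goal_cases)
    case (3 i t)
    then have f: "frame {vi, aExt} {} s t" and v: "nmem t vi 0 = i" and i: "Suc i < K" by auto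
    have par: "nmem t aPar (Suc i) = i div m" and last: "nmem t aLast (Suc i) = i mod m"
      using base f i by (auto simp: frame_nmem)
    show ?case
    proof (cases "i div m")
      case 0
      with 3 v par show ?thesis
        by (intro ht_loop_free) (auto simp: less_Suc_eq extends_code_Suc_0)
    next
      case (Suc c)
      then have c: "Suc c < K" using div_less_code[OF i] by simp
      have "Suc c * m + i mod m = i" using div_mult_mod_eq[of i m] unfolding Suc .
      then have "m + c * m + i mod m = i" by simp
      moreover have "c div m \<le> c" by simp
      then have "c div m * m \<le> c * m" by (rule mult_le_mono1)
      \<comment> \<open>Deleting the last but one element lowers the code, so the entry that is
        looked up has already been computed.\<close>
      ultimately have less: "c div m * m + i mod m < i" using m_pos by linarith
      have "c div m < K" "c div m < q * K" "c mod m < q * K" "i mod m < m" "c mod m < m"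
        using div_less_code[OF c] less_le_trans[OF div_less_code[OF c] K_le_qK(1)] m_pos less_qK(2) by auto
      then have vals: "nmem t aPar (Suc c) = c div m" "nmem t aLast (Suc c) = c mod m"
        "nmem t aMM (c div m) = c div m * m" "nmem t aMM (c mod m) = c mod m * m"
        "0 < nmem t aConf (c mod m * m + i mod m) \<longleftrightarrow> cf (c mod m) (i mod m)"
        using base f c by (auto simp: frame_nmem)
      have ext: "0 < nmem t aExt (Suc (c div m * m + i mod m)) \<longleftrightarrow>
          extends_code cf m (Suc (c div m * m + i mod m))" using 3 less by blast
      note main = extends_code_Suc_Suc[of m i c cf, OF m_pos Suc]
      let ?P = "If (NEq epar (NConst 0)) (NAssign aExt eid (NConst 1))
        (If (And (NonZero (NCell aExt (NPlus (NPlus (NCell aMM (NCell aPar epar)) elast) (NConst 1))))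
               (Not (NonZero (NCell aConf (NPlus (NCell aMM (NCell aLast epar)) elast)))))
        (NAssign aExt eid (NConst 1)) Skip)"
      have "sem ?P t = (if extends_code cf m (Suc i) then nupdate aExt (Suc i) 1 t else t)"
        unfolding main ext[symmetric] using vals by (simp add: v par last Suc)
      then show ?thesis using 3 v
        by (intro ht_loop_free) (auto simp: less_Suc_eq simp del: sem.simps)
    qed
  next
    case 4
    show ?case using num_codes_pos[of m k] by (simp del: num_codes_pos)
  qed (use base in \<open>auto simp: frame_nmem\<close>)
  then show ?thesis
  proof (rule ht_mono, goal_cases)
    case (2 s')
    have "0 < nmem s' aExt (Suc i) \<longleftrightarrow> extends_code cf m (Suc i)" if "Suc i < K" for i
    proof -
      have "i < K - 1" using that by simp
      then show ?thesis using 2 by blast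
    qed
    with 2 show ?case by (elim conjE, intro tables_step[OF s, where r' = 25]) (auto simp: ok_def)
  qed simp
qed

definition (in -) free_table :: com where
  "free_table = Seq (Seq (NAssign aFree (NConst 0) (NConst 1)) (WAssign wWt (NConst 0) WZero))
    (For vi eK1
      (Seq (If (And (NonZero (NCell aFree epar)) (NonZero (NCell aExt eid))) (NAssign aFree eid (NConst 1)) Skip)
        (WAssign wWt eid (WPlus (WCell wWt epar) (WCell 0 elast)))))"

lemma ht_free_table:
  assumes s: "tables 25 s"
  shows "ht free_table s (K * 130) (tables 26)"
proof -
  let ?step = "Seq (If (And (NonZero (NCell aFree epar)) (NonZero (NCell aExt eid))) (NAssign aFree eid (NConst 1)) Skip)
    (WAssign wWt eid (WPlus (WCell wWt epar) (WCell 0 elast)))"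
  \<comment> \<open>The bound is \<open>c \<le> i\<close> and not \<open>c < i\<close>: code 0, the
    empty list, is entered before the loop, and iteration \<open>i\<close> fills the entry of code
    \<open>i + 1\<close>.\<close>
  let ?I = "\<lambda>i s'. frame {vi, aFree} {wWt} s s' \<and>
    (\<forall>c\<le>i. 0 < nmem s' aFree c \<longleftrightarrow> free_code cf m c) \<and> (\<forall>c>i. nmem s' aFree c = 0) \<and>
    (\<forall>c\<le>i. wmem s' wWt c = sum_list (map wt (lst m c)))"
  have base: "nmem s 0 = inp" "nmem s aK 0 = K" "wmem s 0 = wt"
    "\<forall>i. Suc i < K \<longrightarrow> nmem s aPar (Suc i) = i div m" "\<forall>i. Suc i < K \<longrightarrow> nmem s aLast (Suc i) = i mod m"
    "\<forall>i. Suc i < K \<longrightarrow> (0 < nmem s aExt (Suc i) \<longleftrightarrow> extends_code cf m (Suc i))" "nmem s aFree = (\<lambda>_. 0)"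
    using s tables_nmem[OF s] tables_ok[OF s, of aK]
      tables_ok[OF s, of aPar] tables_ok[OF s, of aLast] tables_ok[OF s, of aExt] tables_blank[OF s, of aFree]
    by (auto simp: ok_def tables_def)
  have "ht free_table s (K * 130) (?I (K - 1))"
    unfolding free_table_def
  proof (rule ht_Seq)
    show "ht (Seq (NAssign aFree (NConst 0) (NConst 1)) (WAssign wWt (NConst 0) WZero)) s 6 (?I 0)"
      by (rule ht_loop_free) (use base in auto)
  next
    fix t assume t: "?I 0 t"
    show "ht (For vi eK1
      (?step)) t (K * 120) (?I (K - 1))"
    proof (rule ht_For[where I = ?I and b = 80], goal_cases)
      case (3 i r)
      then have f: "frame {vi, aFree} {wWt} s r" and v: "nmem r vi 0 = i" and i: "Suc i < K" by auto
      have le: "i div m \<le> i" by simp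
      have vals: "nmem r aPar (Suc i) = i div m" "nmem r aLast (Suc i) = i mod m" "wmem r 0 = wt"
        "0 < nmem r aExt (Suc i) \<longleftrightarrow> extends_code cf m (Suc i)"
        "0 < nmem r aFree (i div m) \<longleftrightarrow> free_code cf m (i div m)"
        "wmem r wWt (i div m) = sum_list (map wt (lst m (i div m)))"
        using base f i le 3 by (auto simp: frame_nmem frame_wmem)
      note main = free_code_Suc[of m cf i, OF m_pos cf_refl cf_sym]
      from 3 v vals main show ?case
        by (intro ht_loop_free) (auto simp: le_Suc_eq lst.simps)
    next
      case 4
      show ?case using num_codes_pos[of m k] by (simp del: num_codes_pos)
    qed (use t base in \<open>auto simp: frame_nmem\<close>)
  next
    show "6 + K * 120 \<le> K * 130" using num_codes_pos[of m k] by linarith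
  qed
  then show ?thesis
  proof (rule ht_mono, goal_cases)
    case (2 s')
    have "\<forall>c<K. c \<le> K - 1" by auto
    with 2 show ?case
      by (elim conjE, intro tables_step[OF s, where r' = 26]) (auto simp: ok_def okW_def)
  qed simp
qed

text \<open>Each row is the characteristic vector of a list, copied from the parent with one entry
  added. With it, a list can be united with a stored set in one pass over the members.\<close>

definition (in -) row_table :: com where
  "row_table = For vi eK1
    (Seq (For vj eM (NAssign aRow (NPlus (NCell aMM eid) (V vj)) (NCell aRow (NPlus (NCell aMM epar) (V vj)))))
      (NAssign aRow (NPlus (NCell aMM eid) elast) (NConst 1)))"

lemma ht_row_table:
  assumes s: "tables 26 s"
  shows "ht row_table s (K * m * 140) (tables 27)"
proof -
  let ?I = "\<lambda>i s'. frame {vi, vj, aRow} {} s s' \<and>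
    (\<forall>c\<le>i. \<forall>j<m. 0 < nmem s' aRow (c * m + j) \<longleftrightarrow> j \<in> set (lst m c))"
  have base: "nmem s 0 = inp" "nmem s aK 0 = K" "\<forall>i<q * K. nmem s aMM i = i * m"
    "\<forall>i. Suc i < K \<longrightarrow> nmem s aPar (Suc i) = i div m" "\<forall>i. Suc i < K \<longrightarrow> nmem s aLast (Suc i) = i mod m"
    "nmem s aRow = (\<lambda>_. 0)"
    using s tables_nmem[OF s] tables_ok[OF s, of aK] tables_ok[OF s, of aMM]
      tables_ok[OF s, of aPar] tables_ok[OF s, of aLast] tables_blank[OF s, of aRow] by (auto simp: ok_def)
  have "ht row_table s (K * m * 140) (?I (K - 1))"
    unfolding row_table_def
  proof (rule ht_For[where I = ?I and b = "m * 100"], goal_cases)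
    case (3 i t)
    then have f: "frame {vi, vj, aRow} {} s t" and v: "nmem t vi 0 = i" and i: "Suc i < K" by auto
    have qk: "Suc i < q * K" "i div m < q * K" 
      using less_le_trans[OF i K_le_qK(1)] less_le_trans[OF div_less_code[OF i] K_le_qK(1)] by auto
    have ne: "Suc i * m + j \<noteq> i div m * m + j'" if "j < m" "j' < m" for j j'
    proof -
      have "i div m \<noteq> Suc i" using div_le_dividend[of i m] by linarith
      then show ?thesis using pair_eq_iff[OF that] by metis
    qed
    let ?I2 = "\<lambda>l r. frame {vi, vj, aRow} {} s r \<and> nmem r vi 0 = i \<and>
      (\<forall>c\<le>i. \<forall>j<m. 0 < nmem r aRow (c * m + j) \<longleftrightarrow> j \<in> set (lst m c)) \<and>
      (\<forall>j<l. 0 < nmem r aRow (Suc i * m + j) \<longleftrightarrow> j \<in> set (lst m (i div m)))"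
    have vals: "nmem r 0 = inp" "nmem r aPar (Suc i) = i div m" "nmem r aLast (Suc i) = i mod m"
      "nmem r aMM (Suc i) = Suc i * m" "nmem r aMM (i div m) = i div m * m" if "frame {vi, vj, aRow} {} s r" for r
      using base that i qk by (auto simp: frame_nmem)
    have sep: "c * m + j \<noteq> Suc i * m + l" if "c \<le> i" "j < m" "l < m" for c j l
      using pair_eq_iff[OF that(2,3), of c "Suc i"] that by auto
    show ?case
    proof (rule ht_Seq)
      show "ht (For vj eM (NAssign aRow (NPlus (NCell aMM eid) (V vj)) (NCell aRow (NPlus (NCell aMM epar) (V vj)))))
        t (m * 45 + 12) (?I2 m)"
      proof (rule ht_For[where I = ?I2 and b = 30], goal_cases)
        case (3 l r)
        then have "frame {vi, vj, aRow} {} s r" by simp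
        note vals = vals[OF this]
        have "0 < nmem r aRow (i div m * m + l) \<longleftrightarrow> l \<in> set (lst m (i div m))" using 3 by auto
        then show ?case using 3 vals sep[OF _ _ 3(1)]
          by (intro ht_loop_free) (auto simp: less_Suc_eq)
      next
        case (2 l r)
        then show ?case using vals(1)[of r] inp_m by simp
      qed (use 3 in auto)
    next
      fix r assume r: "?I2 m r"
      then have "frame {vi, vj, aRow} {} s r" by simp
      note vals = vals[OF this]
      have "i mod m < m" using m_pos by simp
      then show "ht (NAssign aRow (NPlus (NCell aMM eid) elast) (NConst 1)) r 30
          (\<lambda>s'. nmem s' vi 0 = i \<and> ?I (Suc i) (nupdate vi 0 (Suc i) s'))"
        using r vals sep[of _ _ "i mod m"]
        by (intro ht_loop_free) (auto simp: le_Suc_eq lst.simps)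
    next
      show "m * 45 + 12 + 30 \<le> m * 100" using m_pos by linarith
    qed
  next
    case 4
    have "(K - 1) * (m * 100 + ncost eK1 + 10) + (ncost eK1 + 10) \<le> (K - 1) * (m * 120) + m * 120"
      by (intro add_mono mult_left_mono) (use m_pos in auto)
    also have "\<dots> = (K - 1 + 1) * (m * 120)" by (simp only: add_mult_distrib mult_1)
    also have "\<dots> = K * (m * 120)" by simp
    also have "\<dots> \<le> K * m * 140" by simp
    finally show ?case by (simp only: add.assoc)
  qed (use base in \<open>auto simp: frame_nmem\<close>)
  then show ?thesis
  proof (rule ht_mono, goal_cases)
    case (2 s')
    have "\<forall>c<K. c \<le> K - 1" by auto
    with 2 show ?case by (elim conjE, intro tables_step[OF s, where r' = 27]) (auto simp: ok_def)
  qed simp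
qed


definition (in -) restriction_table :: com where
  "restriction_table = For vj eQ (For vi eK1
    (If (NonZero (NCell aBag (NPlus (NCell aMM (V vj)) elast)))
      (NAssign aRst (NPlus (NCell aTK (V vj)) eid)
        (NPlus (NPlus (NCell aMM (NCell aRst (NPlus (NCell aTK (V vj)) epar))) elast) (NConst 1)))
      (NAssign aRst (NPlus (NCell aTK (V vj)) eid) (NCell aRst (NPlus (NCell aTK (V vj)) epar)))))"

lemma ht_restriction_table:
  assumes s: "tables 27 s"
  shows "ht restriction_table s (q * K * 200 + 20) (tables 28)"
proof -
  let ?step = "If (NonZero (NCell aBag (NPlus (NCell aMM (V vj)) elast)))
    (NAssign aRst (NPlus (NCell aTK (V vj)) eid)
      (NPlus (NPlus (NCell aMM (NCell aRst (NPlus (NCell aTK (V vj)) epar))) elast) (NConst 1)))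
    (NAssign aRst (NPlus (NCell aTK (V vj)) eid) (NCell aRst (NPlus (NCell aTK (V vj)) epar)))"
  let ?M = "{vi, vj, aRst}"
  \<comment> \<open>The rows from \<open>t\<close> on are still blank. This settles code 0 of each
    row, to which nothing is assigned: its restriction is 0.\<close>
  let ?I = "\<lambda>t s'. frame ?M {} s s' \<and> (\<forall>t'<t. \<forall>c<K. nmem s' aRst (t' * K + c) = restrict_code m (Y t') c) \<and>
    (\<forall>x\<ge>t * K. nmem s' aRst x = 0)"
  have base: "nmem s 0 = inp" "nmem s aK 0 = K" "\<forall>i<q * K. nmem s aMM i = i * m" "\<forall>t<q. nmem s aTK t = t * K"
    "\<forall>t<q. \<forall>j<m. 0 < nmem s aBag (t * m + j) \<longleftrightarrow> j \<in> Y t"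
    "\<forall>i. Suc i < K \<longrightarrow> nmem s aPar (Suc i) = i div m" "\<forall>i. Suc i < K \<longrightarrow> nmem s aLast (Suc i) = i mod m"
    "nmem s aRst = (\<lambda>_. 0)"
    using s tables_nmem[OF s] tables_ok[OF s, of aK] tables_ok[OF s, of aMM] tables_ok[OF s, of aTK]
      tables_ok[OF s, of aBag] tables_ok[OF s, of aPar] tables_ok[OF s, of aLast]
      tables_blank[OF s, of aRst] by (auto simp: ok_def)
  have row_le: "Suc t' * K \<le> t * K" if "t' < t" for t' t
    using that by (intro mult_le_mono1) simp
  have "ht restriction_table s (q * K * 200 + 20) (?I q)"
    unfolding restriction_table_def
  proof (rule ht_For[where I = ?I and b = "K * 150"], goal_cases)
    case (3 t r)
    then have fr: "frame ?M {} s r" and vt: "nmem r vj 0 = t" by auto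
    have sep: "t' * K + c < t * K" if "t' < t" "c < K" for t' c
      using row_le[OF that(1)] that by simp
    let ?I2 = "\<lambda>i r. frame ?M {} s r \<and> nmem r vj 0 = t \<and>
      (\<forall>t'<t. \<forall>c<K. nmem r aRst (t' * K + c) = restrict_code m (Y t') c) \<and>
      (\<forall>c\<le>i. nmem r aRst (t * K + c) = restrict_code m (Y t) c) \<and> (\<forall>x>t * K + i. nmem r aRst x = 0)"
    have "ht (For vi eK1
    (?step)) r (K * 150)
      (?I2 (K - 1))"
    proof (rule ht_For[where I = ?I2 and b = 100], goal_cases)
      case 1
      then show ?case using 3 by auto
    next
      case (2 i u)
      then show ?case using base by (auto simp: frame_nmem)
    next
      case (3 i u)
      then have f: "frame ?M {} s u" and i: "Suc i < K" and v: "nmem u vi 0 = i" "nmem u vj 0 = t" by auto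
      have t: "t < q" by fact
      have im: "i mod m < m" using m_pos by simp
      have "restrict_code m (Y t) (i div m) < q * K"
        using restrict_code_less[OF m_pos div_less_code[OF i], of "Y t"] K_le_qK(1) by linarith
      then have vals: "nmem u aPar (Suc i) = i div m" "nmem u aLast (Suc i) = i mod m"
        "nmem u aMM t = t * m" "nmem u aTK t = t * K" "0 < nmem u aBag (t * m + i mod m) \<longleftrightarrow> i mod m \<in> Y t"
        "nmem u aMM (restrict_code m (Y t) (i div m)) = restrict_code m (Y t) (i div m) * m"
        using base f i less_qK(1)[OF t] im t by (auto simp: frame_nmem)
      have prev: "nmem u aRst (t * K + i div m) = restrict_code m (Y t) (i div m)"
        using 3 div_le_dividend[of i m] by blast
      have sem: "sem ?step u = nupdate aRst (t * K + Suc i) (restrict_code m (Y t) (Suc i)) u"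
        using vals prev by (simp add: v restrict_code_Suc)
      have ne: "t' * K + c \<noteq> t * K + Suc i" if "t' < t" "c < K" for t' c using sep[OF that] by simp
      show ?case
      proof (rule ht_loop_free, goal_cases)
        case cases: 3
        show ?case unfolding sem using 3 ne by (auto simp: le_Suc_eq simp del: add_Suc_right)
      qed auto
    next
      case 4
      show ?case using num_codes_pos[of m k] by (simp del: num_codes_pos)
    qed
    then show ?case
    proof (rule ht_mono, goal_cases)
      case (2 u)
      have "nmem u aRst (t' * K + c) = restrict_code m (Y t') c" if "t' < Suc t" "c < K" for t' c
      proof (cases "t' = t")
        case True
        have "c \<le> K - 1" using that by simp
        with 2 True show ?thesis by blast
      next
        case False
        then show ?thesis using 2 that by simp
      qed
      moreover have "nmem u aRst x = 0" if "Suc t * K \<le> x" for x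
      proof -
        have "t * K + (K - 1) < x" using that num_codes_pos[of m k] by (simp del: num_codes_pos)
        with 2 show ?thesis by blast
      qed
      ultimately show ?case using 2 by simp
    qed simp
  next
    case 4
    have "q * (K * 150 + ncost eQ + 10) + (ncost eQ + 10) \<le> q * (K * 200) + 20"
      by (intro add_mono mult_left_mono) (use num_codes_pos[of m k] in \<open>auto simp: Suc_le_eq simp del: num_codes_pos\<close>)
    then show ?case by (simp only: mult.assoc add.assoc)
  qed (use base inp_q in \<open>auto simp: frame_nmem\<close>)
  then show ?thesis
  proof (rule ht_mono, goal_cases)
    case (2 s')
    then show ?case by (elim conjE, intro tables_step[OF s, where r' = 28]) (auto simp: ok_def)
  qed simp
qed

definition (in -) degree_tables :: com where
  "degree_tables = count_degrees aDeg aNb vi (V aTpos)"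

lemma ht_degree_tables:
  assumes s: "tables 28 s"
  shows "ht degree_tables s ((length ts + 1) * 200) (tables 30)"
  unfolding degree_tables_def
proof (rule ht_mono[OF ht_count_degrees[where pv = "tree_pos inp" and es = ts]], goal_cases)
  have base: "nmem s 0 = inp" "nmem s aTpos 0 = tree_pos inp" "nmem s aDeg = (\<lambda>_. 0)" "nmem s aNb = (\<lambda>_. 0)"
    using s tables_nmem[OF s] tables_ok[OF s, of aTpos] tables_blank[OF s, of aDeg] tables_blank[OF s, of aNb]
    by (auto simp: ok_def)
  {
    case (3 s')
    then show ?case using base by (auto simp: frame_nmem)
  next
    case 4
    then show ?case using base ts by simp
  next
    case (6 s')
    then show ?case using base
      by (elim conjE, intro tables_step[OF s, where r' = 30]) (auto simp: ok_def)
  }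
qed auto

definition (in -) setup_time :: "nat \<Rightarrow> nat \<Rightarrow> nat \<Rightarrow> nat \<Rightarrow> nat \<Rightarrow> nat \<Rightarrow> nat" where
  "setup_time k m n q g l = (let K = num_codes m k in (k + 1) * (m + 1) * 100 + ((q * K + q + 2) * 90 + ((q + m + 3) * 80 +
    ((q * m * (n + 1) * 400 + 20) + ((m * (m * (n + 1) + g) * 700 + 20) + (K * 100 + (K * 130 +
    (K * 130 + (K * m * 140 + ((q * K * 200 + 20) + (l + 1) * 200))))))))))"

definition (in -) setup_tables :: "nat \<Rightarrow> com" where
  "setup_tables k = Seq (code_count k) (Seq code_tables (Seq position_tables (Seq bag_table
    (Seq conflict_table (Seq trie_tables (Seq extension_table (Seq free_table (Seq row_table
    (Seq restriction_table degree_tables)))))))))"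

lemma ht_setup_tables:
  assumes "tables 10 s"
  shows "ht (setup_tables k) s (setup_time k m n q (length gs) (length ts)) (tables 30)"
  unfolding setup_tables_def setup_time_def Let_def
  using assms
  by (intro ht_Seq_sum[OF ht_code_count'] ht_Seq_sum[OF ht_code_tables] ht_Seq_sum[OF ht_position_tables]
      ht_Seq_sum[OF ht_bag_table] ht_Seq_sum[OF ht_conflict_table] ht_Seq_sum[OF ht_trie_tables]
      ht_Seq_sum[OF ht_extension_table] ht_Seq_sum[OF ht_free_table] ht_Seq_sum[OF ht_row_table]
      ht_Seq_sum[OF ht_restriction_table] ht_degree_tables)

end

section \<open>Merging a leaf into its neighbour\<close>

abbreviation (input) vx :: nat where "vx \<equiv> 31"
abbreviation (input) vy :: nat where "vy \<equiv> 32"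
abbreviation (input) vroot :: nat where "vroot \<equiv> 33"
abbreviation (input) vd :: nat where "vd \<equiv> 34"
abbreviation (input) vb :: nat where "vb \<equiv> 35"
abbreviation (input) aBst :: nat where "aBst \<equiv> 36"
abbreviation (input) aSol :: nat where "aSol \<equiv> 37"
abbreviation (input) vbest :: nat where "vbest \<equiv> 38"
abbreviation (input) ve :: nat where "ve \<equiv> 39"

definition cell :: "nat \<Rightarrow> nexp \<Rightarrow> nexp" where
  "cell t c = NPlus (NCell aTK (V t)) c"

text \<open>Containment in the bag is tested by comparing a code with its restriction, as justified
  by \<open>restrict_code_eq_iff\<close>.\<close>

definition is_valid :: "nat \<Rightarrow> bexp" where
  "is_valid t = And (NonZero (NCell aFree (V vi))) (NEq (NCell aRst (cell t (V vi))) (V vi))"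

definition weight_of :: "nat \<Rightarrow> nexp \<Rightarrow> wexp" where
  "weight_of t c = WPlus (WCell wF (cell t c)) (WCell wWt c)"

lemma cost_cell [simp]: "ncost (cell t c) = 4 + ncost c"
  by (simp add: cell_def)

lemma cost_is_valid [simp]: "bcost (is_valid t) = 29"
  by (simp add: is_valid_def)

lemma cost_weight_of [simp]: "wcost (weight_of t c) = 7 + 2 * ncost c"
  by (simp add: weight_of_def)

text \<open>For every group, given by the code \<open>vd\<close> of the common restriction,
  \<open>aBst\<close> holds the code of the best list plus one. Blank memory then says that the
  group has no member yet.\<close>

definition best_loop :: com where
  "best_loop = For vi (V aK) (If (is_valid vx)
     (Seq (Seq (Set vd (NCell aRst (cell vy (V vi)))) (Set vb (NCell aBst (cell vx (V vd)))))
       (If (Or (NEq (V vb) (NConst 0)) (WLess (weight_of vx (NMinus (V vb) (NConst 1))) (weight_of vx (V vi))))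
         (NAssign aBst (cell vx (V vd)) eid) Skip))
     Skip)"

text \<open>The elements in both bags belong to the list of the leaf as well as to that of its
  neighbour. Their weight, that of the list \<open>vd\<close>, would be counted twice and is
  subtracted.\<close>

definition combine_loop :: com where
  "combine_loop = For vi (V aK) (If (is_valid vy)
     (Seq (Seq (Seq (Set vd (NCell aRst (cell vx (V vi)))) (Set vb (NMinus (NCell aBst (cell vx (V vd))) (NConst 1))))
               (WAssign wF (cell vy (V vi)) (WPlus (WCell wF (cell vy (V vi)))
                  (WMinus (weight_of vx (V vb)) (WCell wWt (V vd))))))
       (For vj eM (If (Or (NonZero (NCell aSol (NPlus (NCell aMM (cell vx (V vb))) (V vj))))
                          (NonZero (NCell aRow (NPlus (NCell aMM (V vb)) (V vj)))))
          (NAssign aSol (NPlus (NCell aMM (cell vy (V vi))) (V vj)) (NConst 1)) Skip)))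
     Skip)"

context layout
begin

text \<open>Unlike \<open>tables\<close>, this does not refer to the arrays that the main loop modifies.\<close>

definition const_tables :: "state \<Rightarrow> bool" where
  "const_tables s \<longleftrightarrow> nmem s 0 = inp \<and> nmem s 1 = (\<lambda>_. 0) \<and> nmem s aK 0 = K \<and> (\<forall>t<q. nmem s aTK t = t * K) \<and>
     (\<forall>i<q * K. nmem s aMM i = i * m) \<and> (\<forall>c<K. 0 < nmem s aFree c \<longleftrightarrow> free_code cf m c) \<and>
     (\<forall>c<K. \<forall>j<m. 0 < nmem s aRow (c * m + j) \<longleftrightarrow> j \<in> set (lst m c)) \<and>
     (\<forall>t<q. \<forall>c<K. nmem s aRst (t * K + c) = restrict_code m (Y t) c) \<and>
     (\<forall>c<K. wmem s wWt c = sum_list (map wt (lst m c)))"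

abbreviation valid :: "nat \<Rightarrow> nat \<Rightarrow> bool" where
  "valid t c \<equiv> valid_code cf m (Y t) c"

abbreviation rst :: "nat \<Rightarrow> nat \<Rightarrow> nat" where
  "rst t c \<equiv> restrict_code m (Y t) c"

text \<open>\<open>F\<close> stores the weight of a solution without that of its list, which makes 0
  the right initial value.\<close>

definition value_at :: "(nat \<Rightarrow> rat) \<Rightarrow> nat \<Rightarrow> nat \<Rightarrow> rat" where
  "value_at F t c = F (t * K + c) + sum_list (map wt (lst m c))"

text \<open>The list is added on reading, so blank cells stand for the list itself. Before any merge
  this is the only set in competition.\<close>

definition sol :: "(nat \<Rightarrow> nat) \<Rightarrow> nat \<Rightarrow> nat \<Rightarrow> nat set" where
  "sol f t c = {j. j < m \<and> 0 < f ((t * K + c) * m + j)} \<union> set (lst m c)"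

definition best_codes :: "nat \<Rightarrow> nat \<Rightarrow> (nat \<Rightarrow> rat) \<Rightarrow> nat \<Rightarrow> (nat \<Rightarrow> nat) \<Rightarrow> bool" where
  "best_codes x y F i B \<longleftrightarrow> (\<forall>d<K.
     (B (x * K + d) = 0 \<longrightarrow> (\<forall>c<i. valid x c \<longrightarrow> rst y c \<noteq> d)) \<and>
     (B (x * K + d) > 0 \<longrightarrow> (let b = B (x * K + d) - 1 in b < i \<and> valid x b \<and> rst y b = d \<and>
        (\<forall>c<i. valid x c \<longrightarrow> rst y c = d \<longrightarrow> value_at F x c \<le> value_at F x b))))"

lemma const_tables_frame:
  assumes "const_tables s" "frame M {wF} s s'" "\<forall>a\<in>M. 1 < a \<and> (a < 10 \<or> a \<ge> aDeg)"
  shows "const_tables s'"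
proof -
  have "nmem s' a = nmem s a" if "a \<in> {0, 1, aK, aTK, aMM, aFree, aRow, aRst}" for a
    by (rule frame_nmem[OF assms(2)]) (use that assms(3) in auto)
  moreover have "wmem s' wWt = wmem s wWt" using assms(2) by (simp add: frame_wmem)
  ultimately show ?thesis using assms(1) by (simp add: const_tables_def)
qed

lemma const_tables_nupdate: "const_tables s \<Longrightarrow> 1 < a \<Longrightarrow> a < 10 \<or> a \<ge> aDeg \<Longrightarrow> const_tables (nupdate a i z s)"
  by (rule const_tables_frame[of s "{a}"]) auto

lemma valid_iff: "valid t c \<longleftrightarrow> free_code cf m c \<and> rst t c = c"
  using m_pos by (simp add: valid_code_def restrict_code_eq_iff)

lemma nval_cell: "const_tables s \<Longrightarrow> nmem s t 0 = u \<Longrightarrow> u < q \<Longrightarrow> nval (cell t c) s = u * K + nval c s"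
  by (auto simp: cell_def const_tables_def)

lemma bval_is_valid:
  "const_tables s \<Longrightarrow> nmem s t 0 = u \<Longrightarrow> u < q \<Longrightarrow> nmem s vi 0 < K \<Longrightarrow> bval (is_valid t) s \<longleftrightarrow> valid u (nmem s vi 0)"
  unfolding is_valid_def valid_iff by (auto simp: nval_cell const_tables_def)

lemma wval_weight_of:
  "const_tables s \<Longrightarrow> nmem s t 0 = u \<Longrightarrow> u < q \<Longrightarrow> nval c s < K \<Longrightarrow>
    wval (weight_of t c) s = value_at (wmem s wF) u (nval c s)"
  unfolding weight_of_def value_at_def by (auto simp: nval_cell const_tables_def)

lemma best_codes_step:
  assumes B: "best_codes x y F i B" and i: "i < K" and v: "valid x i"
    and d: "d = rst y i" and b: "b = B (x * K + d)"
  shows "best_codes x y F (Suc i) (if b = 0 \<or> value_at F x (b - 1) < value_at F x i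
    then B(x * K + d := Suc i) else B)"
  unfolding best_codes_def
proof (intro allI impI)
  fix d' assume d': "d' < K"
  let ?B = "if b = 0 \<or> value_at F x (b - 1) < value_at F x i then B(x * K + d := Suc i) else B"
  let ?P = "\<lambda>i B. (B (x * K + d') = 0 \<longrightarrow> (\<forall>c<i. valid x c \<longrightarrow> rst y c \<noteq> d')) \<and>
     (B (x * K + d') > 0 \<longrightarrow> (let b = B (x * K + d') - 1 in b < i \<and> valid x b \<and> rst y b = d' \<and>
        (\<forall>c<i. valid x c \<longrightarrow> rst y c = d' \<longrightarrow> value_at F x c \<le> value_at F x b)))"
  have old: "?P i B" using B d' unfolding best_codes_def by blast
  show "?P (Suc i) ?B"
  proof (cases "d' = d")
    case False
    then have "?B (x * K + d') = B (x * K + d')" "rst y i \<noteq> d'" using d by auto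
    then show ?thesis using old unfolding Let_def by (simp add: less_Suc_eq)
  next
    case True
    show ?thesis
    proof (cases "b = 0 \<or> value_at F x (b - 1) < value_at F x i")
      case upd: True
      have "value_at F x c \<le> value_at F x i" if "c < i" "valid x c" "rst y c = d'" for c
      proof (cases "b = 0")
        case True
        then show ?thesis using old that b \<open>d' = d\<close> by auto
      next
        case False
        then have "value_at F x c \<le> value_at F x (b - 1)"
          using old that b \<open>d' = d\<close> unfolding Let_def by auto
        with upd False show ?thesis by linarith
      qed
      then show ?thesis using upd v d True by (auto simp: Let_def less_Suc_eq)
    next
      case keep: False
      then have "value_at F x i \<le> value_at F x (b - 1)" "b > 0" by auto
      then show ?thesis using old keep True b by (auto simp: Let_def less_Suc_eq)
    qed
  qed
qed

text \<open>The blank row is available because a node is contracted at most once; the rows of the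
  other nodes have to stay untouched for their own merges.\<close>

lemma ht_best_loop:
  assumes tab: "const_tables s" and x: "nmem s vx 0 = x" "x < q" and y: "nmem s vy 0 = y" "y < q"
    and blank: "\<forall>d<K. nmem s aBst (x * K + d) = 0"
  shows "ht best_loop s (K * 200) (\<lambda>s'. frame {vi, vd, vb, aBst} {} s s' \<and>
    best_codes x y (wmem s wF) K (nmem s' aBst) \<and>
    (\<forall>t<q. t \<noteq> x \<longrightarrow> (\<forall>d<K. nmem s' aBst (t * K + d) = nmem s aBst (t * K + d))))"
proof -
  let ?step = "Seq (Seq (Set vd (NCell aRst (cell vy (V vi)))) (Set vb (NCell aBst (cell vx (V vd)))))
    (If (Or (NEq (V vb) (NConst 0)) (WLess (weight_of vx (NMinus (V vb) (NConst 1))) (weight_of vx (V vi))))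
      (NAssign aBst (cell vx (V vd)) eid) Skip)"
  let ?I = "\<lambda>i s'. frame {vi, vd, vb, aBst} {} s s' \<and> best_codes x y (wmem s wF) i (nmem s' aBst) \<and>
    (\<forall>t<q. t \<noteq> x \<longrightarrow> (\<forall>d<K. nmem s' aBst (t * K + d) = nmem s aBst (t * K + d)))"
  have ct: "const_tables r" if "frame {vi, vd, vb, aBst} {} s r" for r
    by (rule const_tables_frame[OF tab, of "{vi, vd, vb, aBst}"]) (use frame_mono[OF that] in auto)
  show ?thesis unfolding best_loop_def
  proof (rule ht_For[where I = ?I and b = 150], goal_cases)
    case 1
    then show ?case using blank by (simp add: best_codes_def)
  next
    case (2 i r)
    then show ?case using ct[of r] by (simp add: const_tables_def)
  next
    case (3 i r)
    then have f: "frame {vi, vd, vb, aBst} {} s r" and B: "best_codes x y (wmem s wF) i (nmem r aBst)"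
      and vi: "nmem r vi 0 = i" by auto
    note ctr = ct[OF f]
    have xy: "nmem r vx 0 = x" "nmem r vy 0 = y" using f x y by (auto simp: frame_nmem)
    have F: "wmem r wF = wmem s wF" using f by (simp add: frame_wmem)
    have val: "bval (is_valid vx) r \<longleftrightarrow> valid x i" using bval_is_valid[OF ctr xy(1) x(2)] vi 3 by simp
    show ?case
    proof (rule ht_If[where d = 119])
      assume "bval (is_valid vx) r"
      then have v: "valid x i" using val by simp
      define d where "d = rst y i"
      define b where "b = nmem r aBst (x * K + d)"
      have dK: "d < K" unfolding d_def using m_pos 3(1) by (rule restrict_code_less)
      let ?r = "nupdate vb 0 b (nupdate vd 0 d r)"
      have ct': "const_tables ?r" using ctr by (intro const_tables_nupdate) auto
      \<comment> \<open>This includes \<open>b = 0\<close>, by truncated subtraction; the weight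
        comparison is evaluated in that case too and must stay within the tables.\<close>
      have bK: "b - 1 < K" using B dK 3(1) unfolding best_codes_def Let_def b_def
        by (metis less_trans num_codes_pos zero_less_iff_neq_zero diff_0_eq_0)
      have "nval (NCell aRst (cell vy (V vi))) r = d"
        using ctr 3(1) y vi by (auto simp: nval_cell[OF ctr xy(2)] const_tables_def d_def)
      moreover have "nval (NCell aBst (cell vx (V vd))) (nupdate vd 0 d r) = b"
        using xy x by (subst nval.simps, subst nval_cell[OF const_tables_nupdate[OF ctr]]) (auto simp: b_def)
      moreover have "nval (cell vx (V vd)) ?r = x * K + d"
        using xy x by (subst nval_cell[OF ct']) auto
      moreover have "wval (weight_of vx (NMinus (V vb) (NConst 1))) ?r = value_at (wmem s wF) x (b - 1)"
        using xy x bK F by (subst wval_weight_of[OF ct']) auto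
      moreover have "wval (weight_of vx (V vi)) ?r = value_at (wmem s wF) x i"
        using xy x vi 3 F by (subst wval_weight_of[OF ct']) auto
      ultimately have sem: "sem (?step) r =
         (if b = 0 \<or> value_at (wmem s wF) x (b - 1) < value_at (wmem s wF) x i
          then nupdate aBst (x * K + d) (Suc i) ?r else ?r)"
        using vi by (simp del: nval.simps(2) add: nval.simps(2)[of _ "NConst _"])
      have "best_codes x y (wmem s wF) (Suc i)
        (if b = 0 \<or> value_at (wmem s wF) x (b - 1) < value_at (wmem s wF) x i
         then (nmem r aBst)(x * K + d := Suc i) else nmem r aBst)"
        by (rule best_codes_step[OF B 3(1) v d_def b_def])
      moreover have "t * K + d' \<noteq> x * K + d" if "t \<noteq> x" "d' < K" for t d'
        using pair_eq_iff[OF that(2) dK] that by simp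
      ultimately show "ht (?step) r 119
         (\<lambda>s'. nmem s' vi 0 = i \<and> ?I (Suc i) (nupdate vi 0 (Suc i) s'))"
      proof (intro ht_loop_free, goal_cases)
        case cases: 3
        then show ?case unfolding sem using 3 vi by (auto split: if_splits)
      qed auto
    next
      assume "\<not> bval (is_valid vx) r"
      then have nv: "\<not> valid x i" using val by simp
      have "best_codes x y (wmem s wF) (Suc i) (nmem r aBst)"
        using B nv unfolding best_codes_def Let_def by (auto simp: less_Suc_eq)
      then show "ht Skip r 119 (\<lambda>s'. nmem s' vi 0 = i \<and> ?I (Suc i) (nupdate vi 0 (Suc i) s'))"
        using 3 by (intro ht_loop_free) auto
    qed simp
  next
    case 4
    show ?case using num_codes_pos[of m k] by (simp del: num_codes_pos)
  qed
qed


text \<open>The sublist of a list of \<open>y\<close> inside \<open>Y x\<close> is a valid list of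
  \<open>x\<close> and its own restriction to \<open>Y y\<close>. Hence the group looked up when
  combining is never empty.\<close>

lemma valid_restrict:
  assumes "valid y c" "c < K"
  shows "rst x c < K" "valid x (rst x c)" "rst y (rst x c) = rst x c"
proof -
  show "rst x c < K" using m_pos assms(2) by (rule restrict_code_less)
  have set: "set (lst m (rst x c)) = set (lst m c) \<inter> Y x"
    using m_pos by (auto simp: lst_restrict_code)
  have "distinct (lst m (rst x c))" using assms m_pos
    by (simp add: lst_restrict_code valid_code_def free_code_def)
  then show "valid x (rst x c)" using assms set
    by (auto simp: valid_code_def free_code_def intro: conflict_free_subset)
  show "rst y (rst x c) = rst x c"
    unfolding restrict_code_eq_iff[OF m_pos] set using assms by (auto simp: valid_code_def)
qed

definition best_for :: "nat \<Rightarrow> (nat \<Rightarrow> nat) \<Rightarrow> nat \<Rightarrow> nat" where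
  "best_for x B c = B (x * K + rst x c) - 1"

text \<open>The entry is positive because \<open>rst x c\<close> belongs to its own group, so
  subtracting 1 recovers a genuine code.\<close>

lemma best_for:
  assumes B: "best_codes x y F K B" and c: "valid y c" "c < K"
  shows "best_for x B c < K" "valid x (best_for x B c)" "rst y (best_for x B c) = rst x c"
    and "\<And>c'. c' < K \<Longrightarrow> valid x c' \<Longrightarrow> rst y c' = rst x c \<Longrightarrow> value_at F x c' \<le> value_at F x (best_for x B c)"
proof -
  note d = valid_restrict[OF c, of x]
  have "B (x * K + rst x c) > 0"
    using B d unfolding best_codes_def by (metis neq0_conv)
  then have "let b = best_for x B c in b < K \<and> valid x b \<and> rst y b = rst x c \<and>
        (\<forall>c<K. valid x c \<longrightarrow> rst y c = rst y b \<longrightarrow> value_at F x c \<le> value_at F x b)"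
    using B d(1) unfolding best_codes_def best_for_def Let_def by simp
  then show "best_for x B c < K" "valid x (best_for x B c)" "rst y (best_for x B c) = rst x c"
    "\<And>c'. c' < K \<Longrightarrow> valid x c' \<Longrightarrow> rst y c' = rst x c \<Longrightarrow> value_at F x c' \<le> value_at F x (best_for x B c)"
    by (simp_all add: Let_def)
qed

lemma index_eq_iff:
  assumes "c < K" "c' < K" "j < m" "j' < m"
  shows "(t * K + c) * m + j = (t' * K + c') * m + j' \<longleftrightarrow> t = t' \<and> c = c' \<and> j = j'"
  using pair_eq_iff[OF assms(3,4), of "t * K + c" "t' * K + c'"] pair_eq_iff[OF assms(1,2), of t t'] by simp

definition combined :: "nat \<Rightarrow> nat \<Rightarrow> (nat \<Rightarrow> nat) \<Rightarrow> state \<Rightarrow> state \<Rightarrow> bool" where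
  "combined x y B s s' \<longleftrightarrow> (\<forall>t<q. \<forall>c<K.
     wmem s' wF (t * K + c) = wmem s wF (t * K + c) + (if t = y \<and> valid y c
       then value_at (wmem s wF) x (best_for x B c) - sum_list (map wt (lst m (rst x c))) else 0) \<and>
     sol (nmem s' aSol) t c = sol (nmem s aSol) t c \<union>
       (if t = y \<and> valid y c then sol (nmem s aSol) x (best_for x B c) else {}))"

text \<open>As \<open>x \<noteq> y\<close>, the row of \<open>x\<close> is read in its initial state
  throughout, although cells of the same arrays are written in the row of \<open>y\<close>. The
  invariant can thus refer to the state \<open>s\<close> before the loop.\<close>

lemma ht_combine_loop:
  assumes tab: "const_tables s" and x: "nmem s vx 0 = x" "x < q" and y: "nmem s vy 0 = y" "y < q" and ne: "x \<noteq> y"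
    and best: "best_codes x y (wmem s wF) K (nmem s aBst)"
  shows "ht combine_loop s (K * m * 300) (\<lambda>s'. frame {vi, vj, vd, vb, aSol} {wF} s s' \<and>
    combined x y (nmem s aBst) s s')"
proof -
  define b where "b = best_for x (nmem s aBst)"
  let ?upd = "Seq (Seq (Set vd (NCell aRst (cell vx (V vi)))) (Set vb (NMinus (NCell aBst (cell vx (V vd))) (NConst 1))))
    (WAssign wF (cell vy (V vi)) (WPlus (WCell wF (cell vy (V vi)))
      (WMinus (weight_of vx (V vb)) (WCell wWt (V vd)))))"
  let ?copy = "If (Or (NonZero (NCell aSol (NPlus (NCell aMM (cell vx (V vb))) (V vj))))
        (NonZero (NCell aRow (NPlus (NCell aMM (V vb)) (V vj)))))
      (NAssign aSol (NPlus (NCell aMM (cell vy (V vi))) (V vj)) (NConst 1)) Skip"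
  let ?M = "{vi, vj, vd, vb, aSol}"
  let ?F = "\<lambda>i s'. \<forall>t<q. \<forall>c<K. wmem s' wF (t * K + c) = wmem s wF (t * K + c) +
       (if t = y \<and> c < i \<and> valid y c then value_at (wmem s wF) x (b c) - sum_list (map wt (lst m (rst x c))) else 0)"
  let ?I = "\<lambda>i s'. frame ?M {wF} s s' \<and> ?F i s' \<and>
    (\<forall>t<q. \<forall>c<K. \<forall>j<m. 0 < nmem s' aSol ((t * K + c) * m + j) \<longleftrightarrow> 0 < nmem s aSol ((t * K + c) * m + j) \<or>
       t = y \<and> c < i \<and> valid y c \<and> j \<in> sol (nmem s aSol) x (b c))"
  have ct: "const_tables r" if "frame ?M {wF} s r" for r
    by (rule const_tables_frame[OF tab that]) auto
  have "ht combine_loop s (K * m * 300) (?I K)" unfolding combine_loop_def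
  proof (rule ht_For[where I = ?I and b = "m * 230"], goal_cases)
    case 1
    then show ?case by simp
  next
    case (2 i r)
    then show ?case using ct[of r] by (simp add: const_tables_def)
  next
    case (3 i r)
    then have f: "frame ?M {wF} s r" and F: "?F i r" and vi: "nmem r vi 0 = i"
      and S: "\<And>t c j. t < q \<Longrightarrow> c < K \<Longrightarrow> j < m \<Longrightarrow>
        0 < nmem r aSol ((t * K + c) * m + j) \<longleftrightarrow> 0 < nmem s aSol ((t * K + c) * m + j) \<or>
        t = y \<and> c < i \<and> valid y c \<and> j \<in> sol (nmem s aSol) x (b c)" by auto
    note ctr = ct[OF f]
    have xy: "nmem r vx 0 = x" "nmem r vy 0 = y" "nmem r aBst = nmem s aBst" using f x y by (auto simp: frame_nmem)
    have val: "bval (is_valid vy) r \<longleftrightarrow> valid y i" using bval_is_valid[OF ctr xy(2) y(2)] vi 3 by simp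
    show ?case
    proof (rule ht_If[where d = "m * 200"])
      assume "bval (is_valid vy) r"
      then have v: "valid y i" using val by simp
      define d where "d = rst x i"
      note bi = best_for[OF best v 3(1), folded b_def]
      have dK: "d < K" unfolding d_def using m_pos 3(1) by (rule restrict_code_less)
      have bqK: "b i < q * K" using bi(1) K_le_qK(1) by linarith
      let ?r = "nupdate vb 0 (b i) (nupdate vd 0 d r)"
      let ?u = "wupdate wF (y * K + i) (wmem r wF (y * K + i) +
          (value_at (wmem s wF) x (b i) - sum_list (map wt (lst m d)))) ?r"
      have ct': "const_tables ?r" using ctr by (intro const_tables_nupdate) auto
      have "nval (NCell aRst (cell vx (V vi))) r = d"
        using ctr 3(1) x vi by (auto simp: nval_cell[OF ctr xy(1)] const_tables_def d_def)
      moreover have "nval (NMinus (NCell aBst (cell vx (V vd))) (NConst 1)) (nupdate vd 0 d r) = b i"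
        using xy x by (subst nval.simps, subst nval.simps, subst nval_cell[OF const_tables_nupdate[OF ctr]])
          (auto simp: b_def best_for_def d_def)
      moreover have "nval (cell vy (V vi)) ?r = y * K + i"
        using xy y vi by (subst nval_cell[OF ct']) auto
      moreover have "wval (weight_of vx (V vb)) ?r = value_at (wmem s wF) x (b i)"
      proof -
        have "wval (weight_of vx (V vb)) ?r = value_at (wmem r wF) x (b i)"
          using xy x bi by (subst wval_weight_of[OF ct']) auto
        also have "\<dots> = value_at (wmem s wF) x (b i)"
          using F x(2) bi(1) ne unfolding value_at_def by simp
        finally show ?thesis .
      qed
      moreover have "wval (WCell wWt (V vd)) ?r = sum_list (map wt (lst m d))"
        using ct' dK by (simp add: const_tables_def)
      ultimately have sem: "sem (?upd) r = ?u"
        by (simp del: nval.simps(2) wval.simps(2) add: nval.simps(2)[of _ "NConst _"] wval.simps(2)[of _ "cell _ _"])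
      have fu: "frame ?M {wF} s ?u" using f by simp
      have Fu: "?F (Suc i) ?u"
      proof (intro allI impI)
        fix t c assume t: "t < q" "c < K"
        have "t * K + c = y * K + i \<longleftrightarrow> t = y \<and> c = i" by (rule pair_eq_iff[OF t(2) 3(1)])
        then show "wmem ?u wF (t * K + c) = wmem s wF (t * K + c) +
           (if t = y \<and> c < Suc i \<and> valid y c then value_at (wmem s wF) x (b c) - sum_list (map wt (lst m (rst x c))) else 0)"
          using F t v by (auto simp: less_Suc_eq d_def)
      qed
      let ?I2 = "\<lambda>l u. frame ?M {wF} s u \<and> nmem u vi 0 = i \<and> nmem u vb 0 = b i \<and> wmem u wF = wmem ?u wF \<and>
        (\<forall>t<q. \<forall>c<K. \<forall>j<m. 0 < nmem u aSol ((t * K + c) * m + j) \<longleftrightarrow> 0 < nmem r aSol ((t * K + c) * m + j) \<or>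
          t = y \<and> c = i \<and> j < l \<and> j \<in> sol (nmem s aSol) x (b i))"
      show "ht (Seq (?upd)
       (For vj eM (?copy))) r (m * 200)
        (\<lambda>s'. nmem s' vi 0 = i \<and> ?I (Suc i) (nupdate vi 0 (Suc i) s'))"
      proof (rule ht_Seq[where d = "m * 90 + 12" and Q' = "\<lambda>u. u = ?u"])
        show "ht (?upd) r 80 (\<lambda>u. u = ?u)"
        proof (intro ht_loop_free, goal_cases)
          case cases: 3
          show ?case by (rule sem)
        qed auto
      next
        fix u assume u: "u = ?u"
        show "ht (For vj eM (?copy)) u (m * 90 + 12)
          (\<lambda>s'. nmem s' vi 0 = i \<and> ?I (Suc i) (nupdate vi 0 (Suc i) s'))"
        proof (rule ht_mono[OF ht_For[where I = ?I2 and b = 75 and N = m]], goal_cases)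
          case 1
          then show ?case using fu vi unfolding u by simp
        next
          case (2 l r')
          then show ?case using ct[of r'] inp_m by (simp add: const_tables_def)
        next
          case (3 l r')
          then have f': "frame ?M {wF} s r'" and v': "nmem r' vi 0 = i" "nmem r' vb 0 = b i" "nmem r' vj 0 = l"
            and S': "\<And>t c j. t < q \<Longrightarrow> c < K \<Longrightarrow> j < m \<Longrightarrow>
              0 < nmem r' aSol ((t * K + c) * m + j) \<longleftrightarrow> 0 < nmem r aSol ((t * K + c) * m + j) \<or>
              t = y \<and> c = i \<and> j < l \<and> j \<in> sol (nmem s aSol) x (b i)" by auto
          note c' = ct[OF f']
          have xy': "nmem r' vx 0 = x" "nmem r' vy 0 = y" using f' x y by (auto simp: frame_nmem)
          have iK: "i < K" and l: "l < m" by fact+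
          have idx: "x * K + b i < q * K" "y * K + i < q * K"
            using pair_less[OF x(2) bi(1)] pair_less[OF y(2) iK] by auto
          have "nval (cell vx (V vb)) r' = x * K + b i" using nval_cell[OF c' xy'(1) x(2)] v' by simp
          moreover have "nval (cell vy (V vi)) r' = y * K + i" using nval_cell[OF c' xy'(2) y(2)] v' by simp
          moreover have "0 < nmem r' aRow (b i * m + l) \<longleftrightarrow> l \<in> set (lst m (b i))"
            using c' bi(1) l by (simp add: const_tables_def)
          moreover have "0 < nmem r' aSol ((x * K + b i) * m + l) \<longleftrightarrow> 0 < nmem s aSol ((x * K + b i) * m + l)"
            using S'[OF x(2) bi(1) l] S[OF x(2) bi(1) l] ne by simp
          moreover have "nmem r' aMM (x * K + b i) = (x * K + b i) * m" "nmem r' aMM (y * K + i) = (y * K + i) * m"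
            "nmem r' aMM (b i) = b i * m"
            using c' idx bqK by (auto simp: const_tables_def)
          ultimately have sem': "sem (?copy) r' =
             (if l \<in> sol (nmem s aSol) x (b i) then nupdate aSol ((y * K + i) * m + l) 1 r' else r')"
            using l v' by (simp add: sol_def)
          have new: "0 < ((nmem r' aSol)((y * K + i) * m + l := 1)) ((t * K + c) * m + j) \<longleftrightarrow>
              0 < nmem r' aSol ((t * K + c) * m + j) \<or> t = y \<and> c = i \<and> j = l" if "t < q" "c < K" "j < m" for t c j
            using index_eq_iff[OF that(2) iK that(3) l, of t y] by auto
          show ?case
          proof (intro ht_loop_free, goal_cases)
            case cases: 3
            show ?case unfolding sem' using 3 v'(1) S' new by (auto simp: less_Suc_eq)
          qed auto
        next
          case (6 u')
          then have f': "frame ?M {wF} s u'" and "nmem u' vi 0 = i" "wmem u' wF = wmem ?u wF"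
            and S': "\<And>t c j. t < q \<Longrightarrow> c < K \<Longrightarrow> j < m \<Longrightarrow>
              0 < nmem u' aSol ((t * K + c) * m + j) \<longleftrightarrow> 0 < nmem r aSol ((t * K + c) * m + j) \<or>
              t = y \<and> c = i \<and> j \<in> sol (nmem s aSol) x (b i)" by auto
          then show ?case using Fu S v by (auto simp: less_Suc_eq)
        qed auto
      next
        show "80 + (m * 90 + 12) \<le> m * 200" using m_pos by linarith
      qed
    next
      assume "\<not> bval (is_valid vy) r"
      then have nv: "\<not> valid y i" using val by simp
      then show "ht Skip r (m * 200) (\<lambda>s'. nmem s' vi 0 = i \<and> ?I (Suc i) (nupdate vi 0 (Suc i) s'))"
        using 3 m_pos by (intro ht_loop_free) (auto simp: less_Suc_eq)
    qed (use m_pos in simp)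
  next
    case 4
    have "K * (m * 230 + ncost (V aK) + 10) + (ncost (V aK) + 10) \<le> K * (m * 235 + 12) + K * 12"
      by (intro add_mono mult_left_mono)
        (use m_pos num_codes_pos[of m k] in \<open>auto simp: Suc_le_eq simp del: num_codes_pos\<close>)
    also have "\<dots> = K * (m * 235 + 24)" by (simp add: algebra_simps)
    also have "\<dots> \<le> K * (m * 300)" by (intro mult_left_mono) (use m_pos in auto)
    finally show ?case by (simp only: add.assoc mult.assoc)
  qed
  then show ?thesis
  proof (rule ht_mono, goal_cases)
    case (2 s')
    then have S: "\<And>t c j. t < q \<Longrightarrow> c < K \<Longrightarrow> j < m \<Longrightarrow>
        0 < nmem s' aSol ((t * K + c) * m + j) \<longleftrightarrow> 0 < nmem s aSol ((t * K + c) * m + j) \<or>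
        t = y \<and> valid y c \<and> j \<in> sol (nmem s aSol) x (b c)" by auto
    have sub: "sol f x c \<subseteq> {..<m}" for f x c using set_lst[OF m_pos, of c] by (auto simp: sol_def)
    have "sol (nmem s' aSol) t c = sol (nmem s aSol) t c \<union>
       (if t = y \<and> valid y c then sol (nmem s aSol) x (b c) else {})" if "t < q" "c < K" for t c
      using S[OF that] sub[of "nmem s aSol" x "b c"] unfolding sol_def[of _ t c] by (auto split: if_splits)
    with 2 show ?case by (simp add: combined_def b_def)
  qed simp
qed

end

section \<open>The main loop\<close>

lemma adj_list_Nil [simp]: "adj_list [] x = []"
  by (simp add: adj_list_def)

lemma adj_list_Cons:
  "adj_list ((a, b) # es) x = (if a = x then [b] else []) @ (if b = x then [a] else []) @ adj_list es x"
  by (simp add: adj_list_def)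

lemma set_adj_list: "set (adj_list es x) = {y. {x, y} \<in> set (map (\<lambda>(a, b). {a, b}) es)}"
proof (induction es)
  case (Cons e es)
  obtain a b where e: "e = (a, b)" by (cases e)
  have "{x, y} = {a, b} \<longleftrightarrow> a = x \<and> b = y \<or> b = x \<and> a = y" for y
    by (auto simp: doubleton_eq_iff)
  with Cons show ?case using [[simproc del: list_to_set_comprehension]]
    by (auto simp: e adj_list_Cons)
qed simp

text \<open>Without repeated edges and loops no neighbour is listed twice, so length and sum of the
  list are the degree and the sum over the set of neighbours.\<close>

lemma distinct_adj_list:
  assumes "distinct (map (\<lambda>(a, b). {a, b}) es)" "\<And>a b. (a, b) \<in> set es \<Longrightarrow> a \<noteq> b"
  shows "distinct (adj_list es x)"
  using assms
proof (induction es)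
  case (Cons e es)
  obtain a b where e: "e = (a, b)" by (cases e)
  have "{a, b} \<notin> set (map (\<lambda>(a, b). {a, b}) es)" using Cons.prems(1) unfolding e by simp
  then have new: "a = x \<Longrightarrow> b \<notin> set (adj_list es x)" "b = x \<Longrightarrow> a \<notin> set (adj_list es x)"
    unfolding set_adj_list mem_Collect_eq by (metis, metis insert_commute)
  have "distinct (map (\<lambda>(a, b). {a, b}) es)" using Cons.prems(1) by (simp only: list.map distinct.simps)
  then have "distinct (adj_list es x)" using Cons.IH Cons.prems(2) by simp
  moreover have "a \<noteq> b" using Cons.prems(2) by (simp add: e)
  ultimately show ?case using new using [[simproc del: list_to_set_comprehension]]
    by (auto simp: e adj_list_Cons)
qed simp

definition merge_leaf :: com where
  "merge_leaf = Seq (Seq (Set vy (NCell aNb (V vx))) (Seq (NAssign aDeg (V vx) (NConst 0))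
             (Seq (NAssign aDeg (V vy) (NMinus (NCell aDeg (V vy)) (NConst 1)))
                  (NAssign aNb (V vy) (NMinus (NCell aNb (V vy)) (V vx))))))
           (Seq (Seq best_loop combine_loop) (Seq (Set vroot (V vy)) (Set vx (V vy))))"

text \<open>The linear-time leaf search known from Pruefer codes. Removing a leaf changes only the
  degree of its neighbour, so \<open>vx\<close> moves there; if the current node is not a leaf, the
  pointer \<open>ve\<close> advances. Nodes behind the pointer never have to be searched
  again.\<close>

definition main_loop :: com where
  "main_loop = While (NLess (V ve) eQ)
    (If (NEq (NCell aDeg (V vx)) (NConst 1))
      merge_leaf
      (Seq (Set ve (NPlus (V ve) (NConst 1))) (Set vx (V ve))))"

context layout
begin

lemma ht_merge:
  assumes tab: "const_tables s" and x: "nmem s vx 0 = x" "x < q" and y: "nmem s vy 0 = y" "y < q" and ne: "x \<noteq> y"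
    and blank: "\<forall>d<K. nmem s aBst (x * K + d) = 0"
  shows "ht (Seq best_loop combine_loop) s (K * 200 + K * m * 300) (\<lambda>s'.
    frame {vi, vj, vd, vb, aBst, aSol} {wF} s s' \<and>
    (\<forall>t<q. t \<noteq> x \<longrightarrow> (\<forall>d<K. nmem s' aBst (t * K + d) = nmem s aBst (t * K + d))) \<and>
    (\<exists>B. best_codes x y (wmem s wF) K B \<and> combined x y B s s'))"
    (is "ht _ _ _ ?Q")
proof (rule ht_Seq_sum[OF ht_best_loop[OF tab x y blank]], elim conjE)
  fix r assume f: "frame {vi, vd, vb, aBst} {} s r" and B: "best_codes x y (wmem s wF) K (nmem r aBst)"
    and other: "\<forall>t<q. t \<noteq> x \<longrightarrow> (\<forall>d<K. nmem r aBst (t * K + d) = nmem s aBst (t * K + d))"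
  have xy: "nmem r vx 0 = x" "nmem r vy 0 = y" and F: "wmem r wF = wmem s wF" and S: "nmem r aSol = nmem s aSol"
    using f x y by (auto simp: frame_nmem frame_wmem)
  have tab': "const_tables r"
    by (rule const_tables_frame[OF tab frame_mono[OF f, of "{vi, vd, vb, aBst}" "{wF}"]]) auto
  have B': "best_codes x y (wmem r wF) K (nmem r aBst)" using B F by simp
  show "ht combine_loop r (K * m * 300) ?Q"
  proof (rule ht_mono[OF ht_combine_loop[OF tab' xy(1) x(2) xy(2) y(2) ne B'] order_refl], elim conjE)
    fix s' assume f': "frame {vi, vj, vd, vb, aSol} {wF} r s'"
      and C: "combined x y (nmem r aBst) r s'"
    have fr: "frame {vi, vj, vd, vb, aBst, aSol} {wF} s s'" by (rule frame_trans[OF f f']) auto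
    have bst: "nmem s' aBst = nmem r aBst" using f' by (simp add: frame_nmem)
    show "?Q s'"
    proof (intro conjI exI[of _ "nmem r aBst"])
      show "\<forall>t<q. t \<noteq> x \<longrightarrow> (\<forall>d<K. nmem s' aBst (t * K + d) = nmem s aBst (t * K + d))"
        unfolding bst by (rule other)
    next
      show "combined x y (nmem r aBst) s s'" using C by (simp add: combined_def F S)
    qed (rule fr B)+
  qed
qed

end

text \<open>\<open>cut\<close> and \<open>share\<close> express that \<open>Y\<close> is a tree
  decomposition of the conflict graph on \<open>E\<close>. That every member occurs in some
  \<open>Y t\<close> follows from \<open>share\<close> and \<open>cf_refl\<close>.\<close>

locale dp = layout +
  fixes E :: "nat set set"
  assumes E: "E = set (map (\<lambda>(a, b). {a, b}) ts)" and dist: "distinct (map (\<lambda>(a, b). {a, b}) ts)"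
    and tree: "is_tree (Graph {..<q} E)"
    and cut: "\<And>j. j < m \<Longrightarrow> cut_connected E {t. t < q \<and> j \<in> Y t}"
    and share: "\<And>i j. i < m \<Longrightarrow> j < m \<Longrightarrow> cf i j \<Longrightarrow> \<exists>t<q. i \<in> Y t \<and> j \<in> Y t"
    and small: "\<And>t I. t < q \<Longrightarrow> I \<subseteq> Y t \<Longrightarrow> conflict_free cf I \<Longrightarrow> card I \<le> k"
begin

lemma Y_subset: "Y t \<subseteq> {..<m}"
  by (auto simp: Y_def)

lemma E_edge: "{a, b} \<in> E \<Longrightarrow> a < q \<and> b < q \<and> a \<noteq> b"
  using tree unfolding is_tree_def simple_graph_def by (fastforce simp: doubleton_eq_iff)

lemma ts_edge: "(a, b) \<in> set ts \<Longrightarrow> a \<noteq> b"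
  using E_edge[of a b] unfolding E by force

definition territory :: "(nat \<Rightarrow> nat) \<Rightarrow> nat \<Rightarrow> nat set" where
  "territory \<rho> t = {j. \<exists>s<q. \<rho> s = t \<and> j \<in> Y s}"

definition solves :: "(nat \<Rightarrow> nat) \<Rightarrow> (nat \<Rightarrow> nat) \<Rightarrow> (nat \<Rightarrow> rat) \<Rightarrow> nat \<Rightarrow> bool" where
  "solves \<rho> S F t \<longleftrightarrow> (\<forall>c<K. valid t c \<longrightarrow>
     optimal cf wt (territory \<rho> t) (Y t) (set (lst m c)) (sol S t c) \<and> value_at F t c = sum wt (sol S t c))"

lemma sum_list_lst: "valid t c \<Longrightarrow> sum_list (map wt (lst m c)) = sum wt (set (lst m c))"
  by (simp add: valid_code_def free_code_def sum_list_distinct_conv_sum_set)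

text \<open>The two fibres are the sides of \<open>optimal_merge\<close>. The best list of a group
  is best among all sets with the prescribed trace on the intersection of the bags, since each such
  set competes for a list of that group.\<close>

lemma merge_optimal:
  assumes con: "contraction E {..<q} R \<rho>" and xR: "x \<in> R" and p: "nbrs E R x = {p}"
    and sx: "solves \<rho> S F x" and sp: "solves \<rho> S F p"
    and B: "best_codes x p F K B" and c: "valid p c" "c < K"
  defines "b \<equiv> best_for x B c"
  shows "optimal cf wt (territory (merge_rep x p \<rho>) p) (Y p) (set (lst m c)) (sol S p c \<union> sol S x b)"
    and "sum wt (sol S p c \<union> sol S x b) =
      sum wt (sol S p c) + (value_at F x b - sum_list (map wt (lst m (rst x c))))"
proof -
  have R: "p \<in> R" "{x, p} \<in> E" using p by (auto simp: nbrs_def)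
  have xp: "x < q" "p < q" "x \<noteq> p" using E_edge[OF R(2)] by auto
  have rep: "\<rho> x = x" "\<rho> p = p" using con xR R by (auto simp: contraction_def)
  have terr: "territory (merge_rep x p \<rho>) p = territory \<rho> p \<union> territory \<rho> x"
    using xp unfolding territory_def merge_rep_def by auto
  have tm: "territory \<rho> t \<subseteq> {..<m}" for t using Y_subset by (auto simp: territory_def)
  have fin: "finite (territory \<rho> t)" for t using tm[of t] finite_subset by blast
  have sub: "Y x \<subseteq> territory \<rho> x" "Y p \<subseteq> territory \<rho> p"
    using xp rep by (auto simp: territory_def)
  have sep: "i \<in> Y x \<inter> Y p \<or> j \<in> Y x \<inter> Y p"
    if i: "i \<in> territory \<rho> x" and j: "j \<in> territory \<rho> p" and "cf i j" for i j
  proof -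
    have "i < m" "j < m" using i j tm by blast+
    \<comment> \<open>If the common node \<open>t\<close> lies in the fibre of \<open>x\<close>,
      then \<open>j\<close> occurs inside and outside of this fibre; otherwise \<open>i\<close>
      does. In either case \<open>contraction_cut\<close> places that member in both bags.\<close>
    obtain t where t: "t < q" "i \<in> Y t" "j \<in> Y t" using share[OF \<open>i < m\<close> \<open>j < m\<close> \<open>cf i j\<close>] by blast
    obtain s where s: "s < q" "\<rho> s = x" "i \<in> Y s" using i by (auto simp: territory_def)
    obtain s' where s': "s' < q" "\<rho> s' = p" "j \<in> Y s'" using j by (auto simp: territory_def)
    show ?thesis
    proof (cases "\<rho> t = x")
      case True
      then show ?thesis
        using contraction_cut[OF con xR p cut[OF \<open>j < m\<close>], of t s'] t s' xp by auto
    next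
      case False
      then show ?thesis
        using contraction_cut[OF con xR p cut[OF \<open>i < m\<close>], of s t] t s by auto
    qed
  qed
  note bf = best_for[OF B c, folded b_def]
  have optp: "optimal cf wt (territory \<rho> p) (Y p) (set (lst m c)) (sol S p c)"
    using sp c unfolding solves_def by blast
  have optx: "optimal cf wt (territory \<rho> x) (Y x) (set (lst m b)) (sol S x b)"
    and valx: "value_at F x b = sum wt (sol S x b)"
    using sx bf(1,2) unfolding solves_def by blast+
  have restr: "set (lst m b) \<inter> Y p = set (lst m c) \<inter> Y x"
  proof -
    have "set (lst m (rst p b)) = set (lst m (rst x c))" using bf(3) by simp
    then show ?thesis using m_pos by (auto simp: lst_restrict_code)
  qed
  \<comment> \<open>The part of \<open>I\<close> in \<open>Y x\<close> has at most \<open>k\<close>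
    elements. It is listed so that the order of \<open>rst x c\<close> is respected, which puts its
    code into the group of \<open>rst x c\<close>.\<close>
  have best: "sum wt I \<le> sum wt (sol S x b)"
    if I: "I \<subseteq> territory \<rho> x" "conflict_free cf I" "I \<inter> Y x \<inter> Y p = set (lst m c) \<inter> Y x" for I
  proof -
    have cfI: "conflict_free cf (I \<inter> Y x)" by (rule conflict_free_subset[OF I(2)]) blast
    have "set (lst m (rst x c)) = (I \<inter> Y x) \<inter> Y p"
      using I(3) m_pos by (auto simp: lst_restrict_code)
    moreover have "distinct (lst m (rst x c))"
      using c m_pos by (simp add: lst_restrict_code valid_code_def free_code_def)
    moreover have "I \<inter> Y x \<subseteq> {..<m}" using Y_subset by blast
    moreover have "card (I \<inter> Y x) \<le> k" by (rule small[OF xp(1) _ cfI]) blast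
    ultimately obtain c' where c': "c' < K" "valid_code cf m (I \<inter> Y x) c'" "set (lst m c') = I \<inter> Y x"
      "restrict_code m (Y p) c' = rst x c"
      using exists_code[OF m_pos _ cfI, of k "rst x c" "Y p"] by blast
    have v: "valid x c'" using c' by (simp add: valid_code_def)
    have "sum wt I \<le> sum wt (sol S x c')" "value_at F x c' = sum wt (sol S x c')"
      using sx c' v I unfolding solves_def optimal_def by blast+
    moreover have "value_at F x c' \<le> value_at F x b" using bf(4)[OF c'(1) v c'(4)] .
    ultimately show ?thesis using valx by simp
  qed
  have x1: "sol S x b \<subseteq> territory \<rho> x" and x2: "conflict_free cf (sol S x b)"
    and x3: "sol S x b \<inter> Y x \<inter> Y p = set (lst m c) \<inter> Y x"
    using optx restr unfolding optimal_def by blast+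
  have rfl: "cf i i" if "i \<in> territory \<rho> x" for i using that tm cf_refl by blast
  note M = optimal_merge[OF fin[of x] fin[of p] cf_sym rfl sep sub optp x1 x2 x3 best]
  show "optimal cf wt (territory (merge_rep x p \<rho>) p) (Y p) (set (lst m c)) (sol S p c \<union> sol S x b)"
    unfolding terr by (rule M(1))
  have slw: "sum_list (map wt (lst m (rst x c))) = sum wt (set (lst m c) \<inter> Y x)"
  proof -
    have "set (lst m (rst x c)) = set (lst m c) \<inter> Y x" using m_pos by (auto simp: lst_restrict_code)
    then show ?thesis using sum_list_lst[OF valid_restrict(2)[OF c, of x]] by simp
  qed
  show "sum wt (sol S p c \<union> sol S x b) =
      sum wt (sol S p c) + (value_at F x b - sum_list (map wt (lst m (rst x c))))"
    unfolding slw valx by (rule M(2))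
qed

section \<open>The invariant of the contraction loop\<close>

definition degrees_ok :: "nat set \<Rightarrow> state \<Rightarrow> bool" where
  "degrees_ok R s \<longleftrightarrow> (\<forall>t<q. nmem s aDeg t = (if t \<in> R then card (nbrs E R t) else 0)) \<and>
     (\<forall>t\<in>R. nmem s aNb t = \<Sum>(nbrs E R t))"

definition dp_ok :: "nat set \<Rightarrow> (nat \<Rightarrow> nat) \<Rightarrow> state \<Rightarrow> bool" where
  "dp_ok R \<rho> s \<longleftrightarrow> contraction E {..<q} R \<rho> \<and> (\<forall>t\<in>R. solves \<rho> (nmem s aSol) (wmem s wF) t) \<and>
     (\<forall>t\<in>R. \<forall>d<K. nmem s aBst (t * K + d) = 0)"

lemma nbrs_remove:
  assumes con: "contraction E {..<q} R \<rho>" and x: "x \<in> R" and p: "nbrs E R x = {p}" and t: "t \<in> R - {x}"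
  shows "nbrs E (R - {x}) t = (if t = p then nbrs E R t - {x} else nbrs E R t)"
proof -
  have "x \<in> nbrs E R t \<longleftrightarrow> t = p"
    using p t x unfolding nbrs_def by (auto simp: insert_commute)
  then show ?thesis by (auto simp: nbrs_def)
qed

lemma degrees_step:
  assumes con: "contraction E {..<q} R \<rho>" and x: "x \<in> R" and p: "nbrs E R x = {p}"
    and ok: "degrees_ok R s"
    and D: "nmem s' aDeg = (nmem s aDeg)(x := 0, p := nmem s aDeg p - 1)"
    and N: "nmem s' aNb = (nmem s aNb)(p := nmem s aNb p - x)"
  shows "degrees_ok (R - {x}) s'"
proof -
  have R: "p \<in> R" "{x, p} \<in> E" using p by (auto simp: nbrs_def)
  have xp: "x \<noteq> p" "p < q" using E_edge[OF R(2)] by auto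
  have "R \<subseteq> {..<q}" using con by (simp add: contraction_def)
  then have fin: "finite (nbrs E R t)" for t
    by (rule finite_subset[rotated, OF finite_subset]) (auto simp: nbrs_def)
  have xin: "x \<in> nbrs E R p" using R x by (simp add: nbrs_def insert_commute)
  have "card (nbrs E R p - {x}) = card (nbrs E R p) - 1" using xin by simp
  moreover have "\<Sum>(nbrs E R p - {x}) = \<Sum>(nbrs E R p) - x"
    using sum.remove[OF fin xin, of "\<lambda>v. v"] by simp
  ultimately show ?thesis using ok xp R x nbrs_remove[OF con x p] unfolding degrees_ok_def D N
    by auto
qed

lemma dp_step:
  assumes x: "x \<in> R" and p: "nbrs E R x = {p}" and dp: "dp_ok R \<rho> s"
    and B: "best_codes x p (wmem s wF) K B"
    and bst: "\<forall>t<q. t \<noteq> x \<longrightarrow> (\<forall>d<K. nmem s' aBst (t * K + d) = nmem s aBst (t * K + d))"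
    and C: "combined x p B s s'"
  shows "dp_ok (R - {x}) (merge_rep x p \<rho>) s'"
proof -
  have con: "contraction E {..<q} R \<rho>" using dp by (simp add: dp_ok_def)
  have pR: "p \<in> R" using p by (auto simp: nbrs_def)
  have tq: "t < q" if "t \<in> R" for t using con that by (auto simp: contraction_def)
  have slv: "solves \<rho> (nmem s aSol) (wmem s wF) t" if "t \<in> R" for t
    using dp that by (simp add: dp_ok_def)
  have "solves (merge_rep x p \<rho>) (nmem s' aSol) (wmem s' wF) t" if t: "t \<in> R" "t \<noteq> x" for t
  proof (cases "t = p")
    case True
    show ?thesis unfolding solves_def True
    proof (intro allI impI)
      fix c assume c: "c < K" "valid p c"
      note M = merge_optimal[OF con x p slv[OF x] slv[OF pR] B c(2,1)]
      have "sol (nmem s' aSol) p c = sol (nmem s aSol) p c \<union> sol (nmem s aSol) x (best_for x B c)"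
        using C c tq[OF pR] by (simp add: combined_def)
      moreover have "value_at (wmem s' wF) p c = value_at (wmem s wF) p c +
          (value_at (wmem s wF) x (best_for x B c) - sum_list (map wt (lst m (rst x c))))"
        using C c tq[OF pR] unfolding value_at_def combined_def by simp
      moreover have "value_at (wmem s wF) p c = sum wt (sol (nmem s aSol) p c)"
        using slv[OF pR] c by (simp add: solves_def)
      ultimately show "optimal cf wt (territory (merge_rep x p \<rho>) p) (Y p) (set (lst m c)) (sol (nmem s' aSol) p c) \<and>
         value_at (wmem s' wF) p c = sum wt (sol (nmem s' aSol) p c)"
        using M by simp
    qed
  next
    case False
    have "territory (merge_rep x p \<rho>) t = territory \<rho> t"
      using False t unfolding territory_def merge_rep_def by auto
    moreover have "value_at (wmem s' wF) t c = value_at (wmem s wF) t c" if "c < K" for c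
      using C tq[OF t(1)] False that unfolding value_at_def combined_def by simp
    moreover have "sol (nmem s' aSol) t c = sol (nmem s aSol) t c" if "c < K" for c
      using C tq[OF t(1)] False that by (simp add: combined_def)
    ultimately show ?thesis using slv[OF t(1)] unfolding solves_def by simp
  qed
  then show ?thesis
    using contraction_merge[OF con x p] bst dp tq unfolding dp_ok_def by auto
qed

text \<open>Every iteration removes a representative or advances the pointer, which lowers
  \<open>N\<close>. All nodes up to the pointer except the current one are known not to be leaves;
  at the end the current node is \<open>q\<close>, which is no node, so the exception becomes
  void.\<close>

definition inv :: "nat \<Rightarrow> state \<Rightarrow> bool" where
  "inv N s \<longleftrightarrow> const_tables s \<and> (\<exists>R \<rho>. dp_ok R \<rho> s \<and> degrees_ok R s \<and> nmem s vroot 0 \<in> R \<and>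
     N = card R + (q - nmem s ve 0)) \<and>
     nmem s ve 0 \<le> q \<and> (nmem s ve 0 < q \<longrightarrow> nmem s vx 0 < q) \<and>
     (\<forall>v\<le>nmem s ve 0. v < q \<longrightarrow> v \<noteq> nmem s vx 0 \<longrightarrow> nmem s aDeg v \<noteq> 1) \<and>
     (nmem s ve 0 = q \<longrightarrow> nmem s vx 0 = q)"

lemma ht_merge_leaf:
  assumes I: "inv N s" and e: "nmem s ve 0 < q" and deg: "nmem s aDeg (nmem s vx 0) = 1"
  shows "ht merge_leaf s
     (K * m * 500 + 60) (\<lambda>s'. \<exists>j<N. inv j s')"
proof -
  let ?unlink = "Seq (Set vy (NCell aNb (V vx))) (Seq (NAssign aDeg (V vx) (NConst 0))
    (Seq (NAssign aDeg (V vy) (NMinus (NCell aDeg (V vy)) (NConst 1)))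
      (NAssign aNb (V vy) (NMinus (NCell aNb (V vy)) (V vx)))))"
  obtain R \<rho> where dp: "dp_ok R \<rho> s" and dg: "degrees_ok R s" and root: "nmem s vroot 0 \<in> R"
    and N: "N = card R + (q - nmem s ve 0)"
    using I by (auto simp: inv_def)
  have tab: "const_tables s" using I by (simp add: inv_def)
  define x where "x = nmem s vx 0"
  have xq: "x < q" using I e by (simp add: inv_def x_def)
  have con: "contraction E {..<q} R \<rho>" using dp by (simp add: dp_ok_def)
  have xR: "x \<in> R" using dg deg xq unfolding degrees_ok_def x_def by (metis zero_neq_one)
  then have "card (nbrs E R x) = 1" using dg deg xq unfolding degrees_ok_def x_def by metis
  then obtain p where p: "nbrs E R x = {p}" by (auto simp: card_1_singleton_iff)
  have R: "p \<in> R" "{x, p} \<in> E" using p by (auto simp: nbrs_def)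
  have xp: "x \<noteq> p" "p < q" using E_edge[OF R(2)] by auto
  have nb: "nmem s aNb x = p" using dg xR p by (simp add: degrees_ok_def)
  let ?s1 = "nupdate aNb p (nmem s aNb p - x) (nupdate aDeg p (nmem s aDeg p - 1)
      (nupdate aDeg x 0 (nupdate vy 0 p s)))"
  have tab1: "const_tables ?s1" using tab by (intro const_tables_nupdate) auto
  have dg1: "degrees_ok (R - {x}) ?s1"
    by (rule degrees_step[OF con xR p dg]) (use xp in auto)
  have finR: "finite R" using con finite_subset by (auto simp: contraction_def)
  show ?thesis unfolding merge_leaf_def
  proof (rule ht_Seq[where d = "K * m * 500 + 10" and Q' = "\<lambda>t. t = ?s1"])
    show "ht (?unlink) s 50 (\<lambda>t. t = ?s1)"
      using xp nb by (intro ht_loop_free) (auto simp: x_def)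
  next
    fix s1 assume s1: "s1 = ?s1"
    have x1: "nmem s1 vx 0 = x" "nmem s1 vy 0 = p" and tab1: "const_tables s1"
      and dg1: "degrees_ok (R - {x}) s1"
      and same1: "nmem s1 aBst = nmem s aBst" "nmem s1 aSol = nmem s aSol" "wmem s1 wF = wmem s wF"
        "nmem s1 ve = nmem s ve"
      using tab1 dg1 by (auto simp: s1 x_def)
    \<comment> \<open>The degree of \<open>x\<close> was set to 0, so \<open>p\<close> is the only
      node up to the pointer that can have become a leaf.\<close>
    have degs1: "nmem s1 aDeg v \<noteq> 1" if "v \<le> nmem s ve 0" "v < q" "v \<noteq> p" for v
      using I that unfolding inv_def s1 x_def by auto
    have blank: "\<forall>d<K. nmem s1 aBst (x * K + d) = 0" using dp xR by (simp add: dp_ok_def same1)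
    show "ht (Seq (Seq best_loop combine_loop) (Seq (Set vroot (V vy)) (Set vx (V vy)))) s1
       (K * m * 500 + 10) (\<lambda>s'. \<exists>j<N. inv j s')"
    proof (rule ht_Seq[OF ht_merge[OF tab1 x1(1) xq x1(2) xp(2) xp(1) blank]], elim conjE exE)
      fix s2 B
      assume f2: "frame {vi, vj, vd, vb, aBst, aSol} {wF} s1 s2"
        and bst: "\<forall>t<q. t \<noteq> x \<longrightarrow> (\<forall>d<K. nmem s2 aBst (t * K + d) = nmem s1 aBst (t * K + d))"
        and B: "best_codes x p (wmem s1 wF) K B"
        and "combined x p B s1 s2"
      then have C: "combined x p B s s2" by (simp add: combined_def same1)
      have y2: "nmem s2 vy 0 = p" and same2: "nmem s2 aDeg = nmem s1 aDeg" "nmem s2 aNb = nmem s1 aNb"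
        "nmem s2 ve = nmem s ve" using f2 x1 same1 by (auto simp: frame_nmem)
      have tab2: "const_tables s2" by (rule const_tables_frame[OF tab1 f2]) auto
      have dp2: "dp_ok (R - {x}) (merge_rep x p \<rho>) s2"
        by (rule dp_step[OF xR p dp B[unfolded same1] bst[unfolded same1] C])
      let ?f = "nupdate vx 0 p (nupdate vroot 0 p s2)"
      have "dp_ok (R - {x}) (merge_rep x p \<rho>) ?f" using dp2 by (simp add: dp_ok_def)
      moreover have "degrees_ok (R - {x}) ?f" using dg1 same2 by (simp add: degrees_ok_def)
      moreover have "p \<in> R - {x}" using R xp by simp
      moreover have "const_tables ?f" using tab2 by (intro const_tables_nupdate) auto
      ultimately have "inv (card (R - {x}) + (q - nmem s ve 0)) ?f"
        using e xp degs1 unfolding inv_def by (auto simp: same2)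
      moreover have "card (R - {x}) < card R" using finR xR by (rule card_Diff1_less)
      ultimately have "\<exists>j<N. inv j ?f"
        using N by (intro exI[of _ "card (R - {x}) + (q - nmem s ve 0)"]) simp
      then show "ht (Seq (Set vroot (V vy)) (Set vx (V vy))) s2 10 (\<lambda>s'. \<exists>j<N. inv j s')"
        using y2 by (intro ht_loop_free) auto
    next
      have "K * 200 \<le> K * m * 200" using m_pos by simp
      then show "K * 200 + K * m * 300 + 10 \<le> K * m * 500 + 10" by simp
    qed
  qed simp
qed

lemma ht_main_loop:
  assumes I: "inv N s"
  shows "ht main_loop s (N * (K * m * 500 + 90) + 10) (\<lambda>s'. const_tables s' \<and>
    (\<exists>\<rho>. dp_ok {nmem s' vroot 0} \<rho> s'))"
  unfolding main_loop_def
proof (rule ht_mono[OF ht_While[where I = inv and N = N and c = "K * m * 500 + 80", OF I _ order_refl]], goal_cases)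
  case (1 i s)
  then have e: "nmem s ve 0 < q" by (auto simp: inv_def const_tables_def inp_q)
  show ?case
  proof (rule ht_If[where d = "K * m * 500 + 60"])
    assume "bval (NEq (NCell aDeg (V vx)) (NConst 1)) s"
    then have "nmem s aDeg (nmem s vx 0) = 1" by simp
    then show "ht merge_leaf s
     (K * m * 500 + 60) (\<lambda>s'. \<exists>j<i. inv j s')"
      by (rule ht_merge_leaf[OF 1(1) e])
  next
    assume "\<not> bval (NEq (NCell aDeg (V vx)) (NConst 1)) s"
    then have deg: "nmem s aDeg (nmem s vx 0) \<noteq> 1" by auto
    let ?f = "nupdate vx 0 (Suc (nmem s ve 0)) (nupdate ve 0 (Suc (nmem s ve 0)) s)"
    obtain R \<rho> where dp: "dp_ok R \<rho> s" and dg: "degrees_ok R s" and root: "nmem s vroot 0 \<in> R"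
      and i: "i = card R + (q - nmem s ve 0)" using 1 by (auto simp: inv_def)
    have "dp_ok R \<rho> ?f" "degrees_ok R ?f" using dp dg by (auto simp: dp_ok_def degrees_ok_def)
    moreover have "const_tables ?f" using 1 by (intro const_tables_nupdate) (auto simp: inv_def)
    moreover have "nmem s aDeg v \<noteq> 1" if "v \<le> nmem s ve 0" "v < q" for v
      using 1 deg that unfolding inv_def by (cases "v = nmem s vx 0") auto
    ultimately have "inv (card R + (q - Suc (nmem s ve 0))) ?f"
      using root e unfolding inv_def by (auto simp: le_Suc_eq)
    then have "\<exists>j<i. inv j ?f"
      using i e by (intro exI[of _ "card R + (q - Suc (nmem s ve 0))"]) auto
    then show "ht (Seq (Set ve (NPlus (V ve) (NConst 1))) (Set vx (V ve))) s (K * m * 500 + 60)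
        (\<lambda>s'. \<exists>j<i. inv j s')"
      by (intro ht_loop_free) auto
  qed simp
next
  case 2
  have "N * (K * m * 500 + 80 + 1 + bcost (NLess (V ve) eQ)) + (1 + bcost (NLess (V ve) eQ))
      \<le> N * (K * m * 500 + 90) + 10"
    by (rule add_mono[OF mult_left_mono]) auto
  then show ?case by (simp only: add.assoc)
next
  case (3 s')
  then obtain i where i: "inv i s'" by blast
  then have "nmem s' 0 = inp" by (simp add: inv_def const_tables_def)
  then have "\<not> nmem s' ve 0 < q" using 3 inp_q by simp
  then have ve: "nmem s' ve 0 = q" using i by (auto simp: inv_def)
  obtain R \<rho> where dp: "dp_ok R \<rho> s'" and dg: "degrees_ok R s'" and root: "nmem s' vroot 0 \<in> R"
    using i by (auto simp: inv_def)
  have con: "contraction (edges (Graph {..<q} E)) (verts (Graph {..<q} E)) R \<rho>"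
    using dp by (simp add: dp_ok_def)
  \<comment> \<open>With the pointer at \<open>q\<close>, the invariant excludes leaves among all
    nodes.\<close>
  have "card (nbrs (edges (Graph {..<q} E)) R t) \<noteq> 1" if "t \<in> R" for t
  proof -
    have "t < q" using con that by (auto simp: contraction_def)
    then have "nmem s' aDeg t \<noteq> 1" using i ve unfolding inv_def by auto
    then show ?thesis using dg that \<open>t < q\<close> by (simp add: degrees_ok_def)
  qed
  then have "R = {nmem s' vroot 0}" by (rule contraction_of_tree_final[OF tree con root])
  then show ?case using dp i by (auto simp: inv_def)
qed

text \<open>Nothing is initialised: blank memory puts \<open>vx\<close>, \<open>ve\<close> and
  \<open>vroot\<close> at node 0 and makes every list its own solution. The value
  \<open>2 * q\<close> consists of \<open>q\<close> representatives and \<open>q\<close> pointer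
  positions.\<close>

lemma inv_start:
  assumes s: "tables 30 s"
  shows "inv (2 * q) s"
proof -
  note ok = tables_ok[OF s]
  have blank: "nmem s a = (\<lambda>_. 0)" if "a \<ge> 30" for a using tables_blank[OF s that] that by simp
  have tab: "const_tables s"
    using ok[of aK] ok[of aTK] ok[of aMM] ok[of aFree] ok[of aRow] ok[of aRst] s
    unfolding const_tables_def by (auto simp: ok_def tables_def okW_def)
  have F: "wmem s wF = (\<lambda>_. 0)" using s by (simp add: tables_def)
  have con: "contraction E {..<q} {..<q} id" using contraction_id[of "Graph {..<q} E"] tree
    by (simp add: is_tree_def)
  have "solves id (nmem s aSol) (wmem s wF) t" if "t < q" for t
    unfolding solves_def
  proof (intro allI impI)
    fix c assume c: "c < K" "valid t c"
    have terr: "territory id t = Y t" using that by (auto simp: territory_def)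
    have sol: "sol (nmem s aSol) t c = set (lst m c)" by (simp add: sol_def blank)
    show "optimal cf wt (territory id t) (Y t) (set (lst m c)) (sol (nmem s aSol) t c) \<and>
        value_at (wmem s wF) t c = sum wt (sol (nmem s aSol) t c)"
      using c unfolding terr sol optimal_def
      by (auto simp: F value_at_def sum_list_lst valid_code_def free_code_def Int_absorb2)
  qed
  then have dp: "dp_ok {..<q} id s" using con blank by (simp add: dp_ok_def)
  have adj: "set (adj_list ts x) = nbrs E {..<q} x" for x
    using E_edge unfolding set_adj_list E[symmetric] nbrs_def by blast
  have dadj: "distinct (adj_list ts x)" for x by (rule distinct_adj_list[OF dist ts_edge])
  have "nmem s aDeg x = card (nbrs E {..<q} x)" "nmem s aNb x = \<Sum>(nbrs E {..<q} x)" for x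
    using ok[of aDeg] ok[of aNb] distinct_card[OF dadj[of x]] sum_list_distinct_conv_sum_set[OF dadj[of x], of "\<lambda>v. v"]
    unfolding adj by (auto simp: ok_def)
  then have dg: "degrees_ok {..<q} s" by (simp add: degrees_ok_def)
  show ?thesis unfolding inv_def
  proof (intro conjI exI[of _ "{..<q}"] exI[of _ id])
    show "2 * q = card {..<q} + (q - nmem s ve 0)" by (simp add: blank)
  qed (use tab dp dg q_pos blank in auto)
qed

end

section \<open>Reading off an optimal packing\<close>

definition output_phase :: com where
  "output_phase = Seq (Set vbest (NConst 0))
    (Seq (For vi (V aK) (If (And (is_valid vroot) (WLess (weight_of vroot (V vbest)) (weight_of vroot (V vi))))
       (Set vbest (V vi)) Skip))
     (For vj eM (If (Or (NonZero (NCell aSol (NPlus (NCell aMM (cell vroot (V vbest))) (V vj))))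
                        (NonZero (NCell aRow (NPlus (NCell aMM (V vbest)) (V vj)))))
       (NAssign 1 (V vj) (NConst 1)) Skip)))"

context dp
begin

text \<open>The last territory consists of all members. The trace of any packing on
  \<open>Y r\<close> has at most \<open>k\<close> elements and hence a code, for which the packing
  is a competitor.\<close>

lemma dp_final:
  assumes dp: "dp_ok {r} \<rho> s" and b: "b < K" "valid r b"
    and max: "\<And>c. c < K \<Longrightarrow> valid r c \<Longrightarrow> value_at (wmem s wF) r c \<le> value_at (wmem s wF) r b"
  shows "sol (nmem s aSol) r b \<subseteq> {..<m}" "conflict_free cf (sol (nmem s aSol) r b)"
    and "\<And>I. I \<subseteq> {..<m} \<Longrightarrow> conflict_free cf I \<Longrightarrow> sum wt I \<le> sum wt (sol (nmem s aSol) r b)"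
proof -
  have con: "contraction E {..<q} {r} \<rho>" and slv: "solves \<rho> (nmem s aSol) (wmem s wF) r"
    using dp by (auto simp: dp_ok_def)
  then have r: "r < q" and rep: "\<And>t. t < q \<Longrightarrow> \<rho> t = r" by (auto simp: contraction_def)
  have terr: "territory \<rho> r = {..<m}"
  proof -
    have "\<exists>t<q. j \<in> Y t" if "j < m" for j using share[OF that that cf_refl[OF that]] by blast
    then show ?thesis using Y_subset rep unfolding territory_def by blast
  qed
  have opt: "optimal cf wt {..<m} (Y r) (set (lst m b)) (sol (nmem s aSol) r b)"
    and vb: "value_at (wmem s wF) r b = sum wt (sol (nmem s aSol) r b)"
    using slv b unfolding solves_def terr by blast+
  from opt show "sol (nmem s aSol) r b \<subseteq> {..<m}" "conflict_free cf (sol (nmem s aSol) r b)"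
    unfolding optimal_def by blast+
  fix I assume I: "I \<subseteq> {..<m}" "conflict_free cf I"
  have cfI: "conflict_free cf (I \<inter> Y r)" by (rule conflict_free_subset[OF I(2)]) blast
  have sm: "I \<inter> Y r \<subseteq> {..<m}" using I by blast
  have "card (I \<inter> Y r) \<le> k" by (rule small[OF r _ cfI]) blast
  \<comment> \<open>With \<open>{}\<close> and code 0 in the last two arguments, no order is imposed
    on the list.\<close>
  then obtain c where c: "c < K" "valid_code cf m (I \<inter> Y r) c" "set (lst m c) = I \<inter> Y r"
    using exists_code[OF m_pos sm cfI, of k 0 "{}"] by auto
  have v: "valid r c" using c by (simp add: valid_code_def)
  have "optimal cf wt {..<m} (Y r) (I \<inter> Y r) (sol (nmem s aSol) r c)"
    and vc: "value_at (wmem s wF) r c = sum wt (sol (nmem s aSol) r c)"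
    using slv c v unfolding solves_def terr by auto
  then have "sum wt I \<le> value_at (wmem s wF) r c" using I unfolding optimal_def vc by blast
  also have "\<dots> \<le> sum wt (sol (nmem s aSol) r b)" using max[OF c(1) v] vb by simp
  finally show "sum wt I \<le> sum wt (sol (nmem s aSol) r b)" .
qed

definition best_output :: "state \<Rightarrow> bool" where
  "best_output s \<longleftrightarrow> (let I = {j. j < m \<and> nmem s 1 j \<noteq> 0} in conflict_free cf I \<and>
     (\<forall>I'. I' \<subseteq> {..<m} \<longrightarrow> conflict_free cf I' \<longrightarrow> sum wt I' \<le> sum wt I))"

lemma ht_output_phase:
  assumes tab: "const_tables s" and dp: "dp_ok {nmem s vroot 0} \<rho> s"
  shows "ht output_phase s (K * 120 + m * 90 + 40) best_output"
proof -
  let ?pick = "If (And (is_valid vroot) (WLess (weight_of vroot (V vbest)) (weight_of vroot (V vi)))) (Set vbest (V vi)) Skip"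
  let ?write = "If (Or (NonZero (NCell aSol (NPlus (NCell aMM (cell vroot (V vbest))) (V vj))))
      (NonZero (NCell aRow (NPlus (NCell aMM (V vbest)) (V vj)))))
    (NAssign 1 (V vj) (NConst 1)) Skip"
  define r where "r = nmem s vroot 0"
  have dp: "dp_ok {r} \<rho> s" using dp by (simp add: r_def)
  then have r: "r < q" by (auto simp: dp_ok_def contraction_def)
  have K0: "0 < K" by simp
  have v0: "valid r 0" by (simp add: valid_code_def)
  let ?I = "\<lambda>i s'. frame {vi, vbest} {} s s' \<and> nmem s' vbest 0 < K \<and> valid r (nmem s' vbest 0) \<and>
    (\<forall>c<i. valid r c \<longrightarrow> value_at (wmem s wF) r c \<le> value_at (wmem s wF) r (nmem s' vbest 0))"
  show ?thesis unfolding output_phase_def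
  proof (rule ht_Seq)
    show "ht (Set vbest (NConst 0)) s 3 (?I 0)" using K0 v0 by (intro ht_loop_free) auto
  next
    fix s1 assume I0: "?I 0 s1"
    show "ht (Seq (For vi (V aK) (?pick))
     (For vj eM (?write))) s1 ((K * 120 + 12) + (m * 90 + 12)) best_output"
    proof (rule ht_Seq_sum)
      show "ht (For vi (V aK) (?pick)) s1 (K * 120 + 12) (?I K)"
      proof (rule ht_For[where I = ?I and b = 100], goal_cases)
        case 1
        then show ?case using I0 by simp
      next
        case (2 i t)
        then show ?case using tab by (auto simp: frame_nmem const_tables_def)
      next
        case (3 i t)
        then have f: "frame {vi, vbest} {} s t" and vi: "nmem t vi 0 = i" and bK: "nmem t vbest 0 < K" by auto
        have ct: "const_tables t" by (rule const_tables_frame[OF tab frame_mono[OF f, of "{vi, vbest}"]]) auto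
        have rt: "nmem t vroot 0 = r" "wmem t wF = wmem s wF" using f by (auto simp: r_def frame_nmem frame_wmem)
        have "bval (is_valid vroot) t \<longleftrightarrow> valid r i" using bval_is_valid[OF ct rt(1) r] vi 3 by simp
        moreover have "wval (weight_of vroot (V vbest)) t = value_at (wmem s wF) r (nmem t vbest 0)"
          using wval_weight_of[OF ct rt(1) r, of "V vbest"] bK rt by simp
        moreover have "wval (weight_of vroot (V vi)) t = value_at (wmem s wF) r i"
          using wval_weight_of[OF ct rt(1) r, of "V vi"] vi 3(1) rt by simp
        ultimately have sem: "sem (?pick) t = (if valid r i \<and> value_at (wmem s wF) r (nmem t vbest 0) < value_at (wmem s wF) r i
             then nupdate vbest 0 i t else t)"
          using vi by simp
        show ?case
        proof (intro ht_loop_free, goal_cases)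
          case cases: 3
          show ?case
          proof (cases "valid r i \<and> value_at (wmem s wF) r (nmem t vbest 0) < value_at (wmem s wF) r i")
            case True
            have "value_at (wmem s wF) r c \<le> value_at (wmem s wF) r i" if "c < i" "valid r c" for c
              using 3(2) that True by (meson order_trans order_less_imp_le)
            then show ?thesis unfolding sem using True 3 vi by (auto simp: less_Suc_eq)
          next
            case False
            then show ?thesis unfolding sem using 3 vi by (auto simp: less_Suc_eq not_less)
          qed
        qed auto
      qed simp
    next
      fix t assume It: "?I K t"
      then have f: "frame {vi, vbest} {} s t" by simp
      define b where "b = nmem t vbest 0"
      have b: "b < K" "valid r b" and max: "\<And>c. c < K \<Longrightarrow> valid r c \<Longrightarrow> value_at (wmem s wF) r c \<le> value_at (wmem s wF) r b"
        using It by (auto simp: b_def)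
      note final = dp_final[OF dp b max]
      let ?S = "sol (nmem s aSol) r b"
      have ct: "const_tables t" by (rule const_tables_frame[OF tab frame_mono[OF f, of "{vi, vbest}"]]) auto
      let ?I2 = "\<lambda>l u. frame {1, vj} {} t u \<and> (\<forall>j. 0 < nmem u 1 j \<longleftrightarrow> j < l \<and> j \<in> ?S)"
      show "ht (For vj eM (?write)) t (m * 90 + 12) best_output"
      proof (rule ht_mono[OF ht_For[where I = ?I2 and b = 75 and N = m, OF _ _ _ order_refl]], goal_cases)
        case 1
        then show ?case using ct by (simp add: const_tables_def)
      next
        case (2 l u)
        then show ?case using ct inp_m by (auto simp: frame_nmem const_tables_def)
      next
        case (3 l u)
        then have fu: "frame {1, vj} {} t u" and vj: "nmem u vj 0 = l" by auto
        have idx: "r * K + b < q * K" "b < q * K" using pair_less[OF r b(1)] b(1) K_le_qK(1) by auto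
        have "nmem u 13 = nmem t 13" "nmem u aTK = nmem t aTK" "nmem u aRow = nmem t aRow" "nmem u aSol = nmem s aSol"
          "nmem u vroot 0 = r" "nmem u vbest 0 = b"
          using fu f by (auto simp: frame_nmem b_def r_def)
        then have sem: "sem (?write) u = (if l \<in> ?S then nupdate 1 l 1 u else u)"
          using ct vj idx r b(1) 3(1) by (simp add: cell_def const_tables_def sol_def)
        show ?case
        proof (intro ht_loop_free, goal_cases)
          case cases: 3
          show ?case unfolding sem using 3 by (auto simp: less_Suc_eq)
        qed auto
      next
        case (5 u)
        then have "{j. j < m \<and> nmem u 1 j \<noteq> 0} = ?S" using final(1) by auto
        then show ?case using final by (simp add: best_output_def)
      qed simp_all
    qed
  qed simp
qed

text \<open>An empty family is caught at once, as the tables presuppose \<open>m > 0\<close>. The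
  untouched output array then denotes the empty packing.\<close>

definition (in -) solve :: "nat \<Rightarrow> com" where
  "solve k = If (NonZero eM) (Seq (setup_tables k) (Seq main_loop output_phase)) Skip"

lemma ht_solve:
  assumes s: "tables 10 s"
  shows "ht (solve k) s (1 + bcost (NonZero eM) + (setup_time k m n q (length gs) (length ts) +
    ((2 * q * (K * m * 500 + 90) + 10) + (K * 120 + m * 90 + 40))))
   best_output"
  unfolding solve_def
proof (rule ht_If[OF _ _ order_refl], goal_cases)
  case 1
  show ?case
    by (rule ht_Seq_sum[OF ht_setup_tables[OF s]], rule ht_Seq_sum[OF ht_main_loop[OF inv_start]],
      assumption, elim conjE exE, rule ht_output_phase)
next
  case 2
  then show ?case using s m_pos by (simp add: tables_def inp_m)
qed

end

section \<open>Reading the input\<close>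

definition seg :: "nat list \<Rightarrow> nat \<Rightarrow> nat list \<Rightarrow> bool" where
  "seg xs p ys \<longleftrightarrow> (\<exists>us vs. xs = us @ ys @ vs \<and> length us = p)"

definition cells :: "nat list \<Rightarrow> nat \<Rightarrow> nat" where
  "cells xs i = (if i < length xs then xs ! i else 0)"

lemma seg_append:
  assumes "seg xs p (ys @ zs)"
  shows "seg xs p ys" "seg xs (p + length ys) zs"
proof -
  obtain us vs where xs: "xs = us @ (ys @ zs) @ vs" "length us = p" using assms by (auto simp: seg_def)
  have "xs = us @ ys @ (zs @ vs)" "xs = (us @ ys) @ zs @ vs" using xs by simp_all
  with xs(2) show "seg xs p ys" "seg xs (p + length ys) zs"
    unfolding seg_def by (blast, metis length_append)
qed

lemma seg_cells: "seg xs p ys \<Longrightarrow> i < length ys \<Longrightarrow> cells xs (p + i) = ys ! i"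
  by (auto simp: seg_def cells_def nth_append)

lemma seg_concat:
  assumes "seg xs p (concat (map f l))" "i < length l"
  shows "seg xs (p + sum_list (map (\<lambda>x. length (f x)) (take i l))) (f (l ! i))"
proof -
  have "l = take i l @ l ! i # drop (Suc i) l" using assms(2) by (rule id_take_nth_drop)
  then have "concat (map f l) = concat (map f (take i l)) @ f (l ! i) @ concat (map f (drop (Suc i) l))"
    by (metis concat.simps(2) concat_append list.simps(9) map_append)
  then have "seg xs (p + length (concat (map f (take i l)))) (f (l ! i))"
    using assms(1) seg_append by metis
  then show ?thesis by (simp add: length_concat comp_def)
qed

lemma seg_enc_set: "seg xs p (enc_set vs) \<Longrightarrow> holds (cells xs) p vs"
  unfolding holds_def using seg_cells[of xs p "enc_set vs" 0] seg_cells[of xs p "enc_set vs" "i + 1" for i]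
  by (simp add: enc_set_def)

lemma length_pairs: "length (concat (map (\<lambda>(u, v). [u, v]) es)) = length es + length es"
  by (induction es) auto

lemma nth_pairs:
  "i < length es \<Longrightarrow> concat (map (\<lambda>(u, v). [u, v]) es) ! (i + i) = fst (es ! i) \<and>
    concat (map (\<lambda>(u, v). [u, v]) es) ! (i + i + 1) = snd (es ! i)"
proof (induction es arbitrary: i)
  case (Cons e es)
  show ?case by (cases i) (use Cons in \<open>auto split: prod.splits\<close>)
qed simp

lemma seg_enc_edges:
  assumes "seg xs p (enc_edges es)"
  shows "holds_edges (cells xs) p es"
  unfolding holds_edges_def
proof (intro conjI allI impI)
  show "cells xs p = length es" using seg_cells[OF assms, of 0] by (simp add: enc_edges_def)
  fix i assume i: "i < length es"
  show "cells xs (p + (i + i + 1)) = fst (es ! i)" "cells xs (p + (i + i + 2)) = snd (es ! i)"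
    using seg_cells[OF assms, of "i + i + 1"] seg_cells[OF assms, of "i + i + 2"] nth_pairs[OF i] i
    by (auto simp: enc_edges_def length_pairs)
qed

lemma length_enc: "length (enc_set vs) = length vs + 1" "length (enc_edges es) = length es + length es + 1"
  by (simp_all add: enc_set_def enc_edges_def length_pairs)

text \<open>The next position is read off the length word at the current one, so each induction step
  needs to know the contents there.\<close>

lemma bag_pos_eq:
  assumes seg: "seg xs p (concat (map enc_set bags))" and p: "bag_pos (cells xs) 0 = p" and "t \<le> length bags"
  shows "bag_pos (cells xs) t = p + sum_list (map (\<lambda>b. length (enc_set b)) (take t bags))"
  using assms(3)
proof (induction t)
  case (Suc t)
  have "holds (cells xs) (bag_pos (cells xs) t) (bags ! t)"
    using seg_enc_set[OF seg_concat[OF seg, of t]] Suc by simp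
  moreover have "bag_pos (cells xs) (Suc t) = next_bag (cells xs) (bag_pos (cells xs) t)"
    by (simp add: bag_pos_def)
  ultimately show ?case using Suc
    by (simp add: next_bag_def holds_def take_Suc_conv_app_nth length_enc)
qed (simp add: p)

definition enc_member :: "nat list \<times> (nat \<times> nat) list \<Rightarrow> nat list" where
  "enc_member = (\<lambda>(vs, es). enc_set vs @ enc_edges es)"

lemma member_pos_eq:
  assumes seg: "seg xs p (concat (map enc_member fam))" and p: "member_pos (cells xs) 0 = p" and "j \<le> length fam"
  shows "member_pos (cells xs) j = p + sum_list (map (\<lambda>h. length (enc_member h)) (take j fam))"
  using assms(3)
proof (induction j)
  case (Suc j)
  obtain vs es where h: "fam ! j = (vs, es)" by (cases "fam ! j")
  have pj: "member_pos (cells xs) j = p + sum_list (map (\<lambda>h. length (enc_member h)) (take j fam))"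
    using Suc by simp
  have "seg xs (member_pos (cells xs) j) (enc_set vs @ enc_edges es)"
    using seg_concat[OF seg, of j] Suc.prems unfolding pj by (simp add: enc_member_def h)
  then have "holds (cells xs) (member_pos (cells xs) j) vs"
    "holds_edges (cells xs) (member_pos (cells xs) j + length (enc_set vs)) es"
    using seg_append seg_enc_set seg_enc_edges by blast+
  moreover have "member_pos (cells xs) (Suc j) = next_member (cells xs) (member_pos (cells xs) j)"
    by (simp add: member_pos_def)
  ultimately have "member_pos (cells xs) (Suc j) = member_pos (cells xs) j + length (enc_member (fam ! j))"
    by (simp add: next_member_def holds_def holds_edges_def h enc_member_def length_enc Let_def)
  then show ?case using pj Suc.prems by (simp add: take_Suc_conv_app_nth)
qed (simp add: p)

lemma encoding_layout:
  assumes xs: "xs = [n, m, q] @ enc_edges gs @ enc_edges ts @ concat (map enc_set bags) @ concat (map enc_member fam)"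
    and len: "length bags = q" "length fam = m"
  shows "cells xs 1 = m" "cells xs 2 = q" "holds_edges (cells xs) 3 gs"
    and "holds_edges (cells xs) (tree_pos (cells xs)) ts"
    and "t < q \<Longrightarrow> holds (cells xs) (bag_pos (cells xs) t) (bags ! t)"
    and "j < m \<Longrightarrow> holds (cells xs) (member_pos (cells xs) j) (fst (fam ! j))"
proof -
  show m: "cells xs 1 = m" "cells xs 2 = q" by (simp_all add: xs cells_def)
  have s3: "seg xs 3 (enc_edges gs @ enc_edges ts @ concat (map enc_set bags) @ concat (map enc_member fam))"
    unfolding seg_def xs by (intro exI[of _ "[n, m, q]"] exI[of _ "[]"]) simp
  note s4 = seg_append(2)[OF s3]
  note s5 = seg_append(2)[OF s4]
  note s6 = seg_append(2)[OF s5]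
  show gs: "holds_edges (cells xs) 3 gs" using seg_append(1)[OF s3] by (rule seg_enc_edges)
  have tp: "tree_pos (cells xs) = 3 + length (enc_edges gs)"
    using gs by (simp add: tree_pos_def holds_edges_def length_enc)
  show ts: "holds_edges (cells xs) (tree_pos (cells xs)) ts"
    unfolding tp using seg_append(1)[OF s4] by (rule seg_enc_edges)
  have b0: "bag_pos (cells xs) 0 = 3 + length (enc_edges gs) + length (enc_edges ts)"
    using ts unfolding bag_pos_def by (simp add: holds_edges_def tp length_enc)
  note bp = bag_pos_eq[OF seg_append(1)[OF s5] b0]
  show "holds (cells xs) (bag_pos (cells xs) t) (bags ! t)" if "t < q"
    using seg_enc_set[OF seg_concat[OF seg_append(1)[OF s5], of t]] bp[of t] that len by simp
  have "length (concat (map enc_set bags)) = sum_list (map (\<lambda>b. length (enc_set b)) bags)"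
    by (simp add: length_concat comp_def)
  then have m0: "member_pos (cells xs) 0 =
      3 + length (enc_edges gs) + length (enc_edges ts) + length (concat (map enc_set bags))"
    using bp[of q] len m(2) by (simp add: member_pos_def)
  show "holds (cells xs) (member_pos (cells xs) j) (fst (fam ! j))" if "j < m"
  proof -
    have "seg xs (member_pos (cells xs) j) (enc_member (fam ! j))"
      using seg_concat[OF s6, of j] member_pos_eq[OF s6 m0, of j] that len by simp
    then have "seg xs (member_pos (cells xs) j) (enc_set (fst (fam ! j)) @ enc_edges (snd (fam ! j)))"
      by (simp add: enc_member_def case_prod_beta)
    then show ?thesis using seg_append(1) seg_enc_set by blast
  qed
qed

section \<open>The time bound\<close>

text \<open>Every summand is at most a constant times \<open>D\<close>. The factor
  \<open>k + 1\<close> in \<open>D\<close> covers the estimate \<open>num_codes_le\<close>, applied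
  to the product \<open>q * m * K\<close> that dominates all other terms with \<open>K\<close>, and
  the \<open>k\<close> multiplications in \<open>code_count\<close>.\<close>

lemma time_bound:
  fixes k m n q g l :: nat
  assumes "m > 0" "n > 0" "q > 0" "l \<le> q"
  defines "K \<equiv> num_codes m k"
  shows "1 + 4 + (setup_time k m n q g l +
    ((2 * q * (K * m * 500 + 90) + 10) + (K * 120 + m * 90 + 40)))
    \<le> 10000 * (k + 1) * (m * ((m + q) * n + g + m ^ k * q))"
proof -
  define Z where "Z = m * ((m + q) * n + g + m ^ k * q)"
  define D where "D = (k + 1) * Z"
  have Zeq: "Z = m * m * n + q * m * n + m * g + m * m ^ k * q" by (simp add: Z_def algebra_simps)
  have "Z \<le> D" by (simp add: D_def)
  have p1: "1 \<le> m * n" "m * n \<le> m * m * n" "m \<le> m * n" "q \<le> q * m * n"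
    using assms by (simp_all add: Suc_le_eq mult.assoc)
  have big: "m * m * n \<le> Z" "q * m * n \<le> Z" "m * g \<le> Z" unfolding Zeq by simp_all
  have mn: "m * n \<le> Z" "m \<le> Z" "1 \<le> Z" "q \<le> Z" "m * g \<le> Z" "m * m * n \<le> Z" "q * m * n \<le> Z"
    using p1 big by linarith+
  have qm: "q * m \<le> q * m * n" "m * m \<le> m * m * n" using assms by (simp_all add: Suc_le_eq)
  have "K \<le> Suc k * m ^ k" unfolding K_def using assms(1) by (rule num_codes_le)
  then have "(q * m) * K \<le> (q * m) * (Suc k * m ^ k)" by (rule mult_le_mono2)
  also have "\<dots> = Suc k * (m * m ^ k * q)" by (simp add: algebra_simps)
  also have "\<dots> \<le> Suc k * Z" unfolding Zeq by (intro mult_le_mono2) simp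
  also have "\<dots> = D" by (simp add: D_def)
  finally have W: "q * m * K \<le> D" .
  have w: "1 \<le> q * m" "q \<le> q * m" "m \<le> q * m" using assms by (simp_all add: Suc_le_eq)
  have "1 * K \<le> q * m * K" using w(1) by (rule mult_le_mono1)
  then have K: "K \<le> D" "q * K \<le> D" "m * K \<le> D"
    using order_trans[OF mult_le_mono1[OF w(2), of K] W] order_trans[OF mult_le_mono1[OF w(3), of K] W] W
    by linarith+
  have k: "(k + 1) * (m + 1) \<le> 2 * D"
  proof -
    have "(k + 1) * (m + 1) \<le> (k + 1) * (Z + Z)" using mn by (intro mult_le_mono2 add_mono)
    also have "\<dots> = 2 * D" by (simp add: D_def algebra_simps)
    finally show ?thesis .
  qed
  have e: "q * m * (n + 1) = q * m * n + q * m" "m * (m * (n + 1) + g) = m * m * n + m * m + m * g"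
    "2 * q * (K * m * 500 + 90) = 1000 * (q * m * K) + 180 * q" "K * m * 140 = 140 * (m * K)"
    by (simp_all add: algebra_simps)
  have "1 \<le> D" using \<open>Z \<le> D\<close> mn by linarith
  have r: "10000 * (k + 1) * Z = 10000 * D" by (simp add: D_def algebra_simps)
  \<comment> \<open>Products appear as variables here, so that the inequality is linear. The
    coefficients on the left add up to less than 7000; 10000 is a round upper bound.\<close>
  have sum: "1 + 4 + (a * 100 + ((qK + q + 2) * 90 + ((q + m + 3) * 80 + ((b + qm) * 400 + 20 +
      ((c + mm + mg) * 700 + 20 + (K * 100 + (K * 130 + (K * 130 + (140 * mK + (qK * 200 + 20 + (l + 1) * 200))))))))) +
      (1000 * W + 180 * q + 10 + (K * 120 + m * 90 + 40))) \<le> 10000 * D"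
    if "a \<le> 2 * D" "qK \<le> D" "q \<le> D" "m \<le> D" "b \<le> D" "qm \<le> D" "c \<le> D" "mm \<le> D" "mg \<le> D"
      "K \<le> D" "mK \<le> D" "l \<le> D" "W \<le> D" "1 \<le> D" for a qK b qm c mm mg mK W :: nat
    unfolding add_mult_distrib using that by linarith
  have "q \<le> D" "m \<le> D" "q * m * n \<le> D" "q * m \<le> D" "m * m * n \<le> D" "m * m \<le> D" "m * g \<le> D" "l \<le> D"
    using mn qm \<open>Z \<le> D\<close> \<open>l \<le> q\<close> by linarith+
  then show ?thesis unfolding Z_def[symmetric] setup_time_def Let_def K_def[symmetric] r e
    by (intro sum K W k \<open>1 \<le> D\<close>)
qed

theorem theorem7p2:
  fixes k :: nat
  assumes "k \<ge> 1"
  shows "\<exists>(P :: com) (C :: nat).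
    \<forall>(G :: nat graph) (J :: nat set) (H :: nat \<Rightarrow> nat graph) (w :: nat \<Rightarrow> rat)
      (T :: nat graph) (X :: nat \<Rightarrow> nat set) (xs :: nat list) (ws :: rat list).
      simple_graph G \<longrightarrow>
      finite J \<longrightarrow>
      (\<forall>j\<in>J. subgraph (H j) G \<and> connected_graph (H j) \<and> nonnull (H j)) \<longrightarrow>
      (\<forall>j\<in>J. 0 \<le> w j) \<longrightarrow>
      tree_decomposition G T X \<longrightarrow>
      td_independence_number G T X \<le> k \<longrightarrow>
      encodes xs ws G J H w T X \<longrightarrow>
      (\<exists>c s. run P (init_state xs ws) c s \<and>
             max_weight_independent_packing G J H w (output_set J s) \<and>
             c \<le> C * max 1 (card J * ((card J + card (verts T)) * card (verts G)
                                + card (edges G) + card J ^ k * card (verts T))))"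
proof (rule exI[of _ "solve k"], rule exI[of _ "10000 * (k + 1)"], intro allI impI)
  fix G :: "nat graph" and J :: "nat set" and H :: "nat \<Rightarrow> nat graph" and w :: "nat \<Rightarrow> rat"
    and T :: "nat graph" and X :: "nat \<Rightarrow> nat set" and xs :: "nat list" and ws :: "rat list"
  assume G: "simple_graph G" and "finite J"
    and H: "\<forall>j\<in>J. subgraph (H j) G \<and> connected_graph (H j) \<and> nonnull (H j)"
    and "\<forall>j\<in>J. 0 \<le> w j" and td: "tree_decomposition G T X"
    and ind: "td_independence_number G T X \<le> k" and "encodes xs ws G J H w T X"
  let ?B = "card J * ((card J + card (verts T)) * card (verts G) + card (edges G) + card J ^ k * card (verts T))"
  from \<open>encodes xs ws G J H w T X\<close> obtain n m q gs ts bags fam where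
    VG: "verts G = {..<n}" and J: "J = {..<m}" and VT: "verts T = {..<q}"
    and gs: "lists_edges gs (edges G)" and ts: "lists_edges ts (edges T)"
    and len: "length bags = q" "length fam = m"
    and bags: "\<And>t. t < q \<Longrightarrow> lists_set (bags ! t) (X t)"
    and fam: "\<And>j. j < m \<Longrightarrow> lists_set (fst (fam ! j)) (verts (H j))"
    and xs: "xs = [n, m, q] @ enc_edges gs @ enc_edges ts @ concat (map enc_set bags) @ concat (map enc_member fam)"
    and ws: "ws = map w [0..<m]"
    unfolding encodes_def enc_member_def by blast
  define inp where "inp = cells xs"
  define wt where "wt = (\<lambda>i. if i < length ws then ws ! i else 0)"
  have init: "nmem (init_state xs ws) 0 = inp" "wmem (init_state xs ws) 0 = wt"
    "a \<noteq> 0 \<Longrightarrow> nmem (init_state xs ws) a = (\<lambda>_. 0)" "a \<noteq> 0 \<Longrightarrow> wmem (init_state xs ws) a = (\<lambda>_. 0)" for a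
    by (auto simp: init_state_def inp_def wt_def cells_def)
  have wt: "sum wt I = sum w I" if "I \<subseteq> J" for I
    by (rule sum.cong) (use that in \<open>auto simp: wt_def ws J\<close>)
  note lay = encoding_layout[OF xs len, folded inp_def]
  show "\<exists>c s. run (solve k) (init_state xs ws) c s \<and> max_weight_independent_packing G J H w (output_set J s) \<and>
             c \<le> 10000 * (k + 1) * max 1 ?B"
  \<comment> \<open>Without members the product in the bound is 0 while the initial test still takes
    time, which \<open>max 1\<close> pays for.\<close>
  proof (cases "m = 0")
    case True
    have "ht (solve k) (init_state xs ws) 10 (\<lambda>_. True)"
      unfolding solve_def
      by (rule ht_If[where d = 2]) (use lay(1) init True in \<open>auto intro: ht_loop_free\<close>)
    then obtain c s where "run (solve k) (init_state xs ws) c s" "c \<le> 10" unfolding ht_def by blast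
    moreover have "max_weight_independent_packing G J H w (output_set J s)"
      using True by (auto simp: J max_weight_independent_packing_def independent_packing_def output_set_def)
    moreover have "10 \<le> 10000 * (k + 1) * max 1 ?B" by (simp add: True J)
    ultimately show ?thesis using order_trans by blast
  next
    case False
    then have m: "m > 0" by simp
    define vs where "vs = (\<lambda>j. fst (fam ! j))"
    define bag where "bag = (\<lambda>t. bags ! t)"
    have setvs: "set (vs j) = verts (H j)" and dvs: "distinct (vs j)" if "j < m" for j
      using fam[OF that] by (auto simp: lists_set_def vs_def)
    have setbag: "set (bag t) = X t" and dbag: "distinct (bag t)" if "t < q" for t
      using bags[OF that] by (auto simp: lists_set_def bag_def)
    have HG: "verts (H j) \<subseteq> {..<n}" "verts (H j) \<noteq> {}" if "j < m" for j
      using H that by (auto simp: J subgraph_def nonnull_def VG)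
    have XG: "X t \<subseteq> {..<n}" if "t < q" for t using td that by (simp add: tree_decomposition_def VT VG)
    \<comment> \<open>A member is nonnull, so \<open>G\<close> has a vertex;
      \<open>time_bound\<close> needs this to absorb terms that lack the factor
      \<open>n\<close>.\<close>
    have n: "n > 0" using HG[OF m] by auto
    have isT: "is_tree T" using td by (simp add: tree_decomposition_def)
    then have q: "q > 0" using VT by (cases q) (auto simp: is_tree_def nonnull_def)
    have Teq: "Graph {..<q} (edges T) = T" using VT by (cases T) simp
    have edgesG: "edges G = set (map (\<lambda>(u, v). {u, v}) gs)" and edgesT: "edges T = set (map (\<lambda>(u, v). {u, v}) ts)"
      and dts: "distinct (map (\<lambda>(u, v). {u, v}) ts)" and dgs: "distinct (map (\<lambda>(u, v). {u, v}) gs)"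
      using gs ts by (auto simp: lists_edges_def)
    interpret layout inp wt k n m q gs ts bag vs
    proof
      show "holds inp (bag_pos inp t) (bag t) \<and> length (bag t) \<le> n" if "t < q" for t
        using lay(5)[OF that] card_mono[OF _ XG[OF that]] setbag[OF that] distinct_card[OF dbag[OF that]]
        by (simp add: bag_def)
      show "holds inp (member_pos inp j) (vs j) \<and> length (vs j) \<le> n" if "j < m" for j
        using lay(6)[OF that] card_mono[OF _ HG(1)[OF that]] setvs[OF that] distinct_card[OF dvs[OF that]]
        by (simp add: vs_def)
      show "vs j \<noteq> []" if "j < m" for j using HG(2)[OF that] setvs[OF that] by auto
    qed (use assms m q lay in auto)
    have Y: "Y t = hits J H X t" if "t < q" for t
      using setvs setbag[OF that] by (auto simp: Y_def hits_def J)
    have "{u, v} = (\<lambda>(u, v). {u, v}) e \<longleftrightarrow> fst e = u \<and> snd e = v \<or> fst e = v \<and> snd e = u"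
      for u v :: nat and e
      by (cases e) (auto simp: doubleton_eq_iff)
    then have edge: "{u, v} \<in> edges G \<longleftrightarrow> (\<exists>e\<in>set gs. fst e = u \<and> snd e = v \<or> fst e = v \<and> snd e = u)" for u v
      unfolding edgesG set_map image_iff by simp
    have cf: "cf i j \<longleftrightarrow> conflict G H i j" if "i < m" "j < m" for i j
      unfolding cf_def conflict_def edge setvs[OF that(1)] setvs[OF that(2)] by blast
    have cfree: "conflict_free cf I \<longleftrightarrow> conflict_free (conflict G H) I" if "I \<subseteq> {..<m}" for I
      using cf that unfolding conflict_free_def by blast
    interpret dp inp wt k n m q gs ts bag vs "edges T"
    proof
      show "is_tree (Graph {..<q} (edges T))" using isT by (simp add: Teq)
      show "cut_connected (edges T) {t. t < q \<and> j \<in> Y t}" if "j < m" for j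
      proof -
        have "{t. t < q \<and> j \<in> Y t} = {t \<in> verts T. j \<in> hits J H X t}" using Y VT by auto
        then show ?thesis using hits_cut_connected[OF td, of j J H] H that J by simp
      qed
      show "\<exists>t<q. i \<in> Y t \<and> j \<in> Y t" if "i < m" "j < m" "cf i j" for i j
        using conflict_share_bag[OF td, of H i j J] cf[OF that(1,2)] that HG Y by (auto simp: VT J VG)
      show "card I \<le> k" if "t < q" "I \<subseteq> Y t" "conflict_free cf I" for t I
      proof -
        have "I \<subseteq> {..<m}" using that(2) by (auto simp: Y_def)
        then show ?thesis
          using card_conflict_free_hits[OF td G ind, of t I J H] that cfree Y by (simp add: VT)
      qed
    qed (rule edgesT dts)+
    have "tables 10 (init_state xs ws)" using init by (simp add: tables_def ok_scratch)
    from ht_solve[OF this] obtain c s where run: "run (solve k) (init_state xs ws) c s"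
      and c: "c \<le> 1 + bcost (NonZero eM) + (setup_time k m n q (length gs) (length ts) +
    ((2 * q * (K * m * 500 + 90) + 10) + (K * 120 + m * 90 + 40)))"
      and out: "best_output s"
      unfolding ht_def by blast
    have sub: "output_set J s \<subseteq> {..<m}" by (auto simp: output_set_def J)
    have "conflict_free cf (output_set J s)"
      "\<And>I. I \<subseteq> {..<m} \<Longrightarrow> conflict_free cf I \<Longrightarrow> sum wt I \<le> sum wt (output_set J s)"
      using out unfolding best_output_def Let_def by (simp_all add: output_set_def J)
    then have "max_weight_independent_packing G J H w (output_set J s)"
      unfolding max_weight_independent_packing_def independent_packing_iff
      using sub cfree[OF sub] cfree wt[unfolded J] unfolding J[symmetric] by metis
    moreover have "c \<le> 10000 * (k + 1) * max 1 ?B"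
    proof -
      \<comment> \<open>This supplies the condition on the length of the tree edge list in
        \<open>time_bound\<close>.\<close>
      have "card (edges T) \<le> card (verts T)" using isT by (intro acyclic_card_edges) (auto simp: is_tree_def)
      moreover have "length ts = card (edges T)" "length gs = card (edges G)"
        using distinct_card[OF dts] distinct_card[OF dgs] edgesT edgesG by simp_all
      ultimately have "c \<le> 10000 * (k + 1) * ?B"
        using c time_bound[OF m n q, of "length ts" k "length gs"] VT by (simp add: J VG)
      also have "\<dots> \<le> 10000 * (k + 1) * max 1 ?B" by (intro mult_left_mono) auto
      finally show ?thesis .
    qed
    ultimately show ?thesis using run by blast
  qed
qed

end
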